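(* Let $(X,0)=(X^{(1)}\cup\cdots\cup X^{(r)},0)$ be a germ of singular reduced complex analytic curve in $(\mathbb{C}^n,0)$, $n\geq 2$, with branches $(X^{(i)},0)$ of multiplicity $m^{(i)}$. Then $$\sharp\{\mathrm{Irred}(C_5(X,0))\}\le \sum_{i\in S(X)}\bigl(\sharp\, ChAM(X^{(i)},0)-1\bigr)+\sum_{(i,j)\in T(X)}\gcd\bigl(m^{(i)},m^{(j)}\bigr)+\sharp\, NT(X).$$ In particular, if $(X,0)$ is irreducible, then $\sharp\{\mathrm{Irred}(C_5(X,0))\}\le\sharp\, ChAM(X,0)-1$.
   Context: **The cone $C_5$.** For an analytic germ $(X,0)\subset(\mathbb{C}^n,0)$, $C_5(X,0)$ is the set of $v\in\mathbb{C}^n$ for which there are sequences of points $w_s,w'_s\in X$ with $w_s\ne w'_s$, $w_s\to0$, $w'_s\to0$, and numbers $\lambda_s\in\mathbb{C}$ such that $\lambda_s(w_s-w'_s)\to v$. For a singular reduced curve germ, $C_5(X,0)$ is a finite union of two-dimensional complex linear subspaces (planes); $\sharp\{\mathrm{Irred}(C_5(X,0))\}$ is the number of its irreducible components, with $C_5(X,0)$ considered as a reduced analytic set. **Index sets.** $S(X)\subset\{1,\dots,r\}$ is the set of $i$ such that $(X^{(i)},0)$ is singular; $T(X)$ is the set of pairs $(i,j)$ with $i<j$ such that $X^{(i)}$ and $X^{(j)}$ have the same tangent line at $0$; $NT(X)$ is the set of pairs $(i,j)$ with $i<j$ such that they have different tangent lines at $0$. **Characteristic auxiliary multiplicities.**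 Let $(Z,0)\subset(\mathbb{C}^n,0)$ be a reduced irreducible singular curve germ of multiplicity $m$. A primitive parametrization is a finite holomorphic map germ $\varphi:(\mathbb{C},0)\to(\mathbb{C}^n,0)$ with image $(Z,0)$ through which every other finite holomorphic map germ $(\mathbb{C},0)\to(\mathbb{C}^n,0)$ with image $(Z,0)$ factors uniquely. It is a Puiseux parametrization if all its coordinates have order $\ge m$ at $0$ and at least one coordinate is exactly $u^m$; such parametrizations always exist. Let $G_m$ be the group of $m$-th roots of unity and let $\mathrm{ord}_0$ be the order of a power series at $0$ ($\mathrm{ord}_0(0)=\infty$). For $\theta\in G_m\setminus\{1\}$ put $m_\theta=\min_j\mathrm{ord}_0[\varphi_j(u)-\varphi_j(\theta u)]$. Then $ChAM(Z,0)$ is the set $\{m\}\cup\{m_\theta:\theta\in G_m\setminus\{1\}\}$ (counted without repetition); it does not depend on the chosen Puiseux parametrization $\varphi$. *)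

theory Defs
  imports "HOL-Complex_Analysis.Complex_Analysis" "HOL-Library.Extended_Nat"
begin

section \<open>Analytic sets and germs in complex n-space\<close>

text \<open>A germ at the origin is given by any representing set; only its behaviour near the
  origin matters. All spaces are reduced, so analytic sets are just sets of points.\<close>

definition cholomorphic_on :: "(complex ^ 'n \<Rightarrow> complex) \<Rightarrow> (complex ^ 'n) set \<Rightarrow> bool" where
  "cholomorphic_on f V \<longleftrightarrow>
     (\<forall>z\<in>V. \<exists>f'. (f has_derivative f') (at z) \<and> (\<forall>c x. f' (c *s x) = c * f' x))"

definition analytic_at :: "(complex ^ 'n) set \<Rightarrow> complex ^ 'n \<Rightarrow> bool" where
  "analytic_at A p \<longleftrightarrow>
     (\<exists>V F. open V \<and> p \<in> V \<and> finite F \<and> (\<forall>f\<in>F. cholomorphic_on f V) \<and>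
            A \<inter> V = {z \<in> V. \<forall>f\<in>F. f z = 0})"

definition germ_le :: "(complex ^ 'n) set \<Rightarrow> (complex ^ 'n) set \<Rightarrow> bool" where
  "germ_le A B \<longleftrightarrow> (\<forall>\<^sub>F z in nhds 0. z \<in> A \<longrightarrow> z \<in> B)"

definition germ_eq :: "(complex ^ 'n) set \<Rightarrow> (complex ^ 'n) set \<Rightarrow> bool" where
  "germ_eq A B \<longleftrightarrow> (\<forall>\<^sub>F z in nhds 0. z \<in> A \<longleftrightarrow> z \<in> B)"

definition irreducible_germ :: "(complex ^ 'n) set \<Rightarrow> bool" where
  "irreducible_germ Z \<longleftrightarrow> analytic_at Z 0 \<and> 0 \<in> Z \<and>
     (\<forall>A B. analytic_at A 0 \<and> analytic_at B 0 \<and> germ_eq Z (A \<union> B)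
              \<longrightarrow> germ_eq Z A \<or> germ_eq Z B)"

text \<open>Irreducible components of a global analytic subset of complex n-space.\<close>

definition irreducible_analytic_set :: "(complex ^ 'n) set \<Rightarrow> bool" where
  "irreducible_analytic_set Z \<longleftrightarrow> (\<forall>p. analytic_at Z p) \<and> Z \<noteq> {} \<and>
     (\<forall>A B. (\<forall>p. analytic_at A p) \<and> (\<forall>p. analytic_at B p) \<and> Z = A \<union> B
              \<longrightarrow> Z = A \<or> Z = B)"

definition irreducible_components :: "(complex ^ 'n) set \<Rightarrow> (complex ^ 'n) set set" where
  "irreducible_components A =
     {Z. irreducible_analytic_set Z \<and> Z \<subseteq> A \<and>
         (\<forall>W. irreducible_analytic_set W \<and> Z \<subseteq> W \<and> W \<subseteq> A \<longrightarrow> W = Z)}"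


section \<open>Curve germs\<close>

text \<open>Near \<open>p\<close> the set \<open>Z\<close> is a one-dimensional complex submanifold: some biholomorphic chart
  (with inverse \<open>\<Psi>\<close>) straightens it to a coordinate axis.\<close>

definition smooth_curve_at :: "(complex ^ 'n) set \<Rightarrow> complex ^ 'n \<Rightarrow> bool" where
  "smooth_curve_at Z p \<longleftrightarrow>
     (\<exists>V W (\<Phi> :: complex ^ 'n \<Rightarrow> complex ^ 'n) (\<Psi> :: complex ^ 'n \<Rightarrow> complex ^ 'n) j.
        open V \<and> open W \<and> p \<in> V \<and> p \<in> Z \<and> \<Phi> p = 0 \<and>
        (\<forall>k. cholomorphic_on (\<lambda>z. \<Phi> z $ k) V) \<and> (\<forall>k. cholomorphic_on (\<lambda>w. \<Psi> w $ k) W) \<and>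
        \<Phi> ` V = W \<and> (\<forall>z\<in>V. \<Psi> (\<Phi> z) = z) \<and>
        \<Phi> ` (Z \<inter> V) = {w \<in> W. \<forall>k. k \<noteq> j \<longrightarrow> w $ k = 0})"

text \<open>A curve germ is an analytic germ of pure dimension one: the points at which it is a
  one-dimensional submanifold are dense in it near the origin.\<close>

definition curve_germ :: "(complex ^ 'n) set \<Rightarrow> bool" where
  "curve_germ X \<longleftrightarrow> analytic_at X 0 \<and> 0 \<in> X \<and>
     (\<exists>U. open U \<and> 0 \<in> U \<and> X \<inter> U \<subseteq> closure {p \<in> X. smooth_curve_at X p})"

definition branches :: "(complex ^ 'n) set \<Rightarrow> nat \<Rightarrow> (nat \<Rightarrow> (complex ^ 'n) set) \<Rightarrow> bool" where
  "branches X r B \<longleftrightarrow>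
     (\<forall>i\<in>{1..r}. irreducible_germ (B i)) \<and>
     germ_eq X (\<Union>i\<in>{1..r}. B i) \<and>
     (\<forall>i\<in>{1..r}. \<forall>j\<in>{1..r}. i \<noteq> j \<longrightarrow> \<not> germ_le (B i) (B j))"

text \<open>Multiplicity of a reduced curve germ: the least number of sheets of a linear projection
  \<open>z \<mapsto> \<Sum>k. a k * z k\<close> to the line whose restriction to \<open>Z\<close> is finite at the origin, i.e. the
  number of points close to the origin in which a generic affine hyperplane close to the
  origin meets \<open>Z\<close>. The isolatedness condition excludes the forms vanishing on \<open>Z\<close>, whose
  nonzero fibres are empty.\<close>

definition multiplicity_germ :: "(complex ^ 'n) set \<Rightarrow> nat" where
  "multiplicity_germ Z =
     (LEAST m. \<exists>a :: complex ^ 'n.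
        (\<forall>\<^sub>F z in at 0. z \<in> Z \<longrightarrow> (\<Sum>k\<in>UNIV. a $ k * z $ k) \<noteq> 0) \<and>
        (\<forall>\<^sub>F \<epsilon> in at_right 0. \<forall>\<^sub>F t in at 0.
           finite {z \<in> Z. norm z < \<epsilon> \<and> (\<Sum>k\<in>UNIV. a $ k * z $ k) = t} \<and>
           card {z \<in> Z. norm z < \<epsilon> \<and> (\<Sum>k\<in>UNIV. a $ k * z $ k) = t} = m))"

text \<open>For an irreducible curve germ the tangent cone is its tangent line.\<close>

definition tangent_cone :: "(complex ^ 'n) set \<Rightarrow> (complex ^ 'n) set" where
  "tangent_cone Z =
     {v. \<exists>w c. (\<forall>s::nat. w s \<in> Z) \<and> w \<longlonglongrightarrow> 0 \<and> (\<lambda>s. c s *s w s) \<longlonglongrightarrow> v}"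

definition C5 :: "(complex ^ 'n) set \<Rightarrow> (complex ^ 'n) set" where
  "C5 X =
     {v. \<exists>w w' c. (\<forall>s::nat. w s \<in> X \<and> w' s \<in> X \<and> w s \<noteq> w' s) \<and>
           w \<longlonglongrightarrow> 0 \<and> w' \<longlonglongrightarrow> 0 \<and> (\<lambda>s. c s *s (w s - w' s)) \<longlonglongrightarrow> v}"

definition S_index :: "nat \<Rightarrow> (nat \<Rightarrow> (complex ^ 'n) set) \<Rightarrow> nat set" where
  "S_index r B = {i \<in> {1..r}. \<not> smooth_curve_at (B i) 0}"

definition T_index :: "nat \<Rightarrow> (nat \<Rightarrow> (complex ^ 'n) set) \<Rightarrow> (nat \<times> nat) set" where
  "T_index r B = {(i, j). i \<in> {1..r} \<and> j \<in> {1..r} \<and> i < j \<and>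
                          tangent_cone (B i) = tangent_cone (B j)}"

definition NT_index :: "nat \<Rightarrow> (nat \<Rightarrow> (complex ^ 'n) set) \<Rightarrow> (nat \<times> nat) set" where
  "NT_index r B = {(i, j). i \<in> {1..r} \<and> j \<in> {1..r} \<and> i < j \<and>
                           tangent_cone (B i) \<noteq> tangent_cone (B j)}"


section \<open>Parametrizations and characteristic auxiliary multiplicities\<close>

definition finite_param :: "(complex \<Rightarrow> complex ^ 'n) \<Rightarrow> (complex ^ 'n) set \<Rightarrow> bool" where
  "finite_param \<phi> Z \<longleftrightarrow>
     (\<forall>j. (\<lambda>u. \<phi> u $ j) analytic_on {0}) \<and> \<phi> 0 = 0 \<and>
     (\<forall>\<^sub>F u in at 0. \<phi> u \<noteq> 0) \<and>
     (\<forall>\<^sub>F \<epsilon> in at_right 0. germ_eq (\<phi> ` ball 0 \<epsilon>) Z)"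

definition factors_by ::
    "(complex \<Rightarrow> complex ^ 'n) \<Rightarrow> (complex \<Rightarrow> complex ^ 'n) \<Rightarrow> (complex \<Rightarrow> complex) \<Rightarrow> bool" where
  "factors_by \<psi> \<phi> \<tau> \<longleftrightarrow>
     \<tau> analytic_on {0} \<and> \<tau> 0 = 0 \<and> (\<forall>\<^sub>F u in nhds 0. \<psi> u = \<phi> (\<tau> u))"

definition primitive_param :: "(complex \<Rightarrow> complex ^ 'n) \<Rightarrow> (complex ^ 'n) set \<Rightarrow> bool" where
  "primitive_param \<phi> Z \<longleftrightarrow> finite_param \<phi> Z \<and>
     (\<forall>\<psi>. finite_param \<psi> Z \<longrightarrow>
        (\<exists>\<tau>. factors_by \<psi> \<phi> \<tau> \<and>
             (\<forall>\<tau>'. factors_by \<psi> \<phi> \<tau>' \<longrightarrow> (\<forall>\<^sub>F u in nhds 0. \<tau>' u = \<tau> u))))"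

definition ord0 :: "(complex \<Rightarrow> complex) \<Rightarrow> enat" where
  "ord0 f = (INF k \<in> {k. fps_nth (fps_expansion f 0) k \<noteq> 0}. enat k)"

definition puiseux_param :: "(complex \<Rightarrow> complex ^ 'n) \<Rightarrow> (complex ^ 'n) set \<Rightarrow> bool" where
  "puiseux_param \<phi> Z \<longleftrightarrow> primitive_param \<phi> Z \<and>
     (\<forall>j. ord0 (\<lambda>u. \<phi> u $ j) \<ge> enat (multiplicity_germ Z)) \<and>
     (\<exists>j. \<forall>\<^sub>F u in nhds 0. \<phi> u $ j = u ^ multiplicity_germ Z)"

text \<open>The characteristic auxiliary multiplicities of \<open>Z\<close>, computed from the Puiseux
  parametrization \<open>\<phi>\<close> of \<open>Z\<close>; the result does not depend on the choice of \<open>\<phi>\<close>.\<close>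

definition ChAM :: "(complex ^ 'n) set \<Rightarrow> (complex \<Rightarrow> complex ^ 'n) \<Rightarrow> enat set" where
  "ChAM Z \<phi> = insert (enat (multiplicity_germ Z))
     ((\<lambda>\<theta>. INF j. ord0 (\<lambda>u. \<phi> u $ j - \<phi> (\<theta> * u) $ j)) `
        {\<theta>. \<theta> ^ multiplicity_germ Z = 1 \<and> \<theta> \<noteq> 1})"

end

theory Submission
  imports Defs
begin

text \<open>Parametrize branches so that a coordinate not vanishing on the tangent line is
  \<open>u ^ m\<close>, and split a secant between \<open>\<phi> u\<close> and \<open>\<psi> v\<close> at the point \<open>\<phi> u'\<close>, where \<open>u'\<close> is the
  \<open>m\<close>-th root of \<open>v ^ n\<close> nearest to \<open>u\<close>. The first part is \<open>u ^ m - v ^ n\<close> times a vector close to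
  the tangent vector \<open>t\<close>; the second part lies on one of the arcs obtained by parametrizing the
  solutions of \<open>u ^ m = v ^ n\<close>, so its direction tends to the leading coefficient \<open>w\<close> of that arc.
  Hence the limits of secants are exactly the planes spanned by \<open>t\<close> and the vectors \<open>w\<close>. Two
  branches with a common tangent have \<open>gcd m n\<close> arcs up to reparametrization. For a single branch
  the arc is \<open>\<phi> s - \<phi> (\<theta> * s)\<close>, and its leading coefficient is a multiple of the coefficient of
  \<open>\<phi>\<close> whose index is the order of the arc, so that the plane depends only on this order. Branches
  with different tangents contribute the plane of the two tangent lines. Finally every irreducible
  component of a finite union of planes is one of these planes.\<close>

text \<open>The scalars in a secant limit are unbounded, so every error must be small relative to
  \<open>u ^ m - v ^ n\<close>. An arbitrary root u' of v ^ n does not achieve this: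
  \<open>\<phi> u - \<phi> u'\<close> may be nonzero while \<open>u ^ m - v ^ n\<close> is zero. For
  the nearest root, |u - u'| max(|u|, |u'|)^(m-1) is bounded by a constant times |u ^ m - v ^ n|,
  and increments of the terms of order above \<open>m\<close> are negligible against the left-hand
  side. Smooth branches have no term in the first sum, although their own secants have limits as
  well; this is where the singularity of \<open>X\<close> enters. The multiplicity, defined by
  counting sheets, is never computed. On singular branches the Puiseux parametrization supplies it
  as an exponent. Smooth branches are parametrized with exponent 1, and positivity of their
  multiplicity is enough to compare the gcds.\<close>

no_notation fps_nth (infixl \<open>$\<close> 75)

section \<open>Leading terms of analytic arcs\<close>

text \<open>The coefficient of index \<open>k\<close> may itself vanish, so \<open>k\<close> is only
  a lower bound for the order. This lets all coordinates of a vector-valued arc be divided by one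
  common power of the variable.\<close>

lemma analytic_factor_power:
  fixes f :: "complex \<Rightarrow> complex"
  assumes f: "f analytic_on {0}" and z: "\<And>i. i < k \<Longrightarrow> fps_nth (fps_expansion f 0) i = 0"
  obtains h where "h analytic_on {0}" "h 0 = fps_nth (fps_expansion f 0) k"
    "\<forall>\<^sub>F u in nhds 0. f u = u ^ k * h u"
proof (cases "fps_expansion f 0 = 0")
  case True
  then have "f has_fps_expansion 0"
    using analytic_at_imp_has_fps_expansion_0[OF f] by simp
  then have "\<forall>\<^sub>F u in nhds 0. f u = 0"
    by (auto simp: has_fps_expansion_def elim: eventually_mono)
  with True show ?thesis by (intro that[of "\<lambda>_. 0"]) auto
next
  case False
  define F where "F = fps_expansion f 0"
  have F: "f has_fps_expansion F"
    unfolding F_def by (rule analytic_at_imp_has_fps_expansion_0[OF f])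
  have f0: "f 0 = fps_nth F 0" using has_fps_expansion_imp_0_eq_fps_nth_0[OF F] by simp
  have k: "k \<le> subdegree F"
    using False z by (intro subdegree_geI) (auto simp: F_def)
  define h where "h = (\<lambda>x. if x = 0 then fps_nth F k else f x / x ^ k)"
  have "h has_fps_expansion fps_shift k F"
    unfolding h_def by (rule has_fps_expansion_shift[OF F k]) simp
  then have "h analytic_on {0}" by (rule has_fps_expansion_imp_analytic_0)
  moreover have "f u = u ^ k * h u" for u
    using z[of 0] by (cases "k = 0") (auto simp: h_def f0 F_def)
  ultimately show ?thesis
    by (intro that[of h]) (auto simp: h_def F_def)
qed

text \<open>The limit is taken along \<open>nhds 0\<close>, which forces \<open>h 0 = w\<close>.
  Hence the factorization can be composed with parameters that tend to 0 and may take the value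
  0.\<close>

definition leading_term :: "(complex \<Rightarrow> complex ^ 'n) \<Rightarrow> nat \<Rightarrow> complex ^ 'n \<Rightarrow> bool" where
  "leading_term f k w \<longleftrightarrow> w \<noteq> 0 \<and>
     (\<exists>h. (h \<longlongrightarrow> w) (nhds 0) \<and> (\<forall>\<^sub>F s in nhds 0. f s = s ^ k *s h s))"

definition coeff_vec :: "(complex \<Rightarrow> complex ^ 'n) \<Rightarrow> nat \<Rightarrow> complex ^ 'n" where
  "coeff_vec f k = (\<chi> j. fps_nth (fps_expansion (\<lambda>u. f u $ j) 0) k)"

lemma leading_termI:
  assumes "w \<noteq> 0" "(h \<longlongrightarrow> w) (nhds 0)" "\<forall>\<^sub>F s in nhds 0. f s = s ^ k *s h s"
  shows "leading_term f k w"
  using assms unfolding leading_term_def by blast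


lemma analytic_tendsto_nhds:
  fixes h :: "complex \<Rightarrow> complex"
  assumes "h analytic_on {z}"
  shows "(h \<longlongrightarrow> h z) (nhds z)"
  using analytic_at_imp_isCont[OF assms] by (simp add: tendsto_nhds_iff isCont_def)

lemma tendsto_smult [tendsto_intros]:
  fixes g :: "'a \<Rightarrow> complex ^ 'n"
  assumes "(f \<longlongrightarrow> a) F" "(g \<longlongrightarrow> b) F"
  shows "((\<lambda>x. f x *s g x) \<longlongrightarrow> a *s b) F"
proof (rule vec_tendstoI)
  fix i
  have "((\<lambda>x. g x $ i) \<longlongrightarrow> b $ i) F" using assms(2) by (rule tendsto_vec_nth)
  then show "((\<lambda>x. (f x *s g x) $ i) \<longlongrightarrow> (a *s b) $ i) F"
    using assms(1) by (auto intro!: tendsto_intros)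
qed

lemma norm_smult: "norm (c *s x) = norm c * norm (x :: complex ^ 'n)"
  by (simp add: norm_vec_def L2_set_def norm_mult power_mult_distrib sum_distrib_left [symmetric]
      real_sqrt_mult)

lemma vec_nonzero_component:
  assumes "(w :: complex ^ 'n) \<noteq> 0"
  obtains b where "w $ b \<noteq> 0"
  using assms by (auto simp: vec_eq_iff)

lemma leading_term_coeff_vec:
  assumes an: "\<And>j. (\<lambda>u. f u $ j) analytic_on {0}"
    and z: "\<And>i. i < k \<Longrightarrow> coeff_vec f i = 0" and nz: "coeff_vec f k \<noteq> 0"
  shows "leading_term f k (coeff_vec f k)"
proof -
  have "\<exists>h. h analytic_on {0} \<and> h 0 = coeff_vec f k $ j \<and> (\<forall>\<^sub>F u in nhds 0. f u $ j = u ^ k * h u)"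
    for j
  proof -
    have "fps_nth (fps_expansion (\<lambda>u. f u $ j) 0) i = 0" if "i < k" for i
      using z[OF that] by (simp add: coeff_vec_def vec_eq_iff)
    from analytic_factor_power[OF an[of j] this] show ?thesis
      by (metis coeff_vec_def vec_lambda_beta)
  qed
  then obtain h where h: "\<And>j. h j analytic_on {0}" "\<And>j. h j 0 = coeff_vec f k $ j"
    "\<And>j. \<forall>\<^sub>F u in nhds 0. f u $ j = u ^ k * h j u" by metis
  show ?thesis
  proof (rule leading_termI[OF nz])
    show "((\<lambda>u. \<chi> j. h j u) \<longlongrightarrow> coeff_vec f k) (nhds 0)"
    proof (rule vec_tendstoI)
      fix j
      show "((\<lambda>u. (\<chi> j. h j u) $ j) \<longlongrightarrow> coeff_vec f k $ j) (nhds 0)"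
        using analytic_tendsto_nhds[OF h(1)[of j]] by (simp add: h(2))
    qed
    have "\<forall>\<^sub>F u in nhds 0. \<forall>j. f u $ j = u ^ k * h j u"
      using h(3) by (rule eventually_all_finite)
    then show "\<forall>\<^sub>F u in nhds 0. f u = u ^ k *s (\<chi> j. h j u)"
      by eventually_elim (simp add: vec_eq_iff)
  qed
qed

lemma coeff_vec_all_zero:
  assumes an: "\<And>j. (\<lambda>u. f u $ j) analytic_on {0}" and z: "\<And>i. coeff_vec f i = 0"
  shows "\<forall>\<^sub>F u in nhds 0. f u = 0"
proof -
  have "\<forall>\<^sub>F u in nhds 0. f u $ j = 0" for j
  proof -
    have "fps_expansion (\<lambda>u. f u $ j) 0 = 0"
      using z by (intro fps_ext) (simp add: coeff_vec_def vec_eq_iff)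
    then have "(\<lambda>u. f u $ j) has_fps_expansion 0"
      using analytic_at_imp_has_fps_expansion_0[OF an[of j]] by simp
    then show ?thesis by (auto simp: has_fps_expansion_def elim: eventually_mono)
  qed
  then have "\<forall>\<^sub>F u in nhds 0. \<forall>j. f u $ j = 0" by (rule eventually_all_finite)
  then show ?thesis by eventually_elim (simp add: vec_eq_iff)
qed

lemma leading_term_or_zero:
  assumes an: "\<And>j. (\<lambda>u. f u $ j) analytic_on {0}"
  shows "(\<forall>\<^sub>F u in nhds 0. f u = 0) \<or>
    (\<exists>k. (\<forall>i<k. coeff_vec f i = 0) \<and> coeff_vec f k \<noteq> 0 \<and> leading_term f k (coeff_vec f k))"
proof (cases "\<forall>i. coeff_vec f i = 0")
  case True
  then show ?thesis using coeff_vec_all_zero[OF an] by blast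
next
  case False
  define k where "k = (LEAST i. coeff_vec f i \<noteq> 0)"
  have "coeff_vec f k \<noteq> 0" unfolding k_def using False by (metis (mono_tags, lifting) LeastI)
  moreover have z: "coeff_vec f i = 0" if "i < k" for i
    using not_less_Least that unfolding k_def by blast
  ultimately show ?thesis using leading_term_coeff_vec[OF an z] by blast
qed

text \<open>Dividing by a coordinate \<open>b\<close> with \<open>w $ b \<noteq> 0\<close> isolates
  the scalar \<open>c x * s x ^ k\<close>. It therefore converges, although \<open>c\<close> is
  arbitrary and may be unbounded.\<close>

lemma leading_term_tendsto:
  assumes lt: "leading_term f k w" and s: "(s \<longlongrightarrow> 0) F" and F: "F \<noteq> bot"
    and lim: "((\<lambda>x. c x *s f (s x)) \<longlongrightarrow> y) F"
  shows "\<exists>\<beta>. y = \<beta> *s w"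
proof -
  obtain h where h: "(h \<longlongrightarrow> w) (nhds 0)" "\<forall>\<^sub>F s in nhds 0. f s = s ^ k *s h s" and w: "w \<noteq> 0"
    using lt by (auto simp: leading_term_def)
  obtain b where b: "w $ b \<noteq> 0" using w by (rule vec_nonzero_component)
  define g where "g = (\<lambda>x. c x * s x ^ k)"
  have hs: "((\<lambda>x. h (s x)) \<longlongrightarrow> w) F" using filterlim_compose[OF h(1) s] .
  have "\<forall>\<^sub>F x in F. f (s x) = s x ^ k *s h (s x)"
    using eventually_compose_filterlim[OF h(2) s] .
  then have "\<forall>\<^sub>F x in F. c x *s f (s x) = g x *s h (s x)"
    by eventually_elim (simp add: g_def vec_eq_iff)
  then have lim': "((\<lambda>x. g x *s h (s x)) \<longlongrightarrow> y) F"
    using lim by (simp add: filterlim_cong)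
  have hb: "((\<lambda>x. h (s x) $ b) \<longlongrightarrow> w $ b) F" using tendsto_vec_nth[OF hs] .
  have "((\<lambda>x. (g x *s h (s x)) $ b / h (s x) $ b) \<longlongrightarrow> y $ b / w $ b) F"
    by (intro tendsto_divide tendsto_vec_nth lim' hb b)
  moreover have "\<forall>\<^sub>F x in F. h (s x) $ b \<noteq> 0" using tendsto_imp_eventually_ne[OF hb b] .
  then have "\<forall>\<^sub>F x in F. (g x *s h (s x)) $ b / h (s x) $ b = g x"
    by eventually_elim simp
  ultimately have "(g \<longlongrightarrow> y $ b / w $ b) F" by (simp add: filterlim_cong)
  then have "((\<lambda>x. g x *s h (s x)) \<longlongrightarrow> (y $ b / w $ b) *s w) F"
    using hs by (intro tendsto_intros)
  then show ?thesis using tendsto_unique[OF F lim'] by blast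
qed

lemma leading_term_lower_bound:
  assumes "leading_term f k w"
  obtains c where "c > 0" "\<forall>\<^sub>F s in nhds 0. c * norm s ^ k \<le> norm (f s)"
proof -
  obtain h where h: "(h \<longlongrightarrow> w) (nhds 0)" "\<forall>\<^sub>F s in nhds 0. f s = s ^ k *s h s" and w: "w \<noteq> 0"
    using assms by (auto simp: leading_term_def)
  have "((\<lambda>s. norm (h s)) \<longlongrightarrow> norm w) (nhds 0)" using h(1) by (rule tendsto_norm)
  then have "\<forall>\<^sub>F s in nhds 0. norm w / 2 < norm (h s)" using w by (intro order_tendstoD) auto
  with h(2) have "\<forall>\<^sub>F s in nhds 0. norm w / 2 * norm s ^ k \<le> norm (f s)"
  proof eventually_elim
    case (elim s)
    have "norm s ^ k * (norm w / 2) \<le> norm s ^ k * norm (h s)"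
      using elim(2) by (intro mult_left_mono) auto
    then show ?case by (simp add: elim(1) norm_smult norm_power mult.commute)
  qed
  with w show ?thesis by (intro that[of "norm w / 2"]) auto
qed

lemma leading_term_nonzero:
  assumes "leading_term f k w"
  shows "\<forall>\<^sub>F s in at 0. f s \<noteq> 0"
proof -
  obtain c where c: "c > 0" "\<forall>\<^sub>F s in nhds 0. c * norm s ^ k \<le> norm (f s)"
    using leading_term_lower_bound[OF assms] .
  from c(2) have "\<forall>\<^sub>F s in at 0. c * norm s ^ k \<le> norm (f s)"
    by (simp add: eventually_nhds_conv_at)
  moreover have "\<forall>\<^sub>F s in at 0. s \<noteq> (0::complex)" by (simp add: eventually_at_filter)
  ultimately show ?thesis
  proof eventually_elim
    case (elim s)
    then have "0 < c * norm s ^ k" using c(1) by simp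
    with elim(1) show ?case by auto
  qed
qed

lemma leading_term_unique:
  assumes "leading_term f k w" "leading_term f l v"
  shows "k = l \<and> w = v"
proof -
  have lim: "((\<lambda>s. inverse (s ^ k) *s f s) \<longlongrightarrow> w) (at 0)" if lt: "leading_term f k w" for k w
  proof -
    obtain h where h: "(h \<longlongrightarrow> w) (nhds 0)" "\<forall>\<^sub>F s in nhds 0. f s = s ^ k *s h s"
      using lt by (auto simp: leading_term_def)
    have "\<forall>\<^sub>F s in at 0. f s = s ^ k *s h s" using h(2) by (simp add: eventually_nhds_conv_at)
    moreover have "\<forall>\<^sub>F s in at 0. s \<noteq> (0::complex)" by (simp add: eventually_at_filter)
    ultimately have "\<forall>\<^sub>F s in at 0. h s = inverse (s ^ k) *s f s"
      by eventually_elim (simp add: vec_eq_iff)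
    moreover have "(h \<longlongrightarrow> w) (at 0)" using h(1) by (simp add: tendsto_nhds_iff)
    ultimately show ?thesis by (simp add: filterlim_cong)
  qed
  have no: False if "leading_term f k w" "leading_term f l v" "k < l" for k l w v
  proof -
    have "((\<lambda>s. s ^ (l - k) *s (inverse (s ^ l) *s f s)) \<longlongrightarrow> 0 ^ (l - k) *s v) (at 0)"
      by (intro tendsto_intros lim that)
    moreover have "\<forall>\<^sub>F s in at 0. s \<noteq> (0::complex)" by (simp add: eventually_at_filter)
    then have "\<forall>\<^sub>F s in at 0. s ^ (l - k) *s (inverse (s ^ l) *s f s) = inverse (s ^ k) *s f s"
      by eventually_elim (use \<open>k < l\<close> in \<open>simp add: vec_eq_iff power_diff field_simps\<close>)
    ultimately have "((\<lambda>s. inverse (s ^ k) *s f s) \<longlongrightarrow> 0 ^ (l - k) *s v) (at 0)"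
      by (rule Lim_transform_eventually)
    then have "w = 0 ^ (l - k) *s v"
      by (rule tendsto_unique[OF at_neq_bot lim[OF that(1)]])
    then have "w = 0" using \<open>k < l\<close> by (simp add: vec_eq_iff)
    then show False using that(1) by (simp add: leading_term_def)
  qed
  have "k = l" using no assms by (metis linorder_neqE_nat)
  moreover have "w = v" using tendsto_unique[OF at_neq_bot lim[OF assms(1)]] lim[OF assms(2)]
    unfolding \<open>k = l\<close> by blast
  ultimately show ?thesis by simp
qed

lemma coeff_vec_leading_term:
  assumes an: "\<And>j. (\<lambda>u. f u $ j) analytic_on {0}" and lt: "leading_term f k w"
  shows "(\<forall>i<k. coeff_vec f i = 0) \<and> coeff_vec f k = w"
  using leading_term_or_zero[OF an]
proof
  assume "\<forall>\<^sub>F u in nhds 0. f u = 0"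
  then have "\<forall>\<^sub>F u in at 0. f u = 0" by (simp add: eventually_nhds_conv_at)
  with leading_term_nonzero[OF lt] have "\<forall>\<^sub>F u in at (0::complex). False"
    by eventually_elim simp
  then show ?thesis by simp
next
  assume "\<exists>k. (\<forall>i<k. coeff_vec f i = 0) \<and> coeff_vec f k \<noteq> 0 \<and> leading_term f k (coeff_vec f k)"
  then show ?thesis using leading_term_unique[OF lt] by metis
qed

section \<open>Coefficients and orders of \<open>\<phi> u - \<phi> (\<theta> * u)\<close>\<close>

lemma coeff_vec_twist:
  assumes an: "\<And>j. (\<lambda>u. f u $ j) analytic_on {0}"
  shows "coeff_vec (\<lambda>u. f u - f (\<theta> * u)) k = (1 - \<theta> ^ k) *s coeff_vec f k"
proof -
  have "(deriv ^^ k) (\<lambda>u. f u $ j - f (\<theta> * u) $ j) 0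
      = (1 - \<theta> ^ k) * (deriv ^^ k) (\<lambda>u. f u $ j) 0" for j
  proof -
    obtain R where R: "R > 0" "(\<lambda>u. f u $ j) holomorphic_on ball 0 R"
      using an[of j] by (auto simp: analytic_on_def)
    \<comment> \<open>Multiplication by \<open>\<theta>\<close> maps the ball of radius
      \<open>r\<close> into the ball of radius \<open>R\<close>; the summand 1 keeps the denominator
      positive when \<open>\<theta> = 0\<close>.\<close>
    define r where "r = R / (norm \<theta> + 1)"
    have r: "r > 0" using R(1) by (simp add: r_def add_nonneg_pos)
    have sub: "\<theta> * w \<in> ball 0 R" if "w \<in> ball 0 r" for w
    proof -
      have "norm \<theta> * norm w \<le> norm \<theta> * r" using that by (intro mult_left_mono) auto
      also have "\<dots> < (norm \<theta> + 1) * r" using r by (simp add: algebra_simps)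
      also have "\<dots> = R" unfolding r_def by (simp add: add_nonneg_eq_0_iff)
      finally show ?thesis by (simp add: norm_mult)
    qed
    have c: "(deriv ^^ k) (\<lambda>w. f (\<theta> * w) $ j) 0 = \<theta> ^ k * (deriv ^^ k) (\<lambda>u. f u $ j) (\<theta> * 0)"
      by (rule higher_deriv_compose_linear[where S = "ball 0 r", OF R(2) open_ball open_ball _ sub]) (use r in auto)
    have "(\<lambda>w. f (\<theta> * w) $ j) holomorphic_on ball 0 r"
      using holomorphic_on_compose_gen[of "\<lambda>w. \<theta> * w" "ball 0 r" "\<lambda>u. f u $ j" "ball 0 R"] R(2) sub
      by (force simp: o_def intro!: holomorphic_intros)
    then have "(\<lambda>w. f (\<theta> * w) $ j) analytic_on {0}"
      using r unfolding analytic_on_def by blast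
    then show ?thesis using higher_deriv_diff_at[OF an[of j], of "\<lambda>w. f (\<theta> * w) $ j" k] c
      by (simp add: algebra_simps)
  qed
  then show ?thesis
    by (simp add: coeff_vec_def vec_eq_iff fps_expansion_def left_diff_distrib diff_divide_distrib)
qed

text \<open>The least order among the coordinates is the order of the vector-valued series, infinite
  if all coefficients vanish. This translates the orders in \<open>ChAM\<close> into coefficient
  vectors.\<close>

lemma INF_ord0: "(INF j. ord0 (\<lambda>u. f u $ j)) = (INF k\<in>{k. coeff_vec f k \<noteq> 0}. enat k)"
proof (rule antisym)
  show "(INF j. ord0 (\<lambda>u. f u $ j)) \<le> (INF k\<in>{k. coeff_vec f k \<noteq> 0}. enat k)"
  proof (rule INF_greatest)
    fix k assume "k \<in> {k. coeff_vec f k \<noteq> 0}"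
    then obtain j where "fps_nth (fps_expansion (\<lambda>u. f u $ j) 0) k \<noteq> 0"
      by (auto simp: coeff_vec_def vec_eq_iff)
    then have "ord0 (\<lambda>u. f u $ j) \<le> enat k" unfolding ord0_def by (intro INF_lower) auto
    then show "(INF j. ord0 (\<lambda>u. f u $ j)) \<le> enat k" by (meson INF_lower2 UNIV_I)
  qed
  show "(INF k\<in>{k. coeff_vec f k \<noteq> 0}. enat k) \<le> (INF j. ord0 (\<lambda>u. f u $ j))"
    unfolding ord0_def
    by (intro INF_greatest INF_lower) (auto simp: coeff_vec_def vec_eq_iff)
qed

lemma INF_ord0_eq_enat:
  assumes "\<And>i. i < k \<Longrightarrow> coeff_vec f i = 0" "coeff_vec f k \<noteq> 0"
  shows "(INF j. ord0 (\<lambda>u. f u $ j)) = enat k"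
  unfolding INF_ord0
proof (rule antisym)
  show "(INF k\<in>{k. coeff_vec f k \<noteq> 0}. enat k) \<le> enat k"
    using assms(2) by (intro INF_lower) auto
  show "enat k \<le> (INF k\<in>{k. coeff_vec f k \<noteq> 0}. enat k)"
    using assms(1) by (intro INF_greatest) (auto simp: not_less[symmetric])
qed

section \<open>Nearest roots and increments along a branch\<close>

text \<open>Ties between equally near roots are broken arbitrarily. For \<open>u = 0\<close> all
  roots are equally near, so \<open>near_root m 0 x\<close> is simply a choice of an
  \<open>m\<close>-th root of \<open>x\<close>.\<close>

definition near_root :: "nat \<Rightarrow> complex \<Rightarrow> complex \<Rightarrow> complex" where
  "near_root m u x = arg_min_on (\<lambda>z. norm (u - z)) {z. z ^ m = x}"

lemma complex_root_exists:
  assumes "m > 0"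
  obtains z :: complex where "z ^ m = x"
proof (cases "x = 0")
  case True
  with assms show ?thesis by (intro that[of 0]) simp
next
  case False
  have "(exp (Ln x / of_nat m)) ^ m = x"
    using assms False by (simp flip: exp_of_nat_mult)
  then show ?thesis by (rule that)
qed

lemma near_root:
  assumes "m > 0"
  shows near_root_power: "near_root m u x ^ m = x"
    and near_root_least: "z ^ m = x \<Longrightarrow> norm (u - near_root m u x) \<le> norm (u - z)"
proof -
  have fin: "finite {z. z ^ m = x}" using assms by (rule finite_nth_roots)
  obtain z0 where "z0 ^ m = x" using assms by (rule complex_root_exists)
  then have ne: "{z. z ^ m = x} \<noteq> {}" by blast
  show "near_root m u x ^ m = x"
    using arg_min_if_finite(1)[OF fin ne, of "\<lambda>z. norm (u - z)"] by (simp add: near_root_def)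
  show "norm (u - near_root m u x) \<le> norm (u - z)" if "z ^ m = x"
    using arg_min_least[OF fin ne, of z "\<lambda>z. norm (u - z)"] that by (simp add: near_root_def)
qed

text \<open>The quotient \<open>(1 - r ^ m) / (1 - r)\<close> vanishes only at the roots of unity other than 1, and
  these are excluded from the compact set \<open>K\<close> of all \<open>r\<close> for which 1 is nearest to \<open>r\<close> among
  the \<open>m\<close>-th roots of unity.\<close>

lemma near_root_bound:
  assumes m: "m > 0"
  obtains c where "c > 0"
    "\<And>u x. c * (norm (u - near_root m u x) * max (norm u) (norm (near_root m u x)) ^ (m - 1))
       \<le> norm (u ^ m - x)"
proof -
  define q where "q = (\<lambda>r::complex. \<Sum>i<m. r ^ i)"
  define K where "K = cball 0 1 \<inter> (\<Inter>\<theta>\<in>{\<theta>. \<theta> ^ m = 1}. {r::complex. norm (1 - r) \<le> norm (1 - \<theta> * r)})"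
  have "closed (\<Inter>\<theta>\<in>{\<theta>. \<theta> ^ m = 1}. {r::complex. norm (1 - r) \<le> norm (1 - \<theta> * r)})"
    by (intro closed_INT ballI closed_Collect_le continuous_intros)
  then have "compact K" unfolding K_def by (intro compact_Int_closed compact_cball)
  moreover have "0 \<in> K" by (simp add: K_def)
  moreover have "continuous_on K (\<lambda>r. norm (q r))" unfolding q_def by (intro continuous_intros)
  ultimately obtain r0 where r0: "r0 \<in> K" "\<And>r. r \<in> K \<Longrightarrow> norm (q r0) \<le> norm (q r)"
    using continuous_attains_inf[of K "\<lambda>r. norm (q r)"] by blast
  have q: "1 - r ^ m = (1 - r) * q r" for r
    unfolding q_def by (rule one_diff_power_eq)
  have "q r0 \<noteq> 0"
  proof
    assume "q r0 = 0"
    then have r1: "r0 ^ m = 1" using q[of r0] by simp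
    then have "r0 \<noteq> 0" using m by (auto simp: power_0_left)
    have "inverse r0 ^ m = 1" using r1 by (simp add: power_inverse)
    then have "norm (1 - r0) \<le> norm (1 - inverse r0 * r0)"
      using r0(1) unfolding K_def by blast
    then have "r0 = 1" using \<open>r0 \<noteq> 0\<close> by simp
    then show False using \<open>q r0 = 0\<close> m by (simp add: q_def)
  qed
  \<comment> \<open>Both sides are homogeneous of degree \<open>m\<close>. Dividing by the larger
    variable \<open>u\<close> leaves \<open>r = v / u\<close> in the unit disc, and nearness puts
    \<open>r\<close> into \<open>K\<close>, where \<open>norm (q r0)\<close> is the minimum.\<close>
  have key: "norm (q r0) * (norm (u - v) * norm u ^ (m - 1)) \<le> norm (u ^ m - v ^ m)"
    if le: "norm v \<le> norm u" and near: "\<And>\<theta>. \<theta> ^ m = 1 \<Longrightarrow> norm (u - v) \<le> norm (u - \<theta> * v)" for u v :: complex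
  proof (cases "u = 0")
    case True
    then show ?thesis using le by simp
  next
    case False
    define r where "r = v / u"
    have v: "v = u * r" using False by (simp add: r_def)
    have "r \<in> K"
    proof -
      have "norm (1 - r) \<le> norm (1 - \<theta> * r)" if "\<theta> ^ m = 1" for \<theta>
      proof -
        have "u - v = u * (1 - r)" "u - \<theta> * v = u * (1 - \<theta> * r)" by (simp_all add: v algebra_simps)
        then have "norm u * norm (1 - r) \<le> norm u * norm (1 - \<theta> * r)"
          using near[OF that] by (simp add: norm_mult)
        then show ?thesis using False by simp
      qed
      moreover have "norm r \<le> 1" using le False by (simp add: r_def norm_divide)
      ultimately show ?thesis by (simp add: K_def)
    qed
    have "u ^ m - v ^ m = u ^ m * (1 - r ^ m)" by (simp add: v power_mult_distrib algebra_simps)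
    also have "\<dots> = u ^ m * ((1 - r) * q r)" by (simp only: q)
    also have "\<dots> = u ^ (m - 1) * ((u - v) * q r)"
      using m by (cases m) (simp_all add: v algebra_simps)
    finally have "norm (u ^ m - v ^ m) = norm (u - v) * norm u ^ (m - 1) * norm (q r)"
      by (simp add: norm_mult norm_power)
    also have "\<dots> \<ge> norm (u - v) * norm u ^ (m - 1) * norm (q r0)"
      using r0(2)[OF \<open>r \<in> K\<close>] by (intro mult_left_mono) auto
    finally show ?thesis by (simp add: mult_ac)
  qed
  show ?thesis
  proof (rule that[of "norm (q r0)"])
    show "norm (q r0) > 0" using \<open>q r0 \<noteq> 0\<close> by simp
    fix u x
    define v where "v = near_root m u x"
    have vm: "v ^ m = x" unfolding v_def using m by (rule near_root_power)
    have near: "norm (u - v) \<le> norm (u - \<theta> * v)" if "\<theta> ^ m = 1" for \<theta>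
      unfolding v_def
      by (rule near_root_least[OF m]) (simp add: power_mult_distrib that near_root_power[OF m])
    show "norm (q r0) * (norm (u - near_root m u x) * max (norm u) (norm (near_root m u x)) ^ (m - 1))
       \<le> norm (u ^ m - x)"
    proof (cases "norm v \<le> norm u")
      case True
      then show ?thesis using key[OF True near] by (simp add: v_def[symmetric] vm)
    next
      case False
      \<comment> \<open>Roots of unity have modulus 1, so rotating \<open>u\<close> instead of
        \<open>v\<close> yields the same distances. Nearness is thus symmetric, and
        \<open>key\<close> applies with the two variables exchanged.\<close>
      have "norm (v - u) \<le> norm (v - \<theta> * u)" if \<theta>: "\<theta> ^ m = 1" for \<theta>
      proof -
        have th0: "\<theta> \<noteq> 0" using \<theta> m by (auto simp: power_0_left)
        have "norm \<theta> ^ m = 1" using \<theta> by (simp flip: norm_power)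
        then have n1: "norm \<theta> = 1" using m by (intro power_eq_imp_eq_base[of "norm \<theta>" m 1]) auto
        have "inverse \<theta> ^ m = 1" using \<theta> by (simp add: power_inverse)
        then have "norm (u - v) \<le> norm (u - inverse \<theta> * v)" by (rule near)
        also have "\<dots> = norm \<theta> * norm (u - inverse \<theta> * v)" by (simp add: n1)
        also have "\<dots> = norm (\<theta> * (u - inverse \<theta> * v))" by (rule norm_mult[symmetric])
        also have "\<theta> * (u - inverse \<theta> * v) = \<theta> * u - v"
          using th0 by (simp add: right_diff_distrib flip: mult.assoc)
        finally show ?thesis by (simp add: norm_minus_commute)
      qed
      then have "norm (q r0) * (norm (v - u) * norm v ^ (m - 1)) \<le> norm (v ^ m - u ^ m)"
        using False by (intro key) auto
      then show ?thesis using False by (simp add: v_def[symmetric] vm norm_minus_commute max_def)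
    qed
  qed
qed

lemma root_tendsto_0:
  fixes z :: "'a \<Rightarrow> complex"
  assumes "((\<lambda>x. z x ^ m) \<longlongrightarrow> 0) F" "m > 0"
  shows "(z \<longlongrightarrow> 0) F"
proof (rule tendstoI)
  fix e :: real assume "e > 0"
  then have "\<forall>\<^sub>F x in F. dist (z x ^ m) 0 < e ^ m"
    using assms(1) by (intro tendstoD) auto
  then show "\<forall>\<^sub>F x in F. dist (z x) 0 < e"
  proof eventually_elim
    case (elim x)
    then have "norm (z x) ^ m < e ^ m" by (simp add: norm_power)
    then show ?case using \<open>e > 0\<close> by (simp add: power_less_imp_less_base)
  qed
qed

text \<open>All coefficients up to index \<open>m\<close> vanish, so the derivative is divisible by
  \<open>u ^ m\<close> and small compared with \<open>u ^ (m - 1)\<close>. The mean value inequality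
  on the smallest disc about 0 containing both points yields exactly the expression bounded in
  \<open>near_root_bound\<close>.\<close>

lemma analytic_small_increments:
  fixes g :: "complex \<Rightarrow> complex"
  assumes g: "g analytic_on {0}" and z: "\<And>i. i \<le> m \<Longrightarrow> fps_nth (fps_expansion g 0) i = 0"
    and m: "m > 0" and e: "e > 0"
  shows "\<exists>d>0. \<forall>u v. norm u < d \<longrightarrow> norm v < d \<longrightarrow>
    norm (g u - g v) \<le> e * (norm (u - v) * max (norm u) (norm v) ^ (m - 1))"
proof -
  have "deriv g analytic_on {0}" using g by (rule analytic_deriv)
  moreover have "fps_nth (fps_expansion (deriv g) 0) i = 0" if "i < m" for i
    using z[of "Suc i"] that by (simp add: fps_expansion_def funpow_swap1 del: of_nat_Suc)
  ultimately obtain k where k: "k analytic_on {0}" "\<forall>\<^sub>F u in nhds 0. deriv g u = u ^ m * k u"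
    by (metis analytic_factor_power)
  have "((\<lambda>u. u * k u) \<longlongrightarrow> 0 * k 0) (nhds 0)"
    by (intro tendsto_intros analytic_tendsto_nhds k(1)) (simp add: filterlim_ident)
  then have "\<forall>\<^sub>F u in nhds 0. norm (u * k u) < e"
    using e by (simp add: tendsto_iff)
  with k(2) have "\<forall>\<^sub>F u in nhds 0. norm (deriv g u) \<le> e * norm u ^ (m - 1)"
  proof eventually_elim
    case (elim u)
    have "norm (deriv g u) = norm (u * k u) * norm u ^ (m - 1)"
      using m by (cases m) (simp_all add: elim(1) norm_mult norm_power mult_ac)
    also have "\<dots> \<le> e * norm u ^ (m - 1)" using elim(2) by (intro mult_right_mono) auto
    finally show ?case .
  qed
  then obtain d1 where d1: "d1 > 0" "\<And>u. norm u < d1 \<Longrightarrow> norm (deriv g u) \<le> e * norm u ^ (m - 1)"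
    by (auto simp: eventually_nhds_metric)
  obtain d2 where d2: "d2 > 0" "g holomorphic_on ball 0 d2" using g by (auto simp: analytic_on_def)
  show ?thesis
  proof (intro exI[of _ "min d1 d2"] conjI allI impI)
    fix u v :: complex assume u: "norm u < min d1 d2" and v: "norm v < min d1 d2"
    define M where "M = max (norm u) (norm v)"
    have M: "M < d1" "M < d2" using u v by (auto simp: M_def)
    have "norm (g u - g v) \<le> (e * M ^ (m - 1)) * norm (u - v)"
    proof (rule field_differentiable_bound[of "cball 0 M"])
      fix z :: complex assume z: "z \<in> cball 0 M"
      have "(g has_field_derivative deriv g z) (at z)"
        using d2(2) by (rule holomorphic_derivI) (use z M in auto)
      then show "(g has_field_derivative deriv g z) (at z within cball 0 M)"
        by (rule has_field_derivative_at_within)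
      have "norm (deriv g z) \<le> e * norm z ^ (m - 1)" using z M by (intro d1) auto
      also have "\<dots> \<le> e * M ^ (m - 1)" using z e by (intro mult_left_mono power_mono) auto
      finally show "norm (deriv g z) \<le> e * M ^ (m - 1)" .
    qed (auto simp: M_def)
    then show "norm (g u - g v) \<le> e * (norm (u - v) * max (norm u) (norm v) ^ (m - 1))"
      by (simp add: M_def mult_ac)
  qed (use d1 d2 in auto)
qed

text \<open>The leading terms of \<open>\<phi>\<close> contribute exactly
  \<open>(u ^ m - x) *s coeff_vec \<phi> m\<close>, because the near root has \<open>m\<close>-th
  power \<open>x\<close>. The remainder has order above \<open>m\<close>, and its increments are
  negligible against \<open>u ^ m - x\<close> by \<open>near_root_bound\<close>.\<close>

lemma increment_estimate:
  fixes \<phi> :: "complex \<Rightarrow> complex ^ 'n"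
  assumes an: "\<And>j. (\<lambda>u. \<phi> u $ j) analytic_on {0}"
    and z: "\<And>i. i < m \<Longrightarrow> coeff_vec \<phi> i = 0" and m: "m > 0" and e: "e > 0"
  shows "\<exists>d>0. \<forall>u x. norm u < d \<longrightarrow> norm (near_root m u x) < d \<longrightarrow>
    norm (\<phi> u - \<phi> (near_root m u x) - (u ^ m - x) *s coeff_vec \<phi> m) \<le> e * norm (u ^ m - x)"
proof -
  define t where "t = coeff_vec \<phi> m"
  obtain c where c: "c > 0" "\<And>u x. c * (norm (u - near_root m u x) *
      max (norm u) (norm (near_root m u x)) ^ (m - 1)) \<le> norm (u ^ m - x)"
    using near_root_bound[OF m] by blast
  \<comment> \<open>The factor \<open>c\<close> turns the bound in terms of \<open>u\<close> and its
    nearest root into one in terms of \<open>u ^ m - x\<close>; the divisor distributes the total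
    error over the coordinates.\<close>
  define e' where "e' = e * c / of_nat CARD('n)"
  have e': "e' > 0" using e c(1) by (simp add: e'_def)
  define g where "g = (\<lambda>j u. \<phi> u $ j - t $ j * u ^ m)"
  have g_an: "g j analytic_on {0}" for j
    unfolding g_def by (intro analytic_intros an)
  have "fps_nth (fps_expansion (g j) 0) i = 0" if "i \<le> m" for i j
  proof -
    have "g j has_fps_expansion (fps_expansion (\<lambda>u. \<phi> u $ j) 0 - fps_const (t $ j) * fps_X ^ m)"
      unfolding g_def
      by (intro fps_expansion_intros analytic_at_imp_has_fps_expansion_0 an)
    then have "fps_expansion (g j) 0 = fps_expansion (\<lambda>u. \<phi> u $ j) 0 - fps_const (t $ j) * fps_X ^ m"
      by (rule fps_expansion_eqI)
    moreover have "fps_nth (fps_expansion (\<lambda>u. \<phi> u $ j) 0) i = 0" if "i < m"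
      using z[OF that] by (simp add: coeff_vec_def vec_eq_iff)
    ultimately show ?thesis
      using that by (auto simp: t_def coeff_vec_def fps_X_power_nth)
  qed
  then have "\<exists>d>0. \<forall>u v. norm u < d \<longrightarrow> norm v < d \<longrightarrow>
    norm (g j u - g j v) \<le> e' * (norm (u - v) * max (norm u) (norm v) ^ (m - 1))" for j
    using analytic_small_increments[OF g_an _ m e'] by blast
  then obtain d where d: "\<And>j. d j > 0" "\<And>j u v. norm u < d j \<Longrightarrow> norm v < d j \<Longrightarrow>
    norm (g j u - g j v) \<le> e' * (norm (u - v) * max (norm u) (norm v) ^ (m - 1))"
    by metis
  show ?thesis
  proof (intro exI[of _ "Min (range d)"] conjI allI impI)
    show "Min (range d) > 0" using d(1) by (subst Min_gr_iff) auto
    fix u x assume u: "norm u < Min (range d)" and v: "norm (near_root m u x) < Min (range d)"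
    define v where "v = near_root m u x"
    have vm: "v ^ m = x" unfolding v_def using m by (rule near_root_power)
    have "norm ((\<phi> u - \<phi> v - (u ^ m - x) *s t) $ j) \<le> e / of_nat CARD('n) * norm (u ^ m - x)" for j
    proof -
      have "norm u < d j" "norm v < d j" using u v by (auto simp: v_def)
      then have "norm (g j u - g j v) \<le> e' * (norm (u - v) * max (norm u) (norm v) ^ (m - 1))"
        by (rule d)
      also have "\<dots> = e / of_nat CARD('n) * (c * (norm (u - v) * max (norm u) (norm v) ^ (m - 1)))"
        by (simp add: e'_def)
      also have "\<dots> \<le> e / of_nat CARD('n) * norm (u ^ m - x)"
        using e c(2)[of u x] by (intro mult_left_mono) (auto simp: v_def)
      finally show ?thesis by (simp add: g_def vm[symmetric] algebra_simps)
    qed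
    then have "(\<Sum>j\<in>UNIV. norm ((\<phi> u - \<phi> v - (u ^ m - x) *s t) $ j))
        \<le> (\<Sum>j\<in>(UNIV :: 'n set). e / of_nat CARD('n) * norm (u ^ m - x))"
      by (rule sum_mono)
    also have "\<dots> = e * norm (u ^ m - x)" by simp
    finally have "(\<Sum>j\<in>UNIV. norm ((\<phi> u - \<phi> v - (u ^ m - x) *s t) $ j)) \<le> e * norm (u ^ m - x)" .
    moreover have "norm (\<phi> u - \<phi> v - (u ^ m - x) *s t)
        \<le> (\<Sum>j\<in>UNIV. norm ((\<phi> u - \<phi> v - (u ^ m - x) *s t) $ j))"
      unfolding norm_vec_def[of "\<phi> u - \<phi> v - (u ^ m - x) *s t"] by (rule L2_set_le_sum) simp
    ultimately have "norm (\<phi> u - \<phi> v - (u ^ m - x) *s t) \<le> e * norm (u ^ m - x)" by linarith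
    then show "norm (\<phi> u - \<phi> (near_root m u x) - (u ^ m - x) *s coeff_vec \<phi> m) \<le> e * norm (u ^ m - x)"
      by (simp add: v_def t_def)
  qed
qed

text \<open>Only the product of \<open>c\<close> with \<open>u ^ m - x\<close> converges, not
  \<open>c\<close> itself. The relative form of the error in \<open>increment_estimate\<close> is
  what makes the error term vanish in the limit.\<close>

lemma increment_tendsto:
  fixes \<phi> :: "complex \<Rightarrow> complex ^ 'n"
  assumes an: "\<And>j. (\<lambda>u. \<phi> u $ j) analytic_on {0}"
    and z: "\<And>i. i < m \<Longrightarrow> coeff_vec \<phi> i = 0" and m: "m > 0"
    and u: "(u \<longlongrightarrow> 0) F" and x: "(x \<longlongrightarrow> 0) F"
    and lim: "((\<lambda>i. c i * (u i ^ m - x i)) \<longlongrightarrow> \<alpha>) F"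
  shows "((\<lambda>i. c i *s (\<phi> (u i) - \<phi> (near_root m (u i) (x i)))) \<longlongrightarrow> \<alpha> *s coeff_vec \<phi> m) F"
proof -
  define t where "t = coeff_vec \<phi> m"
  define v where "v = (\<lambda>i. near_root m (u i) (x i))"
  define D where "D = (\<lambda>i. c i * (u i ^ m - x i))"
  define E where "E = (\<lambda>i. c i *s (\<phi> (u i) - \<phi> (v i)) - D i *s t)"
  have v: "(v \<longlongrightarrow> 0) F"
    by (rule root_tendsto_0[OF _ m]) (simp add: v_def near_root_power[OF m] x)
  have "(E \<longlongrightarrow> 0) F"
  proof (rule tendstoI)
    fix e :: real assume e: "e > 0"
    \<comment> \<open>\<open>D\<close> tends to \<open>\<alpha>\<close>, so its norm is eventually
      below \<open>norm \<alpha> + 1\<close>, a bound that is positive even for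
      \<open>\<alpha> = 0\<close>.\<close>
    define e' where "e' = e / (norm \<alpha> + 1)"
    have e': "e' > 0" using e by (simp add: e'_def add_nonneg_pos)
    obtain d where d: "d > 0" "\<And>u x. norm u < d \<Longrightarrow> norm (near_root m u x) < d \<Longrightarrow>
        norm (\<phi> u - \<phi> (near_root m u x) - (u ^ m - x) *s coeff_vec \<phi> m) \<le> e' * norm (u ^ m - x)"
      using increment_estimate[OF an z m e'] by blast
    have "\<forall>\<^sub>F i in F. norm (u i) < d" "\<forall>\<^sub>F i in F. norm (v i) < d"
      using u v d(1) by (auto simp: tendsto_iff)
    moreover have "((\<lambda>i. norm (D i)) \<longlongrightarrow> norm \<alpha>) F"
      using lim unfolding D_def by (rule tendsto_norm)
    then have "\<forall>\<^sub>F i in F. norm (D i) < norm \<alpha> + 1" by (rule order_tendstoD) simp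
    ultimately show "\<forall>\<^sub>F i in F. dist (E i) 0 < e"
    proof eventually_elim
      case (elim i)
      have "E i = c i *s (\<phi> (u i) - \<phi> (v i) - (u i ^ m - x i) *s t)"
        by (simp add: E_def D_def vec_eq_iff algebra_simps)
      then have "norm (E i) = norm (c i) * norm (\<phi> (u i) - \<phi> (v i) - (u i ^ m - x i) *s t)"
        by (simp only: norm_smult)
      also have "\<dots> \<le> norm (c i) * (e' * norm (u i ^ m - x i))"
        using d(2)[of "u i" "x i"] elim by (intro mult_left_mono) (auto simp: v_def t_def)
      also have "\<dots> = e' * norm (D i)" by (simp add: D_def norm_mult)
      also have "\<dots> < e' * (norm \<alpha> + 1)" using elim e' by (intro mult_strict_left_mono) auto
      also have "\<dots> = e" by (simp add: e'_def add_nonneg_eq_0_iff)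
      finally show ?case by simp
    qed
  qed
  moreover have "((\<lambda>i. D i *s t) \<longlongrightarrow> \<alpha> *s t) F"
    using lim unfolding D_def by (intro tendsto_intros)
  ultimately have "((\<lambda>i. E i + D i *s t) \<longlongrightarrow> 0 + \<alpha> *s t) F" by (rule tendsto_add)
  then show ?thesis by (simp add: E_def t_def v_def)
qed

section \<open>Limits of secants between two branches\<close>

definition plane :: "complex ^ 'n \<Rightarrow> complex ^ 'n \<Rightarrow> (complex ^ 'n) set" where
  "plane t w = {x. \<exists>\<alpha> \<beta>. x = \<alpha> *s t + \<beta> *s w}"

text \<open>The exponent \<open>m\<close> is the order of \<open>\<phi>\<close> and is not tied to
  \<open>multiplicity_germ Z\<close>. The last conjunct says that arbitrarily small discs already
  cover \<open>Z\<close> near the origin, so that points of \<open>Z\<close> lift to small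
  parameters.\<close>

definition branch_param :: "(complex \<Rightarrow> complex ^ 'n) \<Rightarrow> (complex ^ 'n) set \<Rightarrow> nat \<Rightarrow> bool" where
  "branch_param \<phi> Z m \<longleftrightarrow>
     (\<forall>j. (\<lambda>u. \<phi> u $ j) analytic_on {0}) \<and> 0 < m \<and>
     (\<forall>i<m. coeff_vec \<phi> i = 0) \<and> coeff_vec \<phi> m \<noteq> 0 \<and>
     (\<forall>\<^sub>F u in nhds 0. \<phi> u \<in> Z) \<and>
     (\<forall>e>0. \<forall>\<^sub>F z in nhds 0. z \<in> Z \<longrightarrow> z \<in> \<phi> ` ball 0 e)"

definition secant_limit :: "(complex ^ 'n) set \<Rightarrow> (complex ^ 'n) set \<Rightarrow> complex ^ 'n \<Rightarrow> bool" where
  "secant_limit A B v \<longleftrightarrow>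
     (\<exists>(F :: nat filter) w w' c. F \<noteq> bot \<and> (w \<longlongrightarrow> 0) F \<and> (w' \<longlongrightarrow> 0) F \<and>
        (\<forall>\<^sub>F i in F. w i \<in> A \<and> w' i \<in> B) \<and> ((\<lambda>i. c i *s (w i - w' i)) \<longlongrightarrow> v) F)"

lemma branch_param_leading_term:
  "branch_param \<phi> Z m \<Longrightarrow> leading_term \<phi> m (coeff_vec \<phi> m)"
  unfolding branch_param_def by (intro leading_term_coeff_vec) auto

lemma leading_term_at_0:
  assumes "leading_term f k w"
  shows "f 0 = 0 ^ k *s w"
proof -
  obtain h where h: "(h \<longlongrightarrow> w) (nhds 0)" "\<forall>\<^sub>F s in nhds 0. f s = s ^ k *s h s"
    using assms by (auto simp: leading_term_def)
  have "h 0 = w" using h(1) by (simp add: tendsto_nhds_iff)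
  with eventually_nhds_x_imp_x[OF h(2)] show ?thesis by simp
qed

lemma leading_term_tendsto_0:
  assumes lt: "leading_term f k w" and k: "k > 0" and s: "(s \<longlongrightarrow> 0) F"
  shows "((\<lambda>x. f (s x)) \<longlongrightarrow> 0) F"
proof -
  obtain h where h: "(h \<longlongrightarrow> w) (nhds 0)" "\<forall>\<^sub>F s in nhds 0. f s = s ^ k *s h s"
    using lt by (auto simp: leading_term_def)
  have "((\<lambda>x. s x ^ k *s h (s x)) \<longlongrightarrow> 0 ^ k *s w) F"
    by (intro tendsto_intros s filterlim_compose[OF h(1)])
  also have "0 ^ k *s w = 0" using k by (simp add: vec_eq_iff)
  finally have "((\<lambda>x. s x ^ k *s h (s x)) \<longlongrightarrow> 0) F" .
  moreover have "\<forall>\<^sub>F x in F. s x ^ k *s h (s x) = f (s x)"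
    using eventually_compose_filterlim[OF h(2) s] by (auto elim: eventually_mono)
  ultimately show ?thesis by (rule Lim_transform_eventually)
qed

lemma leading_term_scaled_tendsto:
  assumes lt: "leading_term f k w"
  shows "((\<lambda>s. (\<beta> / s ^ k) *s f s) \<longlongrightarrow> \<beta> *s w) (at 0)"
proof -
  obtain h where h: "(h \<longlongrightarrow> w) (nhds 0)" "\<forall>\<^sub>F s in nhds 0. f s = s ^ k *s h s"
    using lt by (auto simp: leading_term_def)
  have "(h \<longlongrightarrow> w) (at 0)" using h(1) by (simp add: tendsto_nhds_iff)
  then have "((\<lambda>s. \<beta> *s h s) \<longlongrightarrow> \<beta> *s w) (at 0)" by (intro tendsto_intros)
  moreover have "\<forall>\<^sub>F s in at 0. f s = s ^ k *s h s"
    using h(2) by (simp add: eventually_nhds_conv_at)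
  then have "\<forall>\<^sub>F s in at 0. \<beta> *s h s = (\<beta> / s ^ k) *s f s"
    using eventually_neq_at_within[of 0 0 UNIV] by eventually_elim (simp add: vec_eq_iff)
  ultimately show ?thesis by (rule Lim_transform_eventually)
qed

lemma leading_term_component_zero:
  assumes lt: "leading_term f k w" and z: "\<forall>\<^sub>F s in nhds 0. f s $ a = 0"
  shows "w $ a = 0"
proof -
  have "((\<lambda>s. ((1 / s ^ k) *s f s) $ a) \<longlongrightarrow> (1 *s w) $ a) (at 0)"
    by (intro tendsto_vec_nth leading_term_scaled_tendsto lt)
  moreover have "\<forall>\<^sub>F s in at 0. ((1 / s ^ k) *s f s) $ a = 0"
    using z by (auto simp: eventually_nhds_conv_at elim: eventually_mono)
  ultimately have "((\<lambda>s::complex. 0) \<longlongrightarrow> w $ a) (at 0)" by (simp add: Lim_transform_eventually)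
  then show ?thesis by (simp add: tendsto_const_iff)
qed

lemma coeff_vec_pure:
  assumes "\<forall>\<^sub>F u in nhds 0. \<phi> u $ a = u ^ m"
  shows "coeff_vec \<phi> i $ a = (if i = m then 1 else 0)"
proof -
  have "(\<lambda>u::complex. u ^ m) has_fps_expansion fps_X ^ m" by (intro fps_expansion_intros)
  then have "(\<lambda>u. \<phi> u $ a) has_fps_expansion fps_X ^ m"
    using assms by (subst has_fps_expansion_cong[OF _ refl]) auto
  then have "fps_expansion (\<lambda>u. \<phi> u $ a) 0 = fps_X ^ m" by (rule fps_expansion_eqI)
  then show ?thesis by (simp add: coeff_vec_def fps_X_power_nth)
qed

section \<open>Exhibiting vectors of \<open>C5\<close>\<close>

lemma at_0_sequence:
  assumes "\<forall>\<^sub>F s in at (0::complex). P s"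
  obtains \<sigma> :: "nat \<Rightarrow> complex" where "\<And>i. P (\<sigma> i)" "filterlim \<sigma> (at 0) sequentially"
proof -
  define \<rho> where "\<rho> = (\<lambda>i. inverse (of_nat (Suc i)) :: complex)"
  have "(\<rho> \<longlongrightarrow> 0) sequentially"
    unfolding \<rho>_def by (rule LIMSEQ_Suc[OF lim_inverse_n])
  moreover have "\<rho> i \<noteq> 0" for i by (simp add: \<rho>_def del: of_nat_Suc)
  ultimately have "filterlim \<rho> (at 0) sequentially" by (simp add: filterlim_at)
  then have "\<forall>\<^sub>F i in sequentially. P (\<rho> i)" using assms by (rule eventually_compose_filterlim[rotated])
  then obtain N where N: "\<And>i. i \<ge> N \<Longrightarrow> P (\<rho> i)" by (auto simp: eventually_sequentially)
  show ?thesis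
  proof (rule that[of "\<lambda>i. \<rho> (i + N)"])
    show "filterlim (\<lambda>i. \<rho> (i + N)) (at 0) sequentially"
      using \<open>filterlim \<rho> (at 0) sequentially\<close> filterlim_add_const_nat_at_top by (rule filterlim_compose)
  qed (simp add: N)
qed

lemma C5I:
  assumes "\<forall>\<^sub>F s in at (0::complex). p s \<in> X \<and> q s \<in> X \<and> p s \<noteq> q s"
    and "(p \<longlongrightarrow> 0) (at 0)" "(q \<longlongrightarrow> 0) (at 0)"
    and "((\<lambda>s. c s *s (p s - q s)) \<longlongrightarrow> v) (at 0)"
  shows "v \<in> C5 X"
proof -
  obtain \<sigma> where \<sigma>: "\<And>i::nat. p (\<sigma> i) \<in> X \<and> q (\<sigma> i) \<in> X \<and> p (\<sigma> i) \<noteq> q (\<sigma> i)"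
    "filterlim \<sigma> (at 0) sequentially"
    using at_0_sequence[OF assms(1)] by blast
  have "(\<forall>i. p (\<sigma> i) \<in> X \<and> q (\<sigma> i) \<in> X \<and> p (\<sigma> i) \<noteq> q (\<sigma> i)) \<and>
      (\<lambda>i. p (\<sigma> i)) \<longlonglongrightarrow> 0 \<and> (\<lambda>i. q (\<sigma> i)) \<longlonglongrightarrow> 0 \<and>
      (\<lambda>i. c (\<sigma> i) *s (p (\<sigma> i) - q (\<sigma> i))) \<longlonglongrightarrow> v"
    using \<sigma>(1) assms(2-4)[THEN filterlim_compose, OF \<sigma>(2)] by simp
  then show ?thesis unfolding C5_def by (intro CollectI exI)
qed

text \<open>A nonzero limit already forces the two points to be distinct for parameters close to
  0.\<close>

lemma C5I_nonzero:
  assumes "\<forall>\<^sub>F s in at (0::complex). p s \<in> X" "\<forall>\<^sub>F s in at 0. q s \<in> X"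
    and "(p \<longlongrightarrow> 0) (at 0)" "(q \<longlongrightarrow> 0) (at 0)"
    and lim: "((\<lambda>s. c s *s (p s - q s)) \<longlongrightarrow> v) (at 0)" and "v \<noteq> 0"
  shows "v \<in> C5 X"
proof (rule C5I[OF _ assms(3-5)])
  have "\<forall>\<^sub>F s in at 0. c s *s (p s - q s) \<noteq> 0"
    using lim \<open>v \<noteq> 0\<close> by (rule tendsto_imp_eventually_ne)
  with assms(1,2) show "\<forall>\<^sub>F s in at 0. p s \<in> X \<and> q s \<in> X \<and> p s \<noteq> q s"
    by eventually_elim auto
qed

text \<open>Secants through the origin produce these vectors. This covers the zero vector too, where
  distinctness of the points cannot be read off from the limit and comes from
  \<open>\<phi> s \<noteq> 0\<close>.\<close>

lemma multiple_of_tangent_in_C5: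
  assumes lt: "leading_term \<phi> m t" and m: "m > 0" and X: "\<forall>\<^sub>F u in nhds 0. \<phi> u \<in> X"
  shows "\<alpha> *s t \<in> C5 X"
proof (rule C5I[where p = \<phi> and q = "\<lambda>_. 0" and c = "\<lambda>s. \<alpha> / s ^ m"])
  have 0: "\<phi> 0 = 0" using leading_term_at_0[OF lt] m by (simp add: vec_eq_iff)
  then have "0 \<in> X" using eventually_nhds_x_imp_x[OF X] by simp
  moreover have "\<forall>\<^sub>F s in at 0. \<phi> s \<in> X" using X by (simp add: eventually_nhds_conv_at)
  ultimately show "\<forall>\<^sub>F s in at 0. \<phi> s \<in> X \<and> 0 \<in> X \<and> \<phi> s \<noteq> 0"
    using leading_term_nonzero[OF lt] by (simp add: eventually_conj_iff)
  show "(\<phi> \<longlongrightarrow> 0) (at 0)" using leading_term_tendsto_0[OF lt m, of "\<lambda>x. x" "at 0"] by simp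
  show "((\<lambda>s. (\<alpha> / s ^ m) *s (\<phi> s - 0)) \<longlongrightarrow> \<alpha> *s t) (at 0)"
    using leading_term_scaled_tendsto[OF lt] by simp
qed (rule tendsto_const)

text \<open>If the restrictions to all fibres of \<open>g\<close> over \<open>A\<close> were
  trivial, \<open>g\<close> would eventually avoid all of \<open>A\<close>. This replaces choosing a
  subsequence on which a finitely valued quantity is constant.\<close>

lemma filter_pigeonhole:
  assumes F: "F \<noteq> bot" and A: "finite A" and g: "\<forall>\<^sub>F i in F. g i \<in> A"
  shows "\<exists>a\<in>A. inf F (principal {i. g i = a}) \<noteq> bot"
proof (rule ccontr)
  assume no: "\<not> ?thesis"
  have "\<forall>\<^sub>F i in F. g i \<noteq> a" if "a \<in> A" for a
  proof -
    have "inf F (principal {i. g i = a}) = bot" using no that by blast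
    then have "\<forall>\<^sub>F i in inf F (principal {i. g i = a}). False" by simp
    then show ?thesis unfolding eventually_inf_principal by (rule eventually_mono) simp
  qed
  then have "\<forall>\<^sub>F i in F. \<forall>a\<in>A. g i \<noteq> a" using A by (intro eventually_ball_finite) auto
  with g have "\<forall>\<^sub>F i in F. False" by eventually_elim blast
  with F show False by simp
qed

text \<open>With \<open>p * m = q * n\<close> and \<open>\<zeta> ^ n = 1\<close>, the arc runs over pairs of points with the same
  coordinate \<open>a\<close> of two branches on which this coordinate is \<open>u ^ m\<close> and \<open>v ^ n\<close>.\<close>

definition secant_arc ::
    "(complex \<Rightarrow> complex ^ 'n) \<Rightarrow> (complex \<Rightarrow> complex ^ 'n) \<Rightarrow> nat \<Rightarrow> nat \<Rightarrow> complex
      \<Rightarrow> complex \<Rightarrow> complex ^ 'n" where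
  "secant_arc \<phi> \<psi> p q \<zeta> s = \<phi> (s ^ p) - \<psi> (\<zeta> * s ^ q)"

text \<open>Coordinate \<open>a\<close> of the scaled secant is
  \<open>c i * (u i ^ m - v i ^ n)\<close>, so its limit \<open>x $ a\<close> is the scalar with
  which the tangent vector enters. What remains is a limit along pairs of points with equal
  coordinate \<open>a\<close>.\<close>

lemma secant_limit_along_arc:
  fixes \<phi> \<psi> :: "complex \<Rightarrow> complex ^ 'n"
  assumes an: "\<And>j. (\<lambda>u. \<phi> u $ j) analytic_on {0}"
    and z: "\<And>i. i < m \<Longrightarrow> coeff_vec \<phi> i = 0" and m: "m > 0" and n: "n > 0"
    and p: "p > 0" and pq: "p * m = q * n"
    and pa: "\<forall>\<^sub>F u in nhds 0. \<phi> u $ a = u ^ m" and pb: "\<forall>\<^sub>F v in nhds 0. \<psi> v $ a = v ^ n"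
    and F: "F \<noteq> bot" and u: "(u \<longlongrightarrow> 0) F" and v: "(v \<longlongrightarrow> 0) F"
    and lim: "((\<lambda>i. c i *s (\<phi> (u i) - \<psi> (v i))) \<longlongrightarrow> x) F"
  shows "\<exists>\<zeta> s F'. \<zeta> ^ n = 1 \<and> F' \<noteq> bot \<and> (s \<longlongrightarrow> 0) F' \<and>
    ((\<lambda>i. c i *s secant_arc \<phi> \<psi> p q \<zeta> (s i)) \<longlongrightarrow> x - x $ a *s coeff_vec \<phi> m) F'"
proof -
  define t where "t = coeff_vec \<phi> m"
  define y where "y = (\<lambda>i. v i ^ n)"
  define u' where "u' = (\<lambda>i. near_root m (u i) (y i))"
  have u'm: "u' i ^ m = v i ^ n" for i by (simp add: u'_def y_def near_root_power[OF m])
  have "((\<lambda>i. v i ^ n) \<longlongrightarrow> 0 ^ n) F" by (intro tendsto_intros v)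
  then have y: "(y \<longlongrightarrow> 0) F" using n by (simp add: y_def zero_power)
  have u': "(u' \<longlongrightarrow> 0) F"
    by (rule root_tendsto_0[OF _ m]) (use y in \<open>simp add: u'm y_def\<close>)
  have "((\<lambda>i. (c i *s (\<phi> (u i) - \<psi> (v i))) $ a) \<longlongrightarrow> x $ a) F"
    using lim by (rule tendsto_vec_nth)
  moreover have "\<forall>\<^sub>F i in F. (c i *s (\<phi> (u i) - \<psi> (v i))) $ a = c i * (u i ^ m - y i)"
    using eventually_compose_filterlim[OF pa u] eventually_compose_filterlim[OF pb v]
    by eventually_elim (simp add: y_def right_diff_distrib)
  ultimately have "((\<lambda>i. c i * (u i ^ m - y i)) \<longlongrightarrow> x $ a) F"
    by (rule Lim_transform_eventually)
  then have "((\<lambda>i. c i *s (\<phi> (u i) - \<phi> (u' i))) \<longlongrightarrow> x $ a *s t) F"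
    unfolding u'_def t_def by (intro increment_tendsto[OF an z m u y])
  from tendsto_diff[OF lim this]
  have lim': "((\<lambda>i. c i *s (\<phi> (u' i) - \<psi> (v i))) \<longlongrightarrow> x - x $ a *s t) F"
    by (rule Lim_transform_eventually) (simp add: vec_eq_iff algebra_simps)
  \<comment> \<open>Any \<open>p\<close>-th root of \<open>u'\<close> serves. Since
    \<open>u' ^ m = v ^ n\<close> and \<open>p * m = q * n\<close>, the quotient of \<open>v\<close>
    by \<open>s ^ q\<close> is an \<open>n\<close>-th root of unity.\<close>
  define s where "s = (\<lambda>i. near_root p 0 (u' i))"
  have sp: "s i ^ p = u' i" for i unfolding s_def by (rule near_root_power[OF p])
  have s: "(s \<longlongrightarrow> 0) F" by (rule root_tendsto_0[OF _ p]) (simp add: sp u')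
  have "q > 0" using pq m p by (cases q) auto
  \<comment> \<open>At \<open>s i = 0\<close> also \<open>v i = 0\<close>, so any root of unity fits
    there; 1 is the default.\<close>
  define \<zeta> where "\<zeta> = (\<lambda>i. if s i = 0 then 1 else v i / s i ^ q)"
  have v\<zeta>: "v i = \<zeta> i * s i ^ q" for i
  proof (cases "s i = 0")
    case True
    then have "u' i = 0" using sp[of i] p by (simp add: power_0_left)
    then have "v i = 0" using u'm[of i] m n by (simp add: power_0_left)
    with True \<open>q > 0\<close> show ?thesis by simp
  qed (simp add: \<zeta>_def)
  have \<zeta>n: "\<zeta> i ^ n = 1" for i
  proof (cases "s i = 0")
    case False
    have "v i ^ n = s i ^ (p * m)" by (simp add: power_mult sp u'm)
    also have "\<dots> = (s i ^ q) ^ n" by (simp add: pq power_mult)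
    finally show ?thesis using False by (simp add: \<zeta>_def power_divide)
  qed (simp add: \<zeta>_def)
  \<comment> \<open>The root of unity depends on \<open>i\<close> but takes finitely many values, so
    restricting the filter makes it constant and leaves a single arc.\<close>
  obtain z0 where z0: "z0 \<in> {z::complex. z ^ n = 1}" "inf F (principal {i. \<zeta> i = z0}) \<noteq> bot"
    using filter_pigeonhole[OF F finite_roots_unity[of n], of \<zeta>] \<zeta>n n by auto
  let ?F = "inf F (principal {i. \<zeta> i = z0})"
  have "?F \<le> F" by simp
  have "((\<lambda>i. c i *s (\<phi> (u' i) - \<psi> (v i))) \<longlongrightarrow> x - x $ a *s t) ?F"
    by (rule tendsto_mono[OF \<open>?F \<le> F\<close> lim'])
  moreover have "\<forall>\<^sub>F i in ?F. c i *s (\<phi> (u' i) - \<psi> (v i)) = c i *s secant_arc \<phi> \<psi> p q z0 (s i)"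
    unfolding eventually_inf_principal
  proof (intro always_eventually allI impI)
    fix i assume "i \<in> {i. \<zeta> i = z0}"
    then have "v i = z0 * s i ^ q" using v\<zeta>[of i] by simp
    then show "c i *s (\<phi> (u' i) - \<psi> (v i)) = c i *s secant_arc \<phi> \<psi> p q z0 (s i)"
      by (simp only: secant_arc_def sp)
  qed
  ultimately have "((\<lambda>i. c i *s secant_arc \<phi> \<psi> p q z0 (s i)) \<longlongrightarrow> x - x $ a *s t) ?F"
    by (rule Lim_transform_eventually)
  moreover have "(s \<longlongrightarrow> 0) ?F" by (rule tendsto_mono[OF \<open>?F \<le> F\<close> s])
  ultimately show ?thesis using z0 unfolding t_def by blast
qed

text \<open>An arc may vanish identically, for instance for \<open>\<zeta> = 1\<close> when the two
  parametrizations and the exponents \<open>p\<close> and \<open>q\<close> agree. Then only the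
  tangent part of the limit survives, which is the first alternative.\<close>

lemma secant_limit_in_plane:
  fixes \<phi> \<psi> :: "complex \<Rightarrow> complex ^ 'n"
  assumes "\<And>j. (\<lambda>u. \<phi> u $ j) analytic_on {0}"
    and "\<And>i. i < m \<Longrightarrow> coeff_vec \<phi> i = 0" "m > 0" "n > 0" "p > 0" "p * m = q * n"
    and "\<forall>\<^sub>F u in nhds 0. \<phi> u $ a = u ^ m" "\<forall>\<^sub>F v in nhds 0. \<psi> v $ a = v ^ n"
    and "F \<noteq> bot" "(u \<longlongrightarrow> 0) F" "(v \<longlongrightarrow> 0) F"
    and "((\<lambda>i. c i *s (\<phi> (u i) - \<psi> (v i))) \<longlongrightarrow> x) F"
  shows "\<exists>\<zeta>. \<zeta> ^ n = 1 \<and>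
    ((\<forall>\<^sub>F s in nhds 0. secant_arc \<phi> \<psi> p q \<zeta> s = 0) \<and> x = x $ a *s coeff_vec \<phi> m \<or>
     (\<forall>k w. leading_term (secant_arc \<phi> \<psi> p q \<zeta>) k w \<longrightarrow> x \<in> plane (coeff_vec \<phi> m) w) \<and>
      \<not> (\<forall>\<^sub>F s in nhds 0. secant_arc \<phi> \<psi> p q \<zeta> s = 0))"
proof -
  obtain \<zeta> s F' where \<zeta>: "\<zeta> ^ n = 1" and F': "F' \<noteq> bot" and s: "(s \<longlongrightarrow> 0) F'"
    and lim: "((\<lambda>i. c i *s secant_arc \<phi> \<psi> p q \<zeta> (s i)) \<longlongrightarrow> x - x $ a *s coeff_vec \<phi> m) F'"
    using secant_limit_along_arc[OF assms] by blast
  show ?thesis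
  proof (cases "\<forall>\<^sub>F s in nhds 0. secant_arc \<phi> \<psi> p q \<zeta> s = 0")
    case True
    have "\<forall>\<^sub>F i in F'. c i *s secant_arc \<phi> \<psi> p q \<zeta> (s i) = 0"
      using eventually_compose_filterlim[OF True s] by eventually_elim (simp add: vec_eq_iff)
    then have "((\<lambda>i. 0) \<longlongrightarrow> x - x $ a *s coeff_vec \<phi> m) F'"
      by (rule Lim_transform_eventually[OF lim])
    then have "x = x $ a *s coeff_vec \<phi> m" using F' by (simp add: tendsto_const_iff)
    with True \<zeta> show ?thesis by blast
  next
    case False
    have "x \<in> plane (coeff_vec \<phi> m) w" if lt: "leading_term (secant_arc \<phi> \<psi> p q \<zeta>) k w" for k w
    proof -
      obtain \<beta> where "x - x $ a *s coeff_vec \<phi> m = \<beta> *s w"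
        using leading_term_tendsto[OF lt s F' lim] by blast
      then have "x = x $ a *s coeff_vec \<phi> m + \<beta> *s w" by (simp add: algebra_simps)
      then show ?thesis unfolding plane_def by blast
    qed
    with False \<zeta> show ?thesis by blast
  qed
qed

text \<open>Moving the first point of the arc along its branch adds a multiple of the tangent
  vector. Shifting the \<open>m\<close>-th power of its parameter by a multiple of
  \<open>s ^ k\<close> gives this contribution the same order as the arc, so every combination of
  the two directions is reached.\<close>

lemma plane_subset_C5:
  fixes \<phi> \<psi> :: "complex \<Rightarrow> complex ^ 'n"
  assumes an: "\<And>j. (\<lambda>u. \<phi> u $ j) analytic_on {0}"
    and z: "\<And>i. i < m \<Longrightarrow> coeff_vec \<phi> i = 0" and m: "m > 0" and n: "n > 0"
    and p: "p > 0" and pq: "p * m = q * n"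
    and pa: "\<forall>\<^sub>F u in nhds 0. \<phi> u $ a = u ^ m" and pb: "\<forall>\<^sub>F v in nhds 0. \<psi> v $ a = v ^ n"
    and lt\<psi>: "leading_term \<psi> n w'"
    and X\<phi>: "\<forall>\<^sub>F u in nhds 0. \<phi> u \<in> X" and X\<psi>: "\<forall>\<^sub>F v in nhds 0. \<psi> v \<in> X"
    and \<zeta>: "\<zeta> ^ n = 1" and lt: "leading_term (secant_arc \<phi> \<psi> p q \<zeta>) k w"
  shows "plane (coeff_vec \<phi> m) w \<subseteq> C5 X" and "coeff_vec \<phi> m $ a = 1" and "w $ a = 0"
proof -
  define t where "t = coeff_vec \<phi> m"
  have ta: "t $ a = 1" using coeff_vec_pure[OF pa, of m] by (simp add: t_def)
  then show "coeff_vec \<phi> m $ a = 1" by (simp add: t_def)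
  have "t \<noteq> 0" using ta by auto
  then have lt\<phi>: "leading_term \<phi> m t"
    unfolding t_def by (intro leading_term_coeff_vec an z)
  have "q > 0" using pq m p by (cases q) auto
  have pow0: "((\<lambda>s::complex. s ^ i) \<longlongrightarrow> 0) (nhds 0)" if "i > 0" for i
  proof -
    have "((\<lambda>s::complex. s ^ i) \<longlongrightarrow> 0 ^ i) (nhds 0)"
      by (intro tendsto_intros) (simp add: filterlim_ident)
    then show ?thesis using that by (simp add: zero_power)
  qed
  have \<zeta>q0: "((\<lambda>s::complex. \<zeta> * s ^ q) \<longlongrightarrow> 0) (nhds 0)"
    using tendsto_mult_right_zero[OF pow0[OF \<open>q > 0\<close>]] .
  have "\<forall>\<^sub>F s in nhds 0. secant_arc \<phi> \<psi> p q \<zeta> s $ a = 0"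
    using eventually_compose_filterlim[OF pa pow0[OF p]] eventually_compose_filterlim[OF pb \<zeta>q0]
  proof eventually_elim
    case (elim s)
    have "(s ^ p) ^ m = (\<zeta> * s ^ q) ^ n"
      by (simp add: power_mult_distrib \<zeta> pq flip: power_mult)
    with elim show ?case by (simp add: secant_arc_def)
  qed
  \<comment> \<open>Both points of the arc have the same coordinate \<open>a\<close>, so its leading
    coefficient vanishes there, while the tangent vector has coordinate 1. The two vectors are
    therefore independent.\<close>
  then show wa: "w $ a = 0" by (rule leading_term_component_zero[OF lt])
  have \<phi>0: "\<phi> 0 = 0" using leading_term_at_0[OF lt\<phi>] m by (simp add: vec_eq_iff)
  have \<psi>0: "\<psi> 0 = 0" using leading_term_at_0[OF lt\<psi>] n by (simp add: vec_eq_iff)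
  have w: "w \<noteq> 0" using lt by (simp add: leading_term_def)
  have k: "k > 0"
  proof (rule ccontr)
    assume "\<not> k > 0"
    then have "secant_arc \<phi> \<psi> p q \<zeta> 0 = w" using leading_term_at_0[OF lt] by simp
    moreover have "secant_arc \<phi> \<psi> p q \<zeta> 0 = 0"
      using p \<open>q > 0\<close> \<phi>0 \<psi>0 by (simp add: secant_arc_def zero_power)
    ultimately show False using w by simp
  qed
  show "plane (coeff_vec \<phi> m) w \<subseteq> C5 X"
  proof
    fix x assume "x \<in> plane (coeff_vec \<phi> m) w"
    then obtain \<alpha> \<beta> where x: "x = \<alpha> *s t + \<beta> *s w" by (auto simp: plane_def t_def)
    show "x \<in> C5 X"
    proof (cases "\<beta> = 0")
      case True
      then have "x = \<alpha> *s t" by (simp add: x vec_eq_iff)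
      then show ?thesis using multiple_of_tangent_in_C5[OF lt\<phi> m X\<phi>] by simp
    next
      case False
      \<comment> \<open>The shift is chosen so that
        \<open>c s * ((s ^ p) ^ m - y s) = - \<alpha>\<close> for \<open>s \<noteq> 0\<close>, where
        \<open>c s\<close> is the scalar that turns the arc into \<open>\<beta> *s w\<close> in the
        limit.\<close>
      define y where "y = (\<lambda>s. (s ^ p) ^ m + (\<alpha> / \<beta>) * s ^ k)"
      define u where "u = (\<lambda>s. near_root m (s ^ p) (y s))"
      define c where "c = (\<lambda>s. \<beta> / s ^ k)"
      have at: "(f \<longlongrightarrow> 0) (at 0)" if "(f \<longlongrightarrow> 0) (nhds 0)" for f :: "complex \<Rightarrow> complex"
        using that by (simp add: tendsto_nhds_iff)
      have sp0: "((\<lambda>s::complex. s ^ p) \<longlongrightarrow> 0) (at 0)" using at[OF pow0[OF p]] .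
      have "(y \<longlongrightarrow> 0 ^ m + (\<alpha> / \<beta>) * 0) (at 0)"
        unfolding y_def by (intro tendsto_intros sp0 at[OF pow0[OF k]])
      then have y0: "(y \<longlongrightarrow> 0) (at 0)" using m by (simp add: zero_power)
      then have u0: "(u \<longlongrightarrow> 0) (at 0)"
        using root_tendsto_0[OF _ m, of u] by (simp add: u_def near_root_power[OF m])
      have ne: "\<forall>\<^sub>F s in at 0. s \<noteq> (0::complex)" by (simp add: eventually_at_filter)
      then have "\<forall>\<^sub>F s in at 0. - \<alpha> = c s * ((s ^ p) ^ m - y s)"
        by eventually_elim (use False in \<open>simp add: c_def y_def\<close>)
      then have "((\<lambda>s. c s * ((s ^ p) ^ m - y s)) \<longlongrightarrow> - \<alpha>) (at 0)"
        by (rule Lim_transform_eventually[OF tendsto_const])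
      then have "((\<lambda>s. c s *s (\<phi> (s ^ p) - \<phi> (u s))) \<longlongrightarrow> (- \<alpha>) *s t) (at 0)"
        unfolding u_def t_def by (intro increment_tendsto[OF an z m sp0 y0])
      from tendsto_diff[OF leading_term_scaled_tendsto[OF lt, of \<beta>] this]
      have lim: "((\<lambda>s. c s *s (\<phi> (u s) - \<psi> (\<zeta> * s ^ q))) \<longlongrightarrow> x) (at 0)"
        by (simp add: x c_def secant_arc_def algebra_simps)
      have "x \<noteq> 0"
      proof
        assume "x = 0"
        have "x $ a = \<alpha>" by (simp add: x ta wa)
        then have "\<alpha> = 0" by (simp add: \<open>x = 0\<close>)
        then show False using x w False \<open>x = 0\<close> by (simp add: vec_eq_iff)
      qed
      show ?thesis
      proof (rule C5I_nonzero[OF _ _ _ _ lim \<open>x \<noteq> 0\<close>])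
        show "\<forall>\<^sub>F s in at 0. \<phi> (u s) \<in> X" using eventually_compose_filterlim[OF X\<phi> u0] .
        show "\<forall>\<^sub>F s in at 0. \<psi> (\<zeta> * s ^ q) \<in> X"
          using eventually_compose_filterlim[OF X\<psi> at[OF \<zeta>q0]] .
        show "((\<lambda>s. \<phi> (u s)) \<longlongrightarrow> 0) (at 0)" using leading_term_tendsto_0[OF lt\<phi> m u0] .
        show "((\<lambda>s. \<psi> (\<zeta> * s ^ q)) \<longlongrightarrow> 0) (at 0)"
          using leading_term_tendsto_0[OF lt\<psi> n at[OF \<zeta>q0]] .
      qed
    qed
  qed
qed

section \<open>Parametrized branches\<close>

text \<open>Preimages are picked in one fixed disc. They tend to 0 by themselves, because
  \<open>norm (\<phi> s)\<close> is bounded below there by a multiple of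
  \<open>norm s ^ m\<close>.\<close>

lemma branch_param_lift:
  assumes bp: "branch_param \<phi> Z m" and w: "(w \<longlongrightarrow> 0) F" "\<forall>\<^sub>F i in F. w i \<in> Z"
  obtains u where "(u \<longlongrightarrow> 0) F" "\<forall>\<^sub>F i in F. \<phi> (u i) = w i"
proof -
  have m: "m > 0" using bp by (simp add: branch_param_def)
  obtain c where c: "c > 0" "\<forall>\<^sub>F s in nhds 0. c * norm s ^ m \<le> norm (\<phi> s)"
    using leading_term_lower_bound[OF branch_param_leading_term[OF bp]] .
  from c(2) obtain e where e: "e > 0" "\<And>s. norm s < e \<Longrightarrow> c * norm s ^ m \<le> norm (\<phi> s)"
    by (auto simp: eventually_nhds_metric)
  define u where "u = (\<lambda>i. SOME s. norm s < e \<and> \<phi> s = w i)"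
  have "\<forall>\<^sub>F z in nhds 0. z \<in> Z \<longrightarrow> z \<in> \<phi> ` ball 0 e" using bp e(1) by (simp add: branch_param_def)
  from eventually_compose_filterlim[OF this w(1)] w(2)
  have u: "\<forall>\<^sub>F i in F. norm (u i) < e \<and> \<phi> (u i) = w i"
  proof eventually_elim
    case (elim i)
    then have "\<exists>s. norm s < e \<and> \<phi> s = w i" by auto
    then show ?case unfolding u_def by (rule someI_ex)
  qed
  have "((\<lambda>i. u i ^ m) \<longlongrightarrow> 0) F"
  proof (rule Lim_null_comparison)
    show "\<forall>\<^sub>F i in F. norm (u i ^ m) \<le> norm (w i) / c"
      using u
    proof eventually_elim
      case (elim i)
      then have "c * norm (u i) ^ m \<le> norm (w i)" using e(2)[of "u i"] by simp
      then show ?case using c(1) by (simp add: norm_power pos_le_divide_eq mult.commute)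
    qed
    show "((\<lambda>i. norm (w i) / c) \<longlongrightarrow> 0) F"
      using tendsto_divide[OF tendsto_norm[OF w(1)] tendsto_const[of c]] c(1) by simp
  qed
  then have "(u \<longlongrightarrow> 0) F" using m by (rule root_tendsto_0)
  moreover have "\<forall>\<^sub>F i in F. \<phi> (u i) = w i" using u by eventually_elim simp
  ultimately show ?thesis by (rule that)
qed

lemma branch_param_at_0:
  assumes "branch_param \<phi> Z m"
  shows "\<phi> 0 = 0" and "0 \<in> Z"
proof -
  show "\<phi> 0 = 0"
    using leading_term_at_0[OF branch_param_leading_term[OF assms]] assms
    by (simp add: branch_param_def vec_eq_iff zero_power)
  moreover have "\<phi> 0 \<in> Z"
    using eventually_nhds_x_imp_x[of "\<lambda>u. \<phi> u \<in> Z" 0] assms by (simp add: branch_param_def)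
  ultimately show "0 \<in> Z" by simp
qed

lemma tangent_cone_branch_param:
  assumes bp: "branch_param \<phi> Z m"
  shows "tangent_cone Z = range (\<lambda>c. c *s coeff_vec \<phi> m)"
proof (intro equalityI subsetI)
  fix v assume "v \<in> tangent_cone Z"
  then obtain w c where w: "\<And>i::nat. w i \<in> Z" "w \<longlonglongrightarrow> 0" "(\<lambda>i. c i *s w i) \<longlonglongrightarrow> v"
    by (auto simp: tangent_cone_def)
  obtain u where u: "u \<longlonglongrightarrow> 0" "\<forall>\<^sub>F i in sequentially. \<phi> (u i) = w i"
    using branch_param_lift[OF bp w(2)] w(1) by auto
  have lim: "(\<lambda>i. c i *s \<phi> (u i)) \<longlonglongrightarrow> v"
    by (rule Lim_transform_eventually[OF w(3)]) (use u(2) in eventually_elim, simp)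
  then show "v \<in> range (\<lambda>c. c *s coeff_vec \<phi> m)"
    using leading_term_tendsto[OF branch_param_leading_term[OF bp] u(1) trivial_limit_sequentially lim]
    by auto
next
  fix v assume "v \<in> range (\<lambda>c. c *s coeff_vec \<phi> m)"
  then obtain \<alpha> where v: "v = \<alpha> *s coeff_vec \<phi> m" by auto
  have m: "m > 0" and Z: "\<forall>\<^sub>F u in nhds 0. \<phi> u \<in> Z" using bp by (auto simp: branch_param_def)
  have lt: "leading_term \<phi> m (coeff_vec \<phi> m)" using bp by (rule branch_param_leading_term)
  have "\<forall>\<^sub>F u in at 0. \<phi> u \<in> Z" using Z by (simp add: eventually_nhds_conv_at)
  then obtain \<sigma> :: "nat \<Rightarrow> complex" where \<sigma>: "\<And>i. \<phi> (\<sigma> i) \<in> Z" "filterlim \<sigma> (at 0) sequentially"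
    using at_0_sequence by blast
  have "(\<phi> \<longlongrightarrow> 0) (at 0)" using leading_term_tendsto_0[OF lt m, of "\<lambda>x. x" "at 0"] by simp
  from filterlim_compose[OF this \<sigma>(2)] have "(\<lambda>i. \<phi> (\<sigma> i)) \<longlonglongrightarrow> 0" .
  moreover have "(\<lambda>i. (\<alpha> / \<sigma> i ^ m) *s \<phi> (\<sigma> i)) \<longlonglongrightarrow> v"
    unfolding v using filterlim_compose[OF leading_term_scaled_tendsto[OF lt] \<sigma>(2)] .
  ultimately have "(\<forall>i. \<phi> (\<sigma> i) \<in> Z) \<and> (\<lambda>i. \<phi> (\<sigma> i)) \<longlonglongrightarrow> 0 \<and>
      (\<lambda>i. (\<alpha> / \<sigma> i ^ m) *s \<phi> (\<sigma> i)) \<longlonglongrightarrow> v" using \<sigma>(1) by simp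
  then show "v \<in> tangent_cone Z" unfolding tangent_cone_def by (intro CollectI exI)
qed

text \<open>If \<open>\<phi> u $ a = u ^ m * g u\<close> with \<open>g 0 \<noteq> 0\<close>, then the inverse of \<open>u * g u powr (1/m)\<close> is the
  required change of parameter.\<close>

lemma branch_param_pure_coordinate:
  assumes bp: "branch_param \<phi> Z m" and ta: "coeff_vec \<phi> m $ a \<noteq> 0"
  shows "\<exists>\<phi>'. branch_param \<phi>' Z m \<and> (\<forall>\<^sub>F u in nhds 0. \<phi>' u $ a = u ^ m)"
proof -
  have m: "m > 0" and an: "\<And>j. (\<lambda>u. \<phi> u $ j) analytic_on {0}"
    and z: "\<And>i. i < m \<Longrightarrow> coeff_vec \<phi> i = 0"
    using bp by (auto simp: branch_param_def)
  define t where "t = coeff_vec \<phi> m"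
  have "fps_nth (fps_expansion (\<lambda>u. \<phi> u $ a) 0) i = 0" if "i < m" for i
    using z[OF that] by (simp add: coeff_vec_def vec_eq_iff)
  from analytic_factor_power[OF an this] obtain g where g: "g analytic_on {0}"
    "g 0 = t $ a" "\<forall>\<^sub>F u in nhds 0. \<phi> u $ a = u ^ m * g u"
    by (auto simp: t_def coeff_vec_def)
  obtain c where c: "c ^ m = t $ a" using m by (rule complex_root_exists)
  have c0: "c \<noteq> 0" using c ta m by (auto simp: t_def zero_power)
  \<comment> \<open>Dividing by \<open>t $ a\<close> moves the argument of \<open>Ln\<close> close
    to 1, away from the branch cut; the factor \<open>c\<close> restores the constant.\<close>
  define \<rho> where "\<rho> = (\<lambda>u. c * exp (Ln (g u / t $ a) / of_nat m))"
  have \<rho>: "\<rho> analytic_on {0}"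
    unfolding \<rho>_def using g(2) ta m by (intro analytic_intros g(1)) (auto simp: t_def)
  have \<rho>0: "\<rho> 0 = c" using ta by (simp add: \<rho>_def g(2) t_def)
  have "\<forall>\<^sub>F u in nhds 0. g u \<noteq> 0"
    using tendsto_imp_eventually_ne[OF analytic_tendsto_nhds[OF g(1)]] ta by (simp add: g(2) t_def)
  then have \<rho>m: "\<forall>\<^sub>F u in nhds 0. \<rho> u ^ m = g u"
  proof eventually_elim
    case (elim u)
    have "\<rho> u ^ m = c ^ m * exp (Ln (g u / t $ a))"
      using m by (simp add: \<rho>_def power_mult_distrib flip: exp_of_nat_mult)
    also have "\<dots> = g u" using elim ta by (simp add: c t_def)
    finally show ?case .
  qed
  define \<sigma> where "\<sigma> = (\<lambda>u. u * \<rho> u)"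
  have \<sigma>: "\<sigma> analytic_on {0}" unfolding \<sigma>_def by (intro analytic_intros \<rho>)
  have \<sigma>0: "\<sigma> 0 = 0" by (simp add: \<sigma>_def)
  have "(\<rho> has_field_derivative deriv \<rho> 0) (at 0)"
    using \<rho> by (simp add: analytic_on_imp_differentiable_at field_differentiable_derivI)
  then have "(\<sigma> has_field_derivative c) (at 0)"
    unfolding \<sigma>_def by (auto intro!: derivative_eq_intros simp: \<rho>0)
  then have d\<sigma>: "deriv \<sigma> 0 = c" by (rule DERIV_imp_deriv)
  have \<phi>\<sigma>: "\<forall>\<^sub>F u in nhds 0. \<phi> u $ a = \<sigma> u ^ m"
    using g(3) \<rho>m by eventually_elim (simp add: \<sigma>_def power_mult_distrib)
  obtain R where R: "R > 0" "\<sigma> holomorphic_on ball 0 R" using \<sigma> by (auto simp: analytic_on_def)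
  obtain r where r: "r > 0" "ball (0::complex) r \<subseteq> ball 0 R" "open (\<sigma> ` ball 0 r)" "inj_on \<sigma> (ball 0 r)"
  proof (rule has_complex_derivative_locally_invertible[OF R(2), of 0])
    show "0 \<in> ball (0::complex) R" using R(1) by simp
    show "deriv \<sigma> 0 \<noteq> 0" using d\<sigma> c0 by simp
  qed (rule open_ball, rule that)
  have hol: "\<sigma> holomorphic_on ball 0 r" using R(2) r(2) by (rule holomorphic_on_subset)
  obtain \<tau> where \<tau>: "\<tau> holomorphic_on \<sigma> ` ball 0 r"
    "\<And>u. u \<in> ball 0 r \<Longrightarrow> deriv \<sigma> u * deriv \<tau> (\<sigma> u) = 1"
    "\<And>u. u \<in> ball 0 r \<Longrightarrow> \<tau> (\<sigma> u) = u"
    using holomorphic_has_inverse[OF hol open_ball r(4)] by blast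
  have 0: "0 \<in> \<sigma> ` ball 0 r" using r(1) \<sigma>0 by (auto intro!: image_eqI[of _ _ 0])
  have \<tau>0: "\<tau> 0 = 0" using \<tau>(3)[of 0] r(1) \<sigma>0 by simp
  have d\<tau>: "deriv \<tau> 0 \<noteq> 0" using \<tau>(2)[of 0] r(1) \<sigma>0 by auto
  have \<tau>an: "\<tau> analytic_on {0}"
    using \<tau>(1) r(3) 0 analytic_at by blast
  have "\<forall>\<^sub>F y in nhds 0. y \<in> \<sigma> ` ball 0 r" using r(3) 0 by (rule eventually_nhds_in_open)
  then have \<sigma>\<tau>: "\<forall>\<^sub>F y in nhds 0. \<sigma> (\<tau> y) = y" by eventually_elim (use \<tau>(3) in auto)
  have \<tau>lim: "(\<tau> \<longlongrightarrow> 0) (nhds 0)" using analytic_tendsto_nhds[OF \<tau>an] by (simp add: \<tau>0)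
  have "fps_nth (fps_expansion \<tau> 0) i = 0" if "i < 1" for i
    using that by (simp add: fps_expansion_def \<tau>0)
  from analytic_factor_power[where k = 1, OF \<tau>an this] obtain \<kappa> where \<kappa>: "\<kappa> analytic_on {0}"
    "\<kappa> 0 = deriv \<tau> 0" "\<forall>\<^sub>F y in nhds 0. \<tau> y = y * \<kappa> y"
    by (auto simp: fps_expansion_def)
  define \<phi>' where "\<phi>' = (\<lambda>y. \<phi> (\<tau> y))"
  have an': "(\<lambda>u. \<phi>' u $ j) analytic_on {0}" for j
    using analytic_on_compose[OF \<tau>an, of "\<lambda>u. \<phi> u $ j"] an[of j] by (simp add: \<phi>'_def o_def \<tau>0)
  have pure: "\<forall>\<^sub>F y in nhds 0. \<phi>' y $ a = y ^ m"
    using eventually_compose_filterlim[OF \<phi>\<sigma> \<tau>lim] \<sigma>\<tau> by eventually_elim (simp add: \<phi>'_def)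
  obtain h where h: "(h \<longlongrightarrow> t) (nhds 0)" "\<forall>\<^sub>F s in nhds 0. \<phi> s = s ^ m *s h s"
    using branch_param_leading_term[OF bp] by (auto simp: leading_term_def t_def)
  have t: "t \<noteq> 0" using bp by (simp add: t_def branch_param_def)
  have lt': "leading_term \<phi>' m (deriv \<tau> 0 ^ m *s t)"
  proof (rule leading_termI)
    show "deriv \<tau> 0 ^ m *s t \<noteq> 0" using d\<tau> t by (simp add: vec_eq_iff)
    have "(\<kappa> \<longlongrightarrow> deriv \<tau> 0) (nhds 0)" using analytic_tendsto_nhds[OF \<kappa>(1)] by (simp add: \<kappa>(2))
    then show "((\<lambda>y. \<kappa> y ^ m *s h (\<tau> y)) \<longlongrightarrow> deriv \<tau> 0 ^ m *s t) (nhds 0)"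
      by (intro tendsto_intros filterlim_compose[OF h(1) \<tau>lim])
    show "\<forall>\<^sub>F y in nhds 0. \<phi>' y = y ^ m *s (\<kappa> y ^ m *s h (\<tau> y))"
      using eventually_compose_filterlim[OF h(2) \<tau>lim] \<kappa>(3)
      by eventually_elim (simp add: \<phi>'_def power_mult_distrib)
  qed
  have "branch_param \<phi>' Z m" unfolding branch_param_def
  proof (intro conjI allI impI)
    show "coeff_vec \<phi>' i = 0" if "i < m" for i using coeff_vec_leading_term[OF an' lt'] that by blast
    show "coeff_vec \<phi>' m \<noteq> 0" using coeff_vec_leading_term[OF an' lt'] lt' by (simp add: leading_term_def)
    have "\<forall>\<^sub>F u in nhds 0. \<phi> u \<in> Z" using bp by (simp add: branch_param_def)
    then show "\<forall>\<^sub>F u in nhds 0. \<phi>' u \<in> Z"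
      using eventually_compose_filterlim[OF _ \<tau>lim] by (auto simp: \<phi>'_def)
    fix e :: real assume "e > 0"
    have "(\<sigma> \<longlongrightarrow> 0) (nhds 0)" using analytic_tendsto_nhds[OF \<sigma>] by (simp add: \<sigma>0)
    then have "\<forall>\<^sub>F u in nhds 0. norm (\<sigma> u) < e" using \<open>e > 0\<close> by (simp add: tendsto_iff)
    moreover have "\<forall>\<^sub>F u in nhds 0. norm u < r"
      using r(1) by (auto simp: eventually_nhds_metric)
    ultimately have "\<forall>\<^sub>F u in nhds 0. norm (\<sigma> u) < e \<and> norm u < r" by (rule eventually_conj)
    then obtain e' where e': "e' > 0" "\<And>u. norm u < e' \<Longrightarrow> norm (\<sigma> u) < e \<and> norm u < r"
      by (auto simp: eventually_nhds_metric)
    have "\<phi> ` ball 0 e' \<subseteq> \<phi>' ` ball 0 e"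
    proof
      fix x assume "x \<in> \<phi> ` ball 0 e'"
      then obtain u where u: "norm u < e'" "x = \<phi> u" by auto
      then have "x = \<phi>' (\<sigma> u)" using e'(2)[of u] \<tau>(3)[of u] by (simp add: \<phi>'_def)
      then show "x \<in> \<phi>' ` ball 0 e" using e'(2)[OF u(1)] by auto
    qed
    moreover have "\<forall>\<^sub>F z in nhds 0. z \<in> Z \<longrightarrow> z \<in> \<phi> ` ball 0 e'"
      using bp e'(1) by (simp add: branch_param_def)
    ultimately show "\<forall>\<^sub>F z in nhds 0. z \<in> Z \<longrightarrow> z \<in> \<phi>' ` ball 0 e"
      by (auto elim!: eventually_mono)
  qed (use m an' in auto)
  with pure show ?thesis by blast
qed

section \<open>Planes and their irreducibility\<close>

text \<open>\<open>plane t w\<close> degenerates if the vectors are dependent. Independence is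
  expressed by a nonzero minor of size 2, the form in which Cramer's rule uses it.\<close>

definition complex_plane :: "(complex ^ 'n) set \<Rightarrow> bool" where
  "complex_plane L \<longleftrightarrow> (\<exists>t w a b. t $ a * w $ b - t $ b * w $ a \<noteq> 0 \<and> L = plane t w)"

lemma plane_scale:
  assumes "c \<noteq> 0"
  shows "plane t (c *s w) = plane t w"
proof (intro equalityI subsetI)
  fix x assume "x \<in> plane t (c *s w)"
  then obtain \<alpha> \<beta> where "x = \<alpha> *s t + \<beta> *s (c *s w)" by (auto simp: plane_def)
  then have "x = \<alpha> *s t + (\<beta> * c) *s w" by (simp add: vec_eq_iff)
  then show "x \<in> plane t w" unfolding plane_def by blast
next
  fix x assume "x \<in> plane t w"
  then obtain \<alpha> \<beta> where "x = \<alpha> *s t + \<beta> *s w" by (auto simp: plane_def)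
  then have "x = \<alpha> *s t + (\<beta> / c) *s (c *s w)" using assms by (simp add: vec_eq_iff)
  then show "x \<in> plane t (c *s w)" unfolding plane_def by blast
qed

lemma tangent_in_plane: "\<alpha> *s t \<in> plane t w"
  unfolding plane_def by (intro CollectI exI[of _ \<alpha>] exI[of _ 0]) (simp add: vec_eq_iff)

lemma plane_line:
  assumes "x \<in> plane t w" "y \<in> plane t w"
  shows "x + c *s (y - x) \<in> plane t w"
proof -
  obtain \<alpha> \<beta> \<gamma> \<delta> where "x = \<alpha> *s t + \<beta> *s w" "y = \<gamma> *s t + \<delta> *s w"
    using assms by (auto simp: plane_def)
  then have "x + c *s (y - x) = (\<alpha> + c * (\<gamma> - \<alpha>)) *s t + (\<beta> + c * (\<delta> - \<beta>)) *s w"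
    by (simp add: vec_eq_iff algebra_simps)
  then show ?thesis unfolding plane_def by blast
qed

section \<open>Analytic sets and complex lines\<close>

lemma cholomorphic_on_component: "cholomorphic_on (\<lambda>z. z $ i) V"
  unfolding cholomorphic_on_def
  by (auto intro!: exI[of _ "\<lambda>z. z $ i"] bounded_linear_imp_has_derivative bounded_linear_vec_nth)

lemma cholomorphic_on_cmult:
  assumes "cholomorphic_on f V"
  shows "cholomorphic_on (\<lambda>z. c * f z) V"
  unfolding cholomorphic_on_def
proof
  fix z assume "z \<in> V"
  then obtain f' where "(f has_derivative f') (at z)" "\<forall>c x. f' (c *s x) = c * f' x"
    using assms by (auto simp: cholomorphic_on_def)
  then show "\<exists>g. ((\<lambda>z. c * f z) has_derivative g) (at z) \<and> (\<forall>c x. g (c *s x) = c * g x)"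
    by (intro exI[of _ "\<lambda>x. c * f' x"]) (auto intro!: derivative_eq_intros)
qed

lemma cholomorphic_on_diff:
  assumes "cholomorphic_on f V" "cholomorphic_on g V"
  shows "cholomorphic_on (\<lambda>z. f z - g z) V"
  unfolding cholomorphic_on_def
proof
  fix z assume "z \<in> V"
  then obtain f' g' where "(f has_derivative f') (at z)" "\<forall>c x. f' (c *s x) = c * f' x"
    "(g has_derivative g') (at z)" "\<forall>c x. g' (c *s x) = c * g' x"
    using assms unfolding cholomorphic_on_def by blast
  then show "\<exists>h. ((\<lambda>z. f z - g z) has_derivative h) (at z) \<and> (\<forall>c x. h (c *s x) = c * h x)"
    by (intro exI[of _ "\<lambda>x. f' x - g' x"]) (auto intro!: derivative_eq_intros simp: right_diff_distrib)
qed

lemma cholomorphic_on_subset: "cholomorphic_on f V \<Longrightarrow> W \<subseteq> V \<Longrightarrow> cholomorphic_on f W"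
  by (auto simp: cholomorphic_on_def)

lemma cholomorphic_on_isCont:
  assumes "cholomorphic_on f V" "z \<in> V"
  shows "isCont f z"
  using assms has_derivative_continuous by (fastforce simp: cholomorphic_on_def)

text \<open>Cramer's rule turns membership in the plane into linear equations, one per coordinate.\<close>

lemma complex_plane_analytic_at:
  assumes "complex_plane L"
  shows "analytic_at L p"
proof -
  obtain t w a b where D: "t $ a * w $ b - t $ b * w $ a \<noteq> 0" and L: "L = plane t w"
    using assms by (auto simp: complex_plane_def)
  define D where "D = t $ a * w $ b - t $ b * w $ a"
  have D0: "D \<noteq> 0" using D by (simp add: D_def)
  define f where "f = (\<lambda>k (z :: complex ^ 'a). D * z $ k - t $ k * (w $ b * z $ a - w $ a * z $ b)
      - w $ k * (t $ a * z $ b - t $ b * z $ a))"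
  have hol: "cholomorphic_on (f k) UNIV" for k
    unfolding f_def
    by (intro cholomorphic_on_diff cholomorphic_on_cmult cholomorphic_on_component)
  have "z \<in> L \<longleftrightarrow> (\<forall>k. f k z = 0)" for z
  proof
    assume "z \<in> L"
    then obtain \<alpha> \<beta> where "z = \<alpha> *s t + \<beta> *s w" by (auto simp: L plane_def)
    then show "\<forall>k. f k z = 0" by (simp add: f_def D_def algebra_simps)
  next
    assume eq: "\<forall>k. f k z = 0"
    define \<alpha> where "\<alpha> = (w $ b * z $ a - w $ a * z $ b) / D"
    define \<beta> where "\<beta> = (t $ a * z $ b - t $ b * z $ a) / D"
    have "z $ k = \<alpha> * t $ k + \<beta> * w $ k" for k
    proof -
      have "D * z $ k = t $ k * (\<alpha> * D) + w $ k * (\<beta> * D)"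
        using eq[rule_format, of k] D0 by (simp add: f_def \<alpha>_def \<beta>_def diff_eq_eq)
      then have "D * z $ k = D * (\<alpha> * t $ k + \<beta> * w $ k)" by (simp add: algebra_simps)
      then show ?thesis using D0 by simp
    qed
    then have "z = \<alpha> *s t + \<beta> *s w" by (simp add: vec_eq_iff)
    then show "z \<in> L" unfolding L plane_def by blast
  qed
  then show ?thesis unfolding analytic_at_def
    by (intro exI[of _ UNIV] exI[of _ "range f"]) (auto simp: hol)
qed

lemma cholomorphic_on_line:
  assumes f: "cholomorphic_on f V" and T: "\<And>c. c \<in> T \<Longrightarrow> q + c *s d \<in> V"
  shows "(\<lambda>c. f (q + c *s d)) holomorphic_on T"
  unfolding holomorphic_on_def
proof
  fix c assume "c \<in> T"
  then obtain f' where f': "(f has_derivative f') (at (q + c *s d))" "\<forall>c x. f' (c *s x) = c * f' x"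
    using f T unfolding cholomorphic_on_def by blast
  have "((\<lambda>c. q + c *s d) has_derivative (\<lambda>c. c *s d)) (at c)"
  proof -
    have "bounded_linear (\<lambda>c. c *s d)"
      by (intro bounded_linear_intro[where K = "norm d"]) (auto simp: vec_eq_iff algebra_simps norm_smult)
    then have "((\<lambda>c. c *s d) has_derivative (\<lambda>c. c *s d)) (at c)"
      by (rule bounded_linear_imp_has_derivative)
    then show ?thesis by (auto intro!: derivative_eq_intros)
  qed
  then have "((\<lambda>c. f (q + c *s d)) has_derivative (\<lambda>c. f' (c *s d))) (at c)"
    using f'(1) by (rule has_derivative_compose[of _ _ _ UNIV, simplified])
  then have "((\<lambda>c. f (q + c *s d)) has_field_derivative f' d) (at c)"
    using f'(2) by (simp add: has_field_derivative_def mult.commute[of "f' d"] mult_commute_abs)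
  then show "(\<lambda>c. f (q + c *s d)) field_differentiable at c within T"
    unfolding field_differentiable_def using has_field_derivative_at_within by blast
qed

text \<open>Identity theorem on a line: the interior of the set of good parameters is also closed,
  since at a limit point the local equations vanish on a nonempty open part of a disc and hence on
  the whole disc. By connectedness it is everything.\<close>

lemma analytic_set_contains_line:
  assumes A: "\<And>p. analytic_at A p" and ev: "\<forall>\<^sub>F c in nhds 0. q + c *s d \<in> A"
  shows "q + c *s d \<in> A"
proof -
  define S where "S = {c. q + c *s d \<in> A}"
  have cont: "continuous_on UNIV (\<lambda>c. q + c *s d)"
    by (intro continuous_on_vec_lambda continuous_intros continuous_on_add) (simp_all add: vector_scalar_mult_def continuous_intros)
  have "closed (interior S)"
    unfolding closed_limpt
  proof (intro allI impI)
    fix c0 assume lim: "c0 islimpt interior S"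
    obtain V F where V: "open V" "q + c0 *s d \<in> V" and F: "\<forall>f\<in>F. cholomorphic_on f V"
      and AV: "A \<inter> V = {z \<in> V. \<forall>f\<in>F. f z = 0}"
      using A[of "q + c0 *s d"] by (auto simp: analytic_at_def)
    have "open ((\<lambda>c. q + c *s d) -` V)" using cont V(1) by (rule open_vimage[rotated])
    then obtain e where e: "e > 0" "ball c0 e \<subseteq> (\<lambda>c. q + c *s d) -` V"
      using V(2) by (metis openE vimageI)
    obtain c1 where c1: "c1 \<in> interior S" "c1 \<in> ball c0 e"
      using lim e(1) unfolding islimpt_approachable by (auto simp: dist_commute)
    have "ball c0 e \<subseteq> S"
    proof
      fix c assume c: "c \<in> ball c0 e"
      have "f (q + c *s d) = 0" if f: "f \<in> F" for f
      proof -
        have hol: "(\<lambda>c. f (q + c *s d)) holomorphic_on ball c0 e"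
          using F f e(2) by (intro cholomorphic_on_line[of f V]) auto
        have zero: "f (q + c *s d) = 0" if "c \<in> interior S \<inter> ball c0 e" for c
        proof -
          have "c \<in> S" "q + c *s d \<in> V" using that interior_subset[of S] e(2) by blast+
          then have "q + c *s d \<in> A \<inter> V" by (simp add: S_def)
          then show ?thesis unfolding AV using f by simp
        qed
        have op: "open (interior S \<inter> ball c0 e)" by auto
        have ne: "interior S \<inter> ball c0 e \<noteq> {}" using c1 by blast
        have hol0: "(\<lambda>_::complex. 0::complex) holomorphic_on ball c0 e" by simp
        show ?thesis
          using analytic_continuation_open[OF op open_ball ne connected_ball inf_le2 hol hol0 zero c] .
      qed
      moreover have "q + c *s d \<in> V" using e(2) c by blast
      ultimately have "q + c *s d \<in> A \<inter> V" unfolding AV by blast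
      then show "c \<in> S" by (simp add: S_def)
    qed
    then show "c0 \<in> interior S" using e(1) by (meson centre_in_ball interiorI open_ball)
  qed
  moreover have "open (interior S)" by simp
  moreover have "0 \<in> interior S"
    using ev by (auto simp: S_def eventually_nhds interior_def)
  ultimately have "interior S = UNIV" using connected_UNIV clopen by blast
  then have "S = UNIV" using interior_subset[of S] by auto
  then show ?thesis by (auto simp: S_def)
qed

lemma analytic_set_closed:
  assumes "analytic_at A p" "p \<notin> A"
  shows "\<forall>\<^sub>F z in nhds p. z \<notin> A"
proof -
  obtain V F where V: "open V" "p \<in> V" and F: "\<forall>f\<in>F. cholomorphic_on f V"
    and AV: "A \<inter> V = {z \<in> V. \<forall>f\<in>F. f z = 0}"
    using assms(1) by (auto simp: analytic_at_def)
  obtain f where f: "f \<in> F" "f p \<noteq> 0" using assms(2) AV V(2) by auto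
  have "isCont f p" using F f(1) V(2) by (auto intro: cholomorphic_on_isCont)
  then have "(f \<longlongrightarrow> f p) (nhds p)" by (simp add: tendsto_nhds_iff isCont_def)
  then have "\<forall>\<^sub>F z in nhds p. f z \<noteq> 0" using f(2) by (rule tendsto_imp_eventually_ne)
  moreover have "\<forall>\<^sub>F z in nhds p. z \<in> V" using V by (rule eventually_nhds_in_open)
  ultimately show ?thesis by eventually_elim (use AV f(1) in auto)
qed

text \<open>If neither part were the whole plane, a point outside \<open>A\<close> could be joined
  to a point outside \<open>B\<close> by a complex line in the plane. Near the first point the line
  avoids \<open>A\<close>, so it runs in \<open>B\<close>; by continuation all of it lies in
  \<open>B\<close>, the second point included.\<close>

lemma complex_plane_irreducible:
  assumes L: "complex_plane L"
  shows "irreducible_analytic_set L"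
  unfolding irreducible_analytic_set_def
proof (intro conjI allI impI)
  show "analytic_at L p" for p using L by (rule complex_plane_analytic_at)
  obtain t w where tw: "L = plane t w" using L by (auto simp: complex_plane_def)
  then show "L \<noteq> {}" using tangent_in_plane by blast
  fix A B assume AB: "(\<forall>p. analytic_at A p) \<and> (\<forall>p. analytic_at B p) \<and> L = A \<union> B"
  show "L = A \<or> L = B"
  proof (rule ccontr)
    assume "\<not> ?thesis"
    then obtain p0 p1 where p: "p0 \<in> L" "p0 \<notin> A" "p1 \<in> L" "p1 \<notin> B" using AB by blast
    have "((\<lambda>c. p0 + c *s (p1 - p0)) \<longlongrightarrow> p0 + 0 *s (p1 - p0)) (nhds 0)"
      by (intro tendsto_intros) (simp add: filterlim_ident)
    then have lim: "((\<lambda>c. p0 + c *s (p1 - p0)) \<longlongrightarrow> p0) (nhds 0)" by simp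
    have "\<forall>\<^sub>F z in nhds p0. z \<notin> A" using AB p(2) by (intro analytic_set_closed) auto
    from eventually_compose_filterlim[OF this lim]
    have "\<forall>\<^sub>F c in nhds 0. p0 + c *s (p1 - p0) \<in> B"
    proof eventually_elim
      case (elim c)
      have "p0 + c *s (p1 - p0) \<in> L" using p unfolding tw by (intro plane_line)
      then show ?case using elim AB by blast
    qed
    then have "p0 + 1 *s (p1 - p0) \<in> B" using AB by (intro analytic_set_contains_line) auto
    with p(4) show False by simp
  qed
qed

section \<open>Irreducible components of a finite union\<close>

lemma analytic_at_Int:
  assumes "analytic_at A p" "analytic_at B p"
  shows "analytic_at (A \<inter> B) p"
proof -
  obtain V F where V: "open V" "p \<in> V" "finite F" and F: "\<forall>f\<in>F. cholomorphic_on f V"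
    and AV: "A \<inter> V = {z \<in> V. \<forall>f\<in>F. f z = 0}"
    using assms(1) by (auto simp: analytic_at_def)
  obtain W G where W: "open W" "p \<in> W" "finite G" and G: "\<forall>f\<in>G. cholomorphic_on f W"
    and BW: "B \<inter> W = {z \<in> W. \<forall>f\<in>G. f z = 0}"
    using assms(2) by (auto simp: analytic_at_def)
  have "A \<inter> B \<inter> (V \<inter> W) = {z \<in> V \<inter> W. \<forall>f\<in>F \<union> G. f z = 0}" using AV BW by blast
  moreover have "\<forall>f\<in>F \<union> G. cholomorphic_on f (V \<inter> W)"
    using F G cholomorphic_on_subset by blast
  ultimately show ?thesis unfolding analytic_at_def
    using V W by (intro exI[of _ "V \<inter> W"] exI[of _ "F \<union> G"]) auto
qed

lemma analytic_at_Un: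
  assumes "analytic_at A p" "analytic_at B p"
  shows "analytic_at (A \<union> B) p"
proof -
  obtain V F where V: "open V" "p \<in> V" "finite F" and F: "\<forall>f\<in>F. cholomorphic_on f V"
    and AV: "A \<inter> V = {z \<in> V. \<forall>f\<in>F. f z = 0}"
    using assms(1) by (auto simp: analytic_at_def)
  obtain W G where W: "open W" "p \<in> W" "finite G" and G: "\<forall>f\<in>G. cholomorphic_on f W"
    and BW: "B \<inter> W = {z \<in> W. \<forall>f\<in>G. f z = 0}"
    using assms(2) by (auto simp: analytic_at_def)
  define H where "H = (\<lambda>(f, g) z. f z * g z) ` (F \<times> G)"
  have "(A \<union> B) \<inter> (V \<inter> W) = {z \<in> V \<inter> W. \<forall>h\<in>H. h z = 0}"
  proof (intro equalityI subsetI)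
    fix z assume "z \<in> (A \<union> B) \<inter> (V \<inter> W)"
    then have "z \<in> A \<inter> V \<or> z \<in> B \<inter> W" "z \<in> V \<inter> W" by auto
    then show "z \<in> {z \<in> V \<inter> W. \<forall>h\<in>H. h z = 0}" unfolding AV BW H_def by auto
  next
    fix z assume z: "z \<in> {z \<in> V \<inter> W. \<forall>h\<in>H. h z = 0}"
    then have "(\<forall>f\<in>F. f z = 0) \<or> (\<forall>g\<in>G. g z = 0)" unfolding H_def by auto
    then have "z \<in> A \<inter> V \<or> z \<in> B \<inter> W" using z unfolding AV BW by auto
    then show "z \<in> (A \<union> B) \<inter> (V \<inter> W)" using z by auto
  qed
  moreover have "cholomorphic_on h (V \<inter> W)" if h: "h \<in> H" for h
  proof -
    obtain f g where fg: "f \<in> F" "g \<in> G" "h = (\<lambda>z. f z * g z)" using h by (auto simp: H_def)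
    show ?thesis unfolding cholomorphic_on_def fg(3)
    proof
      fix z assume "z \<in> V \<inter> W"
      then obtain f' g' where "(f has_derivative f') (at z)" "\<forall>c x. f' (c *s x) = c * f' x"
        "(g has_derivative g') (at z)" "\<forall>c x. g' (c *s x) = c * g' x"
        using F G fg unfolding cholomorphic_on_def by blast
      then show "\<exists>h. ((\<lambda>z. f z * g z) has_derivative h) (at z) \<and> (\<forall>c x. h (c *s x) = c * h x)"
        by (intro exI[of _ "\<lambda>x. f z * g' x + f' x * g z"])
          (auto intro!: derivative_eq_intros simp: distrib_left mult_ac)
    qed
  qed
  moreover have "finite H" using V W by (simp add: H_def)
  ultimately show ?thesis unfolding analytic_at_def
    using V W by (intro exI[of _ "V \<inter> W"] exI[of _ H]) auto
qed

text \<open>The induction also carries the analyticity of the union, so that irreducibility applies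
  to the splitting of \<open>Z\<close> into \<open>Z \<inter> L\<close> and
  \<open>Z \<inter> \<Union>P\<close>.\<close>

lemma irreducible_subset_finite_union:
  assumes "finite P" "P \<noteq> {}" "\<And>L. L \<in> P \<Longrightarrow> \<forall>p. analytic_at L p"
    and "irreducible_analytic_set Z" "Z \<subseteq> \<Union>P"
  shows "\<exists>L\<in>P. Z \<subseteq> L"
proof -
  have "(\<forall>p. analytic_at (\<Union>P) p) \<and> (Z \<subseteq> \<Union>P \<longrightarrow> (\<exists>L\<in>P. Z \<subseteq> L))"
    using assms(1-3)
  proof (induction P rule: finite_ne_induct)
    case (insert L P)
    then have IH: "\<forall>p. analytic_at (\<Union>P) p" "Z \<subseteq> \<Union>P \<Longrightarrow> \<exists>L\<in>P. Z \<subseteq> L" and L: "\<forall>p. analytic_at L p"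
      by simp_all
    have "\<exists>K\<in>insert L P. Z \<subseteq> K" if "Z \<subseteq> \<Union>(insert L P)"
    proof -
      have "Z = (Z \<inter> L) \<union> (Z \<inter> \<Union>P)" using that by auto
      moreover have "\<forall>p. analytic_at Z p" using assms(4) by (simp add: irreducible_analytic_set_def)
      then have "\<forall>p. analytic_at (Z \<inter> L) p" "\<forall>p. analytic_at (Z \<inter> \<Union>P) p"
        using IH(1) L by (simp_all add: analytic_at_Int)
      ultimately have "Z = Z \<inter> L \<or> Z = Z \<inter> \<Union>P"
        using assms(4) unfolding irreducible_analytic_set_def by blast
      then show ?thesis using IH(2) by blast
    qed
    moreover have "analytic_at (\<Union>(insert L P)) p" for p
      using IH(1) L by (simp add: analytic_at_Un)
    ultimately show ?case by blast
  qed auto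
  then show ?thesis using assms(5) by blast
qed

text \<open>A component lies in a single plane of the family; that plane is itself irreducible, so
  maximality makes the two equal.\<close>

lemma irreducible_components_planes:
  assumes P: "finite P" "\<And>L. L \<in> P \<Longrightarrow> complex_plane L"
  shows "irreducible_components (\<Union>P) \<subseteq> P"
proof
  fix Z assume "Z \<in> irreducible_components (\<Union>P)"
  then have Z: "irreducible_analytic_set Z" "Z \<subseteq> \<Union>P"
    and max: "\<And>W. irreducible_analytic_set W \<Longrightarrow> Z \<subseteq> W \<Longrightarrow> W \<subseteq> \<Union>P \<Longrightarrow> W = Z"
    by (auto simp: irreducible_components_def)
  have "P \<noteq> {}" using Z by (auto simp: irreducible_analytic_set_def)
  then obtain L where L: "L \<in> P" "Z \<subseteq> L"
    using irreducible_subset_finite_union[OF P(1) _ _ Z] complex_plane_analytic_at P(2) by blast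
  then have "L = Z" using complex_plane_irreducible P(2) by (intro max) auto
  with L(1) show "Z \<in> P" by simp
qed

section \<open>Branches with different tangents\<close>

lemma independent_combination_tendsto:
  fixes t w :: "complex ^ 'n"
  assumes h: "(h \<longlongrightarrow> t) F" "(k \<longlongrightarrow> w) F" and D: "t $ a * w $ b - t $ b * w $ a \<noteq> 0"
    and F: "F \<noteq> bot" and lim: "((\<lambda>i. f i *s h i - g i *s k i) \<longlongrightarrow> x) F"
  shows "x \<in> plane t w"
proof -
  define X where "X = (\<lambda>i. f i *s h i - g i *s k i)"
  \<comment> \<open>The minor of the two moving vectors has a nonzero limit, so Cramer's rule writes
    the coefficients \<open>f\<close> and \<open>g\<close> as convergent quotients.\<close>
  define E where "E = (\<lambda>i. h i $ a * k i $ b - h i $ b * k i $ a)"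
  note c = tendsto_vec_nth[OF h(1)] tendsto_vec_nth[OF h(2)] tendsto_vec_nth[OF lim[folded X_def]]
  have E: "(E \<longlongrightarrow> t $ a * w $ b - t $ b * w $ a) F"
    unfolding E_def by (intro tendsto_intros c)
  have E0: "\<forall>\<^sub>F i in F. E i \<noteq> 0" using E D by (rule tendsto_imp_eventually_ne)
  have "((\<lambda>i. (X i $ a * k i $ b - X i $ b * k i $ a) / E i) \<longlongrightarrow>
      (x $ a * w $ b - x $ b * w $ a) / (t $ a * w $ b - t $ b * w $ a)) F" (is "(_ \<longlongrightarrow> ?\<alpha>) F")
    by (intro tendsto_intros c E D)
  moreover have "\<forall>\<^sub>F i in F. (X i $ a * k i $ b - X i $ b * k i $ a) / E i = f i"
    using E0 by eventually_elim (simp add: X_def E_def field_simps)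
  ultimately have f: "(f \<longlongrightarrow> ?\<alpha>) F" by (rule Lim_transform_eventually)
  have "((\<lambda>i. (X i $ a * h i $ b - X i $ b * h i $ a) / E i) \<longlongrightarrow>
      (x $ a * t $ b - x $ b * t $ a) / (t $ a * w $ b - t $ b * w $ a)) F" (is "(_ \<longlongrightarrow> ?\<beta>) F")
    by (intro tendsto_intros c E D)
  moreover have "\<forall>\<^sub>F i in F. (X i $ a * h i $ b - X i $ b * h i $ a) / E i = g i"
    using E0 by eventually_elim (simp add: X_def E_def field_simps)
  ultimately have g: "(g \<longlongrightarrow> ?\<beta>) F" by (rule Lim_transform_eventually)
  have "((\<lambda>i. f i *s h i - g i *s k i) \<longlongrightarrow> ?\<alpha> *s t - ?\<beta> *s w) F" by (intro tendsto_intros f g h)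
  then have "x = ?\<alpha> *s t - ?\<beta> *s w" using lim F tendsto_unique by blast
  moreover have "\<alpha> *s t - \<beta> *s w \<in> plane t w" for \<alpha> \<beta>
    unfolding plane_def by (intro CollectI exI[of _ \<alpha>] exI[of _ "- \<beta>"]) (simp add: vec_eq_iff)
  ultimately show ?thesis by metis
qed

lemma not_proportional_minor:
  fixes t w :: "complex ^ 'n"
  assumes "t \<noteq> 0" "w \<noteq> 0" "range (\<lambda>c. c *s t) \<noteq> range (\<lambda>c. c *s w)"
  obtains a b where "t $ a * w $ b - t $ b * w $ a \<noteq> 0"
proof (rule ccontr)
  assume "\<not> thesis"
  then have eq: "t $ a * w $ b = t $ b * w $ a" for a b using that[of a b] by auto
  obtain a where a: "t $ a \<noteq> 0" using assms(1) by (rule vec_nonzero_component)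
  have w: "w = (w $ a / t $ a) *s t" using eq a by (simp add: vec_eq_iff field_simps)
  then have wa: "w $ a \<noteq> 0" using assms(2) by auto
  have t: "t = (t $ a / w $ a) *s w" using eq wa by (simp add: vec_eq_iff field_simps)
  have "range (\<lambda>c. c *s t) = range (\<lambda>c. c *s w)"
  proof (intro equalityI subsetI)
    fix x assume "x \<in> range (\<lambda>c. c *s t)"
    then obtain c where "x = c *s t" by auto
    then have "x = (c * (t $ a / w $ a)) *s w" using t by (metis vector_smult_assoc)
    then show "x \<in> range (\<lambda>c. c *s w)" by blast
  next
    fix x assume "x \<in> range (\<lambda>c. c *s w)"
    then obtain c where "x = c *s w" by auto
    then have "x = (c * (w $ a / t $ a)) *s t" using w by (metis vector_smult_assoc)
    then show "x \<in> range (\<lambda>c. c *s t)" by blast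
  qed
  with assms(3) show False by simp
qed

lemma branch_param_eventually_in:
  assumes A: "branch_param \<phi> A m" and AX: "\<forall>\<^sub>F z in nhds 0. z \<in> A \<longrightarrow> z \<in> X"
  shows "\<forall>\<^sub>F u in nhds 0. \<phi> u \<in> X"
proof -
  have "m > 0" using A by (simp add: branch_param_def)
  then have "(\<phi> \<longlongrightarrow> 0) (nhds 0)"
    using leading_term_tendsto_0[OF branch_param_leading_term[OF A], of "\<lambda>x. x" "nhds 0"]
    by (simp add: filterlim_ident)
  from eventually_compose_filterlim[OF AX this] have "\<forall>\<^sub>F u in nhds 0. \<phi> u \<in> A \<longrightarrow> \<phi> u \<in> X" .
  moreover have "\<forall>\<^sub>F u in nhds 0. \<phi> u \<in> A" using A by (simp add: branch_param_def)
  ultimately show ?thesis by eventually_elim simp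
qed

text \<open>Independent tangent vectors exclude cancellation, so the leading terms alone decide
  every limit and one plane receives all of them.\<close>

lemma secant_limits_distinct_tangents:
  assumes A: "branch_param \<phi> A m" and B: "branch_param \<psi> B n"
    and ne: "tangent_cone A \<noteq> tangent_cone B"
    and AX: "\<forall>\<^sub>F z in nhds 0. z \<in> A \<longrightarrow> z \<in> X" and BX: "\<forall>\<^sub>F z in nhds 0. z \<in> B \<longrightarrow> z \<in> X"
  shows "\<exists>L. complex_plane L \<and> L \<subseteq> C5 X \<and> (\<forall>v. secant_limit A B v \<longrightarrow> v \<in> L)"
proof -
  define t where "t = coeff_vec \<phi> m"
  define w where "w = coeff_vec \<psi> n"
  have m: "m > 0" and n: "n > 0" using A B by (simp_all add: branch_param_def)
  have lt: "leading_term \<phi> m t" "leading_term \<psi> n w"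
    using A B by (simp_all add: t_def w_def branch_param_leading_term)
  obtain a b where D: "t $ a * w $ b - t $ b * w $ a \<noteq> 0"
    using not_proportional_minor[of t w] lt ne
    by (auto simp: leading_term_def tangent_cone_branch_param[OF A] tangent_cone_branch_param[OF B]
        t_def w_def)
  obtain h where h: "(h \<longlongrightarrow> t) (nhds 0)" "\<forall>\<^sub>F s in nhds 0. \<phi> s = s ^ m *s h s"
    using lt(1) by (auto simp: leading_term_def)
  obtain k where k: "(k \<longlongrightarrow> w) (nhds 0)" "\<forall>\<^sub>F s in nhds 0. \<psi> s = s ^ n *s k s"
    using lt(2) by (auto simp: leading_term_def)
  have "x \<in> plane t w" if sl: "secant_limit A B x" for x
  proof -
    obtain F :: "nat filter" and p q c where F: "F \<noteq> bot" and p: "(p \<longlongrightarrow> 0) F" and q: "(q \<longlongrightarrow> 0) F"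
      and mem: "\<forall>\<^sub>F i in F. p i \<in> A \<and> q i \<in> B" and lim: "((\<lambda>i. c i *s (p i - q i)) \<longlongrightarrow> x) F"
      using sl by (auto simp: secant_limit_def)
    obtain u where u: "(u \<longlongrightarrow> 0) F" "\<forall>\<^sub>F i in F. \<phi> (u i) = p i"
      using branch_param_lift[OF A p] mem by (auto simp: eventually_conj_iff)
    obtain v where v: "(v \<longlongrightarrow> 0) F" "\<forall>\<^sub>F i in F. \<psi> (v i) = q i"
      using branch_param_lift[OF B q] mem by (auto simp: eventually_conj_iff)
    have "\<forall>\<^sub>F i in F. c i *s (p i - q i)
        = (c i * u i ^ m) *s h (u i) - (c i * v i ^ n) *s k (v i)"
      using u(2) v(2) eventually_compose_filterlim[OF h(2) u(1)]
        eventually_compose_filterlim[OF k(2) v(1)]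
      by eventually_elim (simp add: vec_eq_iff algebra_simps)
    then have "((\<lambda>i. (c i * u i ^ m) *s h (u i) - (c i * v i ^ n) *s k (v i)) \<longlongrightarrow> x) F"
      by (rule Lim_transform_eventually[OF lim])
    then show ?thesis
      by (rule independent_combination_tendsto[OF filterlim_compose[OF h(1) u(1)]
            filterlim_compose[OF k(1) v(1)] D F])
  qed
  moreover have "plane t w \<subseteq> C5 X"
  proof
    have \<phi>X: "\<forall>\<^sub>F u in nhds 0. \<phi> u \<in> X" using A AX by (rule branch_param_eventually_in)
    have \<psi>X: "\<forall>\<^sub>F u in nhds 0. \<psi> u \<in> X" using B BX by (rule branch_param_eventually_in)
    fix x assume "x \<in> plane t w"
    then obtain \<alpha> \<beta> where x: "x = \<alpha> *s t + \<beta> *s w" by (auto simp: plane_def)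
    show "x \<in> C5 X"
    proof (cases "x = 0")
      case True
      then show ?thesis using multiple_of_tangent_in_C5[OF lt(1) m \<phi>X, of 0] by simp
    next
      case False
      \<comment> \<open>The parameters solve \<open>u ^ m = \<alpha> * s\<close> and
        \<open>v ^ n = - \<beta> * s\<close>, so that division by \<open>s\<close> turns the leading
        terms of the secant into the prescribed combination.\<close>
      define u where "u = (\<lambda>s. near_root m 0 (\<alpha> * s))"
      define v where "v = (\<lambda>s. near_root n 0 (- \<beta> * s))"
      have um: "u s ^ m = \<alpha> * s" and vn: "v s ^ n = - \<beta> * s" for s
        unfolding u_def v_def using m n by (simp_all add: near_root_power)
      have "((\<lambda>s. \<alpha> * s) \<longlongrightarrow> \<alpha> * 0) (at 0)" "((\<lambda>s. - \<beta> * s) \<longlongrightarrow> - \<beta> * 0) (at 0)"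
        by (intro tendsto_intros)+
      then have u0: "(u \<longlongrightarrow> 0) (at 0)" and v0: "(v \<longlongrightarrow> 0) (at 0)"
        using root_tendsto_0[of u m "at 0"] root_tendsto_0[of v n "at 0"] m n um vn by simp_all
      have "((\<lambda>s. \<alpha> *s h (u s) + \<beta> *s k (v s)) \<longlongrightarrow> x) (at 0)" unfolding x
        by (intro tendsto_intros filterlim_compose[OF h(1) u0] filterlim_compose[OF k(1) v0])
      moreover have "\<forall>\<^sub>F s in at 0. \<alpha> *s h (u s) + \<beta> *s k (v s) = (1 / s) *s (\<phi> (u s) - \<psi> (v s))"
        using eventually_compose_filterlim[OF h(2) u0] eventually_compose_filterlim[OF k(2) v0]
          eventually_neq_at_within[of 0 0 UNIV]
        by eventually_elim (simp add: um vn vec_eq_iff field_simps)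
      ultimately have lim: "((\<lambda>s. (1 / s) *s (\<phi> (u s) - \<psi> (v s))) \<longlongrightarrow> x) (at 0)"
        by (rule Lim_transform_eventually)
      show ?thesis
      proof (rule C5I_nonzero[OF _ _ _ _ lim False])
        show "\<forall>\<^sub>F s in at 0. \<phi> (u s) \<in> X" using eventually_compose_filterlim[OF \<phi>X u0] .
        show "\<forall>\<^sub>F s in at 0. \<psi> (v s) \<in> X" using eventually_compose_filterlim[OF \<psi>X v0] .
        show "((\<lambda>s. \<phi> (u s)) \<longlongrightarrow> 0) (at 0)" using leading_term_tendsto_0[OF lt(1) m u0] .
        show "((\<lambda>s. \<psi> (v s)) \<longlongrightarrow> 0) (at 0)" using leading_term_tendsto_0[OF lt(2) n v0] .
      qed
    qed
  qed
  moreover have "complex_plane (plane t w)" unfolding complex_plane_def using D by blast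
  ultimately show ?thesis by blast
qed

section \<open>Counting the planes\<close>

lemma leading_term_rotate:
  assumes lt: "leading_term f k w" and \<eta>: "\<eta> \<noteq> 0"
  shows "leading_term (\<lambda>s. f (\<eta> * s)) k (\<eta> ^ k *s w)"
proof -
  obtain h where h: "(h \<longlongrightarrow> w) (nhds 0)" "\<forall>\<^sub>F s in nhds 0. f s = s ^ k *s h s" and w: "w \<noteq> 0"
    using lt by (auto simp: leading_term_def)
  have "((\<lambda>s. \<eta> * s) \<longlongrightarrow> \<eta> * 0) (nhds 0)" by (intro tendsto_intros) (simp add: filterlim_ident)
  then have lim: "((\<lambda>s. \<eta> * s) \<longlongrightarrow> 0) (nhds 0)" by simp
  show ?thesis
  proof (rule leading_termI)
    show "\<eta> ^ k *s w \<noteq> 0" using w \<eta> by (simp add: vec_eq_iff)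
    show "((\<lambda>s. \<eta> ^ k *s h (\<eta> * s)) \<longlongrightarrow> \<eta> ^ k *s w) (nhds 0)"
      by (intro tendsto_intros filterlim_compose[OF h(1) lim])
    show "\<forall>\<^sub>F s in nhds 0. f (\<eta> * s) = s ^ k *s (\<eta> ^ k *s h (\<eta> * s))"
      using eventually_compose_filterlim[OF h(2) lim]
      by eventually_elim (simp add: power_mult_distrib mult.commute)
  qed
qed

lemma secant_arc_analytic:
  assumes an: "\<And>j. (\<lambda>u. \<phi> u $ j) analytic_on {0}" "\<And>j. (\<lambda>u. \<psi> u $ j) analytic_on {0}"
    and pq: "p > 0" "q > 0"
  shows "(\<lambda>s. secant_arc \<phi> \<psi> p q \<zeta> s $ j) analytic_on {0}"
proof -
  have "(\<lambda>s::complex. s ^ p) analytic_on {0}" "(\<lambda>s. \<zeta> * s ^ q) analytic_on {0}"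
    by (intro analytic_intros)+
  then have "(\<lambda>s. \<phi> (s ^ p) $ j) analytic_on {0}" "(\<lambda>s. \<psi> (\<zeta> * s ^ q) $ j) analytic_on {0}"
    using analytic_on_compose[of "\<lambda>s. s ^ p" "{0}" "\<lambda>u. \<phi> u $ j"]
      analytic_on_compose[of "\<lambda>s. \<zeta> * s ^ q" "{0}" "\<lambda>u. \<psi> u $ j"] an pq
    by (simp_all add: o_def zero_power)
  then show ?thesis unfolding secant_arc_def by (simp add: analytic_on_diff)
qed

lemma card_image_factor_le:
  assumes "finite A" "\<And>x y. x \<in> A \<Longrightarrow> y \<in> A \<Longrightarrow> f x = f y \<Longrightarrow> g x = g y"
  shows "card (g ` A) \<le> card (f ` A)"
proof -
  have "g x = (g \<circ> inv_into A f) (f x)" if "x \<in> A" for x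
    using assms(2)[OF that, of "inv_into A f (f x)"] that by (simp add: inv_into_into f_inv_into_f)
  then have "g ` A \<subseteq> (g \<circ> inv_into A f) ` (f ` A)" by (auto simp: image_iff)
  then show ?thesis using assms(1) by (meson card_image_le card_mono finite_imageI le_trans)
qed

text \<open>The quotient of the two parameters is a \<open>p\<close>-th root of unity
  \<open>\<rho>\<close>. As \<open>q\<close> is prime to \<open>p\<close>, some \<open>p\<close>-th
  root of unity \<open>\<eta>\<close> satisfies \<open>\<eta> ^ q = \<rho>\<close>, and substituting
  \<open>\<eta> * s\<close> carries one arc into the other. The leading coefficients then differ by
  a nonzero factor.\<close>

lemma secant_arc_rotate:
  assumes lt: "leading_term (secant_arc \<phi> \<psi> p q \<zeta>) k w"
    and lt': "leading_term (secant_arc \<phi> \<psi> p q \<zeta>') k' w'"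
    and pq: "coprime p q" "q > 0" and \<zeta>: "\<zeta> \<noteq> 0" "\<zeta>' \<noteq> 0" "\<zeta> ^ p = \<zeta>' ^ p"
  shows "plane t w = plane t w'"
proof -
  define \<rho> where "\<rho> = \<zeta>' / \<zeta>"
  have \<rho>: "\<rho> ^ p = 1" "\<rho> \<noteq> 0" "\<zeta>' = \<zeta> * \<rho>" using \<zeta> by (auto simp: \<rho>_def power_divide)
  obtain x y where "q * x = p * y + gcd q p" using bezout_nat[of q p] pq(2) by auto
  then have xy: "q * x = p * y + 1" using pq(1) by (simp add: gcd.commute)
  define \<eta> where "\<eta> = \<rho> ^ x"
  have \<eta>p: "\<eta> ^ p = 1" by (metis \<eta>_def \<rho>(1) mult.commute power_mult power_one)
  have "\<eta> ^ q = \<rho> ^ (q * x)" by (simp add: \<eta>_def mult.commute flip: power_mult)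
  also have "\<dots> = \<rho>" unfolding xy by (simp add: power_mult \<rho>(1))
  finally have \<eta>q: "\<eta> ^ q = \<rho>" .
  have "\<eta> \<noteq> 0" using \<rho>(2) by (simp add: \<eta>_def)
  have "secant_arc \<phi> \<psi> p q \<zeta>' = (\<lambda>s. secant_arc \<phi> \<psi> p q \<zeta> (\<eta> * s))"
    by (simp add: fun_eq_iff secant_arc_def power_mult_distrib \<eta>p \<eta>q \<rho>(3) mult.assoc)
  then have "leading_term (secant_arc \<phi> \<psi> p q \<zeta>') k (\<eta> ^ k *s w)"
    using leading_term_rotate[OF lt \<open>\<eta> \<noteq> 0\<close>] by simp
  then have "w' = \<eta> ^ k *s w" using leading_term_unique[OF lt'] by blast
  then show ?thesis using \<open>\<eta> \<noteq> 0\<close> by (simp add: plane_scale)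
qed

lemma complex_plane_axis:
  assumes "t $ a = 1" "w $ a = 0" "w \<noteq> 0"
  shows "complex_plane (plane t w)"
proof -
  obtain b where "w $ b \<noteq> 0" using assms(3) by (rule vec_nonzero_component)
  then have "t $ a * w $ b - t $ b * w $ a \<noteq> 0" using assms by simp
  then show ?thesis unfolding complex_plane_def by blast
qed

lemma secant_limit_lift:
  assumes "secant_limit A B x" "branch_param \<phi> A m" "branch_param \<psi> B n"
  obtains F :: "nat filter" and u v c where "F \<noteq> bot" "(u \<longlongrightarrow> 0) F" "(v \<longlongrightarrow> 0) F"
    "((\<lambda>i. c i *s (\<phi> (u i) - \<psi> (v i))) \<longlongrightarrow> x) F"
proof -
  obtain F :: "nat filter" and p q c where F: "F \<noteq> bot" and p: "(p \<longlongrightarrow> 0) F" and q: "(q \<longlongrightarrow> 0) F"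
    and mem: "\<forall>\<^sub>F i in F. p i \<in> A \<and> q i \<in> B" and lim: "((\<lambda>i. c i *s (p i - q i)) \<longlongrightarrow> x) F"
    using assms(1) by (auto simp: secant_limit_def)
  obtain u where u: "(u \<longlongrightarrow> 0) F" "\<forall>\<^sub>F i in F. \<phi> (u i) = p i"
    using branch_param_lift[OF assms(2) p] mem by (auto simp: eventually_conj_iff)
  obtain v where v: "(v \<longlongrightarrow> 0) F" "\<forall>\<^sub>F i in F. \<psi> (v i) = q i"
    using branch_param_lift[OF assms(3) q] mem by (auto simp: eventually_conj_iff)
  have "\<forall>\<^sub>F i in F. c i *s (p i - q i) = c i *s (\<phi> (u i) - \<psi> (v i))"
    using u(2) v(2) by eventually_elim simp
  then have "((\<lambda>i. c i *s (\<phi> (u i) - \<psi> (v i))) \<longlongrightarrow> x) F" by (rule Lim_transform_eventually[OF lim])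
  with F u(1) v(1) show ?thesis by (rule that)
qed

text \<open>The arcs belonging to \<open>\<zeta>\<close> and \<open>\<zeta>'\<close> are reparametrizations of each other if
  \<open>\<zeta> ^ (n div gcd m n) = \<zeta>' ^ (n div gcd m n)\<close>, and this power is a \<open>gcd m n\<close>-th root of unity.\<close>

lemma secant_limits_same_tangent:
  assumes A: "branch_param \<phi>0 A m" and B: "branch_param \<psi>0 B n"
    and eq: "tangent_cone A = tangent_cone B" and nle: "\<not> germ_le A B"
    and AX: "\<forall>\<^sub>F z in nhds 0. z \<in> A \<longrightarrow> z \<in> X" and BX: "\<forall>\<^sub>F z in nhds 0. z \<in> B \<longrightarrow> z \<in> X"
  shows "\<exists>P. finite P \<and> card P \<le> gcd m n \<and> (\<forall>L\<in>P. complex_plane L \<and> L \<subseteq> C5 X) \<and>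
    (\<forall>v. secant_limit A B v \<longrightarrow> v \<in> \<Union>P)"
proof -
  have m: "m > 0" and n: "n > 0" using A B by (simp_all add: branch_param_def)
  have t0: "coeff_vec \<phi>0 m \<noteq> 0" "coeff_vec \<psi>0 n \<noteq> 0" using A B by (simp_all add: branch_param_def)
  obtain a where a: "coeff_vec \<phi>0 m $ a \<noteq> 0" using t0(1) by (rule vec_nonzero_component)
  \<comment> \<open>The common tangent line makes the same coordinate nonzero in both tangent
    vectors, so one coordinate can become a pure power on both branches.\<close>
  have "1 *s coeff_vec \<phi>0 m \<in> range (\<lambda>c. c *s coeff_vec \<psi>0 n)"
    using eq unfolding tangent_cone_branch_param[OF A] tangent_cone_branch_param[OF B] by blast
  then have a': "coeff_vec \<psi>0 n $ a \<noteq> 0" using a by auto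
  obtain \<phi> where \<phi>: "branch_param \<phi> A m" and pa: "\<forall>\<^sub>F u in nhds 0. \<phi> u $ a = u ^ m"
    using branch_param_pure_coordinate[OF A a] by blast
  obtain \<psi> where \<psi>: "branch_param \<psi> B n" and pb: "\<forall>\<^sub>F u in nhds 0. \<psi> u $ a = u ^ n"
    using branch_param_pure_coordinate[OF B a'] by blast
  have an\<phi>: "\<And>j. (\<lambda>u. \<phi> u $ j) analytic_on {0}" and z: "\<And>i. i < m \<Longrightarrow> coeff_vec \<phi> i = 0"
    using \<phi> by (simp_all add: branch_param_def)
  have an\<psi>: "\<And>j. (\<lambda>u. \<psi> u $ j) analytic_on {0}" using \<psi> by (simp add: branch_param_def)
  define t where "t = coeff_vec \<phi> m"
  define d where "d = gcd m n"
  define p where "p = n div d"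
  define q where "q = m div d"
  have d: "d > 0" using m by (simp add: d_def)
  have nd: "n = p * d" and md: "m = q * d" by (simp_all add: p_def q_def d_def)
  have p: "p > 0" and q: "q > 0" using nd md m n by (auto intro: Nat.gr0I)
  have pq: "p * m = q * n" by (simp add: nd md mult_ac)
  have "coprime q p" unfolding p_def q_def d_def using m by (intro div_gcd_coprime) auto
  then have cop: "coprime p q" by (simp add: coprime_commute)
  define arc where "arc = secant_arc \<phi> \<psi> p q"
  \<comment> \<open>A vanishing arc would send \<open>\<phi> (s ^ p)\<close> into \<open>B\<close>
    for small \<open>s\<close>. Since \<open>s ^ p\<close> covers a whole disc, the germ of
    \<open>A\<close> would lie in that of \<open>B\<close>.\<close>
  have nz: "\<not> (\<forall>\<^sub>F s in nhds 0. arc \<zeta> s = 0)" for \<zeta>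
  proof
    assume "\<forall>\<^sub>F s in nhds 0. arc \<zeta> s = 0"
    moreover have "\<forall>\<^sub>F s in nhds 0. \<psi> (\<zeta> * s ^ q) \<in> B"
    proof -
      have "((\<lambda>s. \<zeta> * s ^ q) \<longlongrightarrow> \<zeta> * 0 ^ q) (nhds 0)"
        by (intro tendsto_intros) (simp add: filterlim_ident)
      then have "((\<lambda>s. \<zeta> * s ^ q) \<longlongrightarrow> 0) (nhds 0)" using q by (simp add: zero_power)
      moreover have "\<forall>\<^sub>F v in nhds 0. \<psi> v \<in> B" using \<psi> by (simp add: branch_param_def)
      ultimately show ?thesis by (rule eventually_compose_filterlim[rotated])
    qed
    ultimately have "\<forall>\<^sub>F s in nhds 0. \<phi> (s ^ p) \<in> B"
      by eventually_elim (simp add: arc_def secant_arc_def)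
    then obtain e where e: "e > 0" "\<And>s. norm s < e \<Longrightarrow> \<phi> (s ^ p) \<in> B"
      by (auto simp: eventually_nhds_metric)
    have "\<forall>\<^sub>F z in nhds 0. z \<in> A \<longrightarrow> z \<in> \<phi> ` ball 0 (e ^ p)"
      using \<phi> e(1) by (simp add: branch_param_def)
    then have "germ_le A B" unfolding germ_le_def
    proof eventually_elim
      case (elim x)
      show ?case
      proof
        assume "x \<in> A"
        with elim obtain u where u: "norm u < e ^ p" "x = \<phi> u" by auto
        obtain s where s: "s ^ p = u" using p by (rule complex_root_exists)
        have "norm s ^ p < e ^ p" using u(1) s by (metis norm_power)
        then have "norm s < e" using e(1) by (simp add: power_less_imp_less_base)
        then show "x \<in> B" using e(2) u(2) s by blast
      qed
    qed
    with nle show False by simp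
  qed
  have "\<exists>k w. leading_term (arc \<zeta>) k w" for \<zeta>
    using leading_term_or_zero[OF secant_arc_analytic[OF an\<phi> an\<psi> p q]] nz unfolding arc_def by blast
  then obtain K W where KW: "\<And>\<zeta>. leading_term (arc \<zeta>) (K \<zeta>) (W \<zeta>)" by metis
  define R where "R = {\<zeta>::complex. \<zeta> ^ n = 1}"
  define P where "P = (\<lambda>\<zeta>. plane t (W \<zeta>)) ` R"
  have finR: "finite R" unfolding R_def using finite_roots_unity[of n] n by simp
  have "card P \<le> card ((\<lambda>\<zeta>. \<zeta> ^ p) ` R)" unfolding P_def
  proof (rule card_image_factor_le[OF finR])
    fix \<zeta> \<zeta>' assume "\<zeta> \<in> R" "\<zeta>' \<in> R" and e: "\<zeta> ^ p = \<zeta>' ^ p"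
    then have "\<zeta> \<noteq> 0" "\<zeta>' \<noteq> 0" using n by (auto simp: R_def zero_power)
    then show "plane t (W \<zeta>) = plane t (W \<zeta>')"
      using secant_arc_rotate[OF KW[unfolded arc_def] KW[unfolded arc_def] cop q] e by blast
  qed
  also have "\<dots> \<le> card {z::complex. z ^ d = 1}"
  proof (rule card_mono)
    show "finite {z::complex. z ^ d = 1}" using finite_roots_unity[of d] d by simp
    show "(\<lambda>\<zeta>. \<zeta> ^ p) ` R \<subseteq> {z. z ^ d = 1}" by (auto simp: R_def nd power_mult)
  qed
  also have "\<dots> = gcd m n" using card_roots_unity_eq[OF d] by (simp add: d_def)
  finally have card: "card P \<le> gcd m n" .
  have planes: "complex_plane L \<and> L \<subseteq> C5 X" if L: "L \<in> P" for L
  proof -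
    obtain \<zeta> where \<zeta>: "\<zeta> ^ n = 1" "L = plane t (W \<zeta>)" using L by (auto simp: P_def R_def)
    note pl = plane_subset_C5[OF an\<phi> z m n p pq pa pb branch_param_leading_term[OF \<psi>]
        branch_param_eventually_in[OF \<phi> AX] branch_param_eventually_in[OF \<psi> BX] \<zeta>(1)
        KW[unfolded arc_def]]
    have "W \<zeta> \<noteq> 0" using KW[of \<zeta>] by (simp add: leading_term_def)
    then show ?thesis using pl complex_plane_axis[of t a "W \<zeta>"] by (simp add: \<zeta>(2) t_def)
  qed
  have "v \<in> \<Union>P" if sl: "secant_limit A B v" for v
  proof -
    obtain F :: "nat filter" and u y c where F: "F \<noteq> bot" "(u \<longlongrightarrow> 0) F" "(y \<longlongrightarrow> 0) F"
      "((\<lambda>i. c i *s (\<phi> (u i) - \<psi> (y i))) \<longlongrightarrow> v) F"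
      using secant_limit_lift[OF sl \<phi> \<psi>] by blast
    obtain \<zeta> where \<zeta>: "\<zeta> ^ n = 1" "v \<in> plane t (W \<zeta>)"
      using secant_limit_in_plane[OF an\<phi> z m n p pq pa pb F] nz KW
      unfolding arc_def t_def by blast
    then show ?thesis by (auto simp: P_def R_def)
  qed
  with finR card planes show ?thesis by (intro exI[of _ P]) (auto simp: P_def)
qed

text \<open>Both parametrizations agree and \<open>p = q = 1\<close>, so \<open>\<theta> = 1\<close>
  gives the zero arc and hence the tangent line. For \<open>m = 1\<close> there is no other root of
  unity: the secants of a smooth branch yield its tangent line only.\<close>

lemma secant_limit_branch_cases:
  assumes bp: "branch_param \<phi> A m" and pa: "\<forall>\<^sub>F u in nhds 0. \<phi> u $ a = u ^ m"
    and prim: "\<And>\<theta>. \<theta> ^ m = 1 \<Longrightarrow> \<theta> \<noteq> 1 \<Longrightarrow> \<not> (\<forall>\<^sub>F u in nhds 0. \<phi> u = \<phi> (\<theta> * u))"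
    and sl: "secant_limit A A x"
  shows "x \<in> tangent_cone A \<or> (\<exists>\<theta>. \<theta> ^ m = 1 \<and> \<theta> \<noteq> 1 \<and>
    (\<forall>k w. leading_term (secant_arc \<phi> \<phi> 1 1 \<theta>) k w \<longrightarrow> x \<in> plane (coeff_vec \<phi> m) w))"
proof -
  have an: "\<And>j. (\<lambda>u. \<phi> u $ j) analytic_on {0}" and z: "\<And>i. i < m \<Longrightarrow> coeff_vec \<phi> i = 0"
    and m: "m > 0"
    using bp by (simp_all add: branch_param_def)
  obtain F :: "nat filter" and u v c where F: "F \<noteq> bot" "(u \<longlongrightarrow> 0) F" "(v \<longlongrightarrow> 0) F"
    "((\<lambda>i. c i *s (\<phi> (u i) - \<phi> (v i))) \<longlongrightarrow> x) F"
    using secant_limit_lift[OF sl bp bp] by blast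
  obtain \<theta> where \<theta>: "\<theta> ^ m = 1"
    "(\<forall>\<^sub>F s in nhds 0. secant_arc \<phi> \<phi> 1 1 \<theta> s = 0) \<and> x = x $ a *s coeff_vec \<phi> m \<or>
     (\<forall>k w. leading_term (secant_arc \<phi> \<phi> 1 1 \<theta>) k w \<longrightarrow> x \<in> plane (coeff_vec \<phi> m) w) \<and>
      \<not> (\<forall>\<^sub>F s in nhds 0. secant_arc \<phi> \<phi> 1 1 \<theta> s = 0)"
    using secant_limit_in_plane[OF an z m m zero_less_one refl pa pa F] by blast
  show ?thesis
  proof (cases "\<theta> = 1")
    case True
    then have "secant_arc \<phi> \<phi> 1 1 \<theta> s = 0" for s by (simp add: secant_arc_def)
    then have "x = x $ a *s coeff_vec \<phi> m" using \<theta>(2) by simp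
    then show ?thesis unfolding tangent_cone_branch_param[OF bp] by blast
  next
    case False
    have "\<not> (\<forall>\<^sub>F s in nhds 0. secant_arc \<phi> \<phi> 1 1 \<theta> s = 0)"
      using prim[OF \<theta>(1) False] by (simp add: secant_arc_def)
    with \<theta> False show ?thesis by blast
  qed
qed

text \<open>The planes are indexed by the orders in \<open>M\<close>, so all \<open>\<theta>\<close>
  with the same order share a plane. The 1 subtracted from the cardinality accounts for
  \<open>m\<close>, which belongs to \<open>ChAM\<close> but is not such an order.\<close>

lemma secant_limits_branch:
  assumes bp: "branch_param \<phi> A m" and pa: "\<forall>\<^sub>F u in nhds 0. \<phi> u $ a = u ^ m"
    and prim: "\<And>\<theta>. \<theta> ^ m = 1 \<Longrightarrow> \<theta> \<noteq> 1 \<Longrightarrow> \<not> (\<forall>\<^sub>F u in nhds 0. \<phi> u = \<phi> (\<theta> * u))"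
    and mult: "multiplicity_germ A = m" and m2: "m \<ge> 2"
    and AX: "\<forall>\<^sub>F z in nhds 0. z \<in> A \<longrightarrow> z \<in> X"
  shows "\<exists>P. finite P \<and> card P \<le> card (ChAM A \<phi>) - 1 \<and> (\<forall>L\<in>P. complex_plane L \<and> L \<subseteq> C5 X) \<and>
    (\<forall>v. secant_limit A A v \<longrightarrow> v \<in> \<Union>P) \<and> tangent_cone A \<subseteq> \<Union>P"
proof -
  have an: "\<And>j. (\<lambda>u. \<phi> u $ j) analytic_on {0}" and z: "\<And>i. i < m \<Longrightarrow> coeff_vec \<phi> i = 0"
    and m: "m > 0"
    using bp by (simp_all add: branch_param_def)
  define t where "t = coeff_vec \<phi> m"
  define C where "C = {\<theta>::complex. \<theta> ^ m = 1 \<and> \<theta> \<noteq> 1}"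
  define M where "M = (\<lambda>\<theta>. INF j. ord0 (\<lambda>u. \<phi> u $ j - \<phi> (\<theta> * u) $ j)) ` C"
  have ChAM: "ChAM A \<phi> = insert (enat m) M" by (simp add: ChAM_def mult M_def C_def)
  have "C \<subseteq> {\<theta>. \<theta> ^ m = 1}" by (auto simp: C_def)
  then have finC: "finite C" by (rule finite_subset) (rule finite_roots_unity, use m in simp)
  have key: "\<exists>k. (INF j. ord0 (\<lambda>u. \<phi> u $ j - \<phi> (\<theta> * u) $ j)) = enat k \<and> k \<noteq> m \<and> \<theta> ^ k \<noteq> 1 \<and>
      leading_term (secant_arc \<phi> \<phi> 1 1 \<theta>) k ((1 - \<theta> ^ k) *s coeff_vec \<phi> k)" if "\<theta> \<in> C" for \<theta>
  proof -
    have \<theta>: "\<theta> ^ m = 1" "\<theta> \<noteq> 1" using that by (auto simp: C_def)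
    have arc: "secant_arc \<phi> \<phi> 1 1 \<theta> = (\<lambda>u. \<phi> u - \<phi> (\<theta> * u))"
      by (simp add: fun_eq_iff secant_arc_def)
    have an': "(\<lambda>u. (\<phi> u - \<phi> (\<theta> * u)) $ j) analytic_on {0}" for j
      using secant_arc_analytic[OF an an zero_less_one zero_less_one, of \<theta> j] by (simp only: arc)
    have "\<not> (\<forall>\<^sub>F u in nhds 0. \<phi> u - \<phi> (\<theta> * u) = 0)" using prim[OF \<theta>] by simp
    then obtain k where k: "\<forall>i<k. coeff_vec (\<lambda>u. \<phi> u - \<phi> (\<theta> * u)) i = 0"
      "coeff_vec (\<lambda>u. \<phi> u - \<phi> (\<theta> * u)) k \<noteq> 0"
      "leading_term (\<lambda>u. \<phi> u - \<phi> (\<theta> * u)) k (coeff_vec (\<lambda>u. \<phi> u - \<phi> (\<theta> * u)) k)"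
      using leading_term_or_zero[of "\<lambda>u. \<phi> u - \<phi> (\<theta> * u)", OF an'] by blast
    have "(INF j. ord0 (\<lambda>u. (\<phi> u - \<phi> (\<theta> * u)) $ j)) = enat k"
      using k(1,2) by (intro INF_ord0_eq_enat) auto
    moreover have "\<theta> ^ k \<noteq> 1" using k(2) coeff_vec_twist[OF an, of \<theta> k] by auto
    moreover have "k \<noteq> m" using calculation(2) \<theta>(1) by auto
    ultimately show ?thesis unfolding arc using k(3) by (auto simp: coeff_vec_twist[OF an])
  qed
  define P where "P = (\<lambda>k. plane t (coeff_vec \<phi> k)) ` {k. enat k \<in> M}"
  have finM: "finite M" using finC by (simp add: M_def)
  have "inj enat" by (simp add: inj_def)
  then have fin: "finite {k. enat k \<in> M}" using finite_vimageI[OF finM] by (simp add: vimage_def)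
  have "card P \<le> card {k. enat k \<in> M}" unfolding P_def using fin by (rule card_image_le)
  also have "\<dots> = card (enat ` {k. enat k \<in> M})"
    using \<open>inj enat\<close> by (simp add: card_image inj_on_subset)
  also have "\<dots> \<le> card M" using finM by (intro card_mono) auto
  also have "\<dots> = card (ChAM A \<phi>) - 1"
  proof -
    \<comment> \<open>By \<open>coeff_vec_twist\<close>, an \<open>m\<close>-th root of unity kills
      the coefficient of index \<open>m\<close>, so the order of the arc cannot be
      \<open>m\<close>.\<close>
    have "enat m \<notin> M"
    proof
      assume "enat m \<in> M"
      then obtain \<theta> where "\<theta> \<in> C" "enat m = (INF j. ord0 (\<lambda>u. \<phi> u $ j - \<phi> (\<theta> * u) $ j))"
        unfolding M_def by blast
      then show False using key[of \<theta>] by auto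
    qed
    then show ?thesis using finM by (simp add: ChAM)
  qed
  finally have card: "card P \<le> card (ChAM A \<phi>) - 1" .
  have planes: "complex_plane L \<and> L \<subseteq> C5 X" if L: "L \<in> P" for L
  proof -
    obtain k \<theta> where "\<theta> \<in> C" "enat k = (INF j. ord0 (\<lambda>u. \<phi> u $ j - \<phi> (\<theta> * u) $ j))"
      and Lk: "L = plane t (coeff_vec \<phi> k)"
      using L by (auto simp: P_def M_def)
    then have \<theta>: "\<theta> ^ m = 1" and k: "\<theta> ^ k \<noteq> 1"
      "leading_term (secant_arc \<phi> \<phi> 1 1 \<theta>) k ((1 - \<theta> ^ k) *s coeff_vec \<phi> k)"
      using key[of \<theta>] by (auto simp: C_def)
    note pl = plane_subset_C5[OF an z m m zero_less_one refl pa pa branch_param_leading_term[OF bp]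
        branch_param_eventually_in[OF bp AX] branch_param_eventually_in[OF bp AX] \<theta> k(2)]
    have eq: "L = plane t ((1 - \<theta> ^ k) *s coeff_vec \<phi> k)" unfolding Lk
      by (rule plane_scale[symmetric]) (use k(1) in simp)
    have "(1 - \<theta> ^ k) *s coeff_vec \<phi> k \<noteq> 0" using k(2) unfolding leading_term_def by blast
    then show ?thesis unfolding eq t_def using pl(1) complex_plane_axis[OF pl(2,3)] by blast
  qed
  have in_P: "plane t ((1 - \<theta> ^ k) *s coeff_vec \<phi> k) \<in> P"
    if "\<theta> \<in> C" "(INF j. ord0 (\<lambda>u. \<phi> u $ j - \<phi> (\<theta> * u) $ j)) = enat k" "\<theta> ^ k \<noteq> 1" for \<theta> k
  proof -
    have "enat k \<in> M" unfolding M_def that(2)[symmetric] using that(1) by (rule imageI)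
    moreover have "plane t ((1 - \<theta> ^ k) *s coeff_vec \<phi> k) = plane t (coeff_vec \<phi> k)"
      by (rule plane_scale) (use that(3) in simp)
    ultimately show ?thesis unfolding P_def by blast
  qed
  \<comment> \<open>As \<open>m \<ge> 2\<close>, there is a nontrivial \<open>m\<close>-th root of
    unity and \<open>P\<close> is nonempty. Each of its planes contains the tangent line, which
    settles the limits arising from \<open>\<theta> = 1\<close>.\<close>
  have "\<exists>\<theta>. \<theta> \<in> C"
  proof (rule ccontr)
    assume "\<not> ?thesis"
    then have "{\<theta>::complex. \<theta> ^ m = 1} \<subseteq> {1}" by (auto simp: C_def)
    then have "card {\<theta>::complex. \<theta> ^ m = 1} \<le> card {1::complex}" by (intro card_mono) auto
    then show False using card_roots_unity_eq[OF m] m2 by simp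
  qed
  then obtain \<theta>0 k0 where "plane t ((1 - \<theta>0 ^ k0) *s coeff_vec \<phi> k0) \<in> P" using key in_P by blast
  then have tangent: "tangent_cone A \<subseteq> \<Union>P"
    unfolding tangent_cone_branch_param[OF bp] using tangent_in_plane by (fastforce simp: t_def)
  have "v \<in> \<Union>P" if sl: "secant_limit A A v" for v
  proof -
    have "v \<in> tangent_cone A \<or> (\<exists>\<theta>\<in>C.
      \<forall>k w. leading_term (secant_arc \<phi> \<phi> 1 1 \<theta>) k w \<longrightarrow> v \<in> plane t w)"
      using secant_limit_branch_cases[OF bp pa _ sl] prim unfolding C_def t_def by blast
    then show ?thesis using tangent key in_P by blast
  qed
  with fin card planes tangent show ?thesis by (intro exI[of _ P]) (auto simp: P_def)
qed

lemma puiseux_branch_param: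
  assumes px: "puiseux_param \<phi> Z"
  shows "branch_param \<phi> Z (multiplicity_germ Z)"
    and "\<exists>a. \<forall>\<^sub>F u in nhds 0. \<phi> u $ a = u ^ multiplicity_germ Z"
    and "\<theta> \<noteq> 1 \<Longrightarrow> \<not> (\<forall>\<^sub>F u in nhds 0. \<phi> u = \<phi> (\<theta> * u))"
proof -
  define m where "m = multiplicity_germ Z"
  have prim: "primitive_param \<phi> Z" and fp: "finite_param \<phi> Z"
    using px by (auto simp: puiseux_param_def primitive_param_def)
  obtain a where a: "\<forall>\<^sub>F u in nhds 0. \<phi> u $ a = u ^ m" using px by (auto simp: puiseux_param_def m_def)
  then show "\<exists>a. \<forall>\<^sub>F u in nhds 0. \<phi> u $ a = u ^ multiplicity_germ Z" by (auto simp: m_def)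
  have an: "(\<lambda>u. \<phi> u $ j) analytic_on {0}" for j using fp by (simp add: finite_param_def)
  have \<phi>0: "\<phi> 0 = 0" using fp by (simp add: finite_param_def)
  have "\<phi> 0 $ a = 0 ^ m" using eventually_nhds_x_imp_x[OF a] .
  \<comment> \<open>For \<open>m = 0\<close> the coordinate \<open>a\<close> would have the value 1
    at the origin, against \<open>\<phi> 0 = 0\<close>.\<close>
  then have m: "m > 0" using \<phi>0 by (cases m) auto
  have z: "coeff_vec \<phi> i = 0" if "i < m" for i
  proof -
    have "fps_nth (fps_expansion (\<lambda>u. \<phi> u $ j) 0) i = 0" for j
    proof (rule ccontr)
      assume "fps_nth (fps_expansion (\<lambda>u. \<phi> u $ j) 0) i \<noteq> 0"
      then have "ord0 (\<lambda>u. \<phi> u $ j) \<le> enat i" unfolding ord0_def by (intro INF_lower) auto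
      moreover have "enat m \<le> ord0 (\<lambda>u. \<phi> u $ j)" using px by (simp add: puiseux_param_def m_def)
      ultimately have "enat m \<le> enat i" by (rule order_trans[rotated])
      then show False using that by simp
    qed
    then show ?thesis by (simp add: coeff_vec_def vec_eq_iff)
  qed
  have "coeff_vec \<phi> m $ a = 1" using coeff_vec_pure[OF a, of m] by simp
  then have t: "coeff_vec \<phi> m \<noteq> 0" by auto
  have lt: "leading_term \<phi> m (coeff_vec \<phi> m)" by (intro leading_term_coeff_vec an z t)
  have small: "\<exists>e'. 0 < e' \<and> e' < e \<and> germ_eq (\<phi> ` ball 0 e') Z" if "e > 0" for e
  proof -
    obtain b where "b > 0" "\<And>y. y > 0 \<Longrightarrow> y < b \<Longrightarrow> germ_eq (\<phi> ` ball 0 y) Z"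
      using fp by (auto simp: finite_param_def eventually_at_right[OF zero_less_one])
    then show ?thesis using that by (intro exI[of _ "min b e / 2"]) auto
  qed
  show "branch_param \<phi> Z (multiplicity_germ Z)" unfolding branch_param_def m_def[symmetric]
  proof (intro conjI allI impI an m z t)
    obtain e where e: "e > 0" "germ_eq (\<phi> ` ball 0 e) Z" using small[of 1] by auto
    have "(\<phi> \<longlongrightarrow> 0) (nhds 0)"
      using leading_term_tendsto_0[OF lt m, of "\<lambda>x. x" "nhds 0"] by (simp add: filterlim_ident)
    from eventually_compose_filterlim[OF e(2)[unfolded germ_eq_def] this]
    have "\<forall>\<^sub>F u in nhds 0. \<phi> u \<in> \<phi> ` ball 0 e \<longleftrightarrow> \<phi> u \<in> Z" .
    moreover have "\<forall>\<^sub>F u in nhds 0. u \<in> ball (0::complex) e"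
      using e(1) by (intro eventually_nhds_in_open) auto
    ultimately show "\<forall>\<^sub>F u in nhds 0. \<phi> u \<in> Z" by eventually_elim blast
    fix e :: real assume "e > 0"
    then obtain e' where e': "e' < e" "germ_eq (\<phi> ` ball 0 e') Z" using small by blast
    show "\<forall>\<^sub>F z in nhds 0. z \<in> Z \<longrightarrow> z \<in> \<phi> ` ball 0 e"
      using e'(2) unfolding germ_eq_def by eventually_elim (use e'(1) in auto)
  qed
  show "\<not> (\<forall>\<^sub>F u in nhds 0. \<phi> u = \<phi> (\<theta> * u))" if "\<theta> \<noteq> 1"
  proof
    assume "\<forall>\<^sub>F u in nhds 0. \<phi> u = \<phi> (\<theta> * u)"
    \<comment> \<open>The identity and the multiplication by \<open>\<theta>\<close> are two
      factorizations of \<open>\<phi>\<close> through itself; the uniqueness clause of primitivity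
      identifies them.\<close>
    then have "factors_by \<phi> \<phi> (\<lambda>u. \<theta> * u)" "factors_by \<phi> \<phi> (\<lambda>u. u)"
      unfolding factors_by_def by (auto intro!: analytic_intros)
    then obtain \<tau> where "\<forall>\<^sub>F u in nhds 0. \<theta> * u = \<tau> u" "\<forall>\<^sub>F u in nhds 0. u = \<tau> u"
      using prim fp unfolding primitive_param_def by meson
    then have "\<forall>\<^sub>F u in nhds 0. \<theta> * u = u" by eventually_elim simp
    then have "\<forall>\<^sub>F u in at 0. \<theta> * u = u" by (simp add: eventually_nhds_conv_at)
    then have "\<forall>\<^sub>F u in at (0::complex). False"
      using eventually_neq_at_within[of 0 0 UNIV] by eventually_elim (use that in simp)
    then show False by simp
  qed
qed

section \<open>Smooth branches and multiplicity\<close>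

text \<open>The inverse chart restricted to the straightened axis is the parametrization.\<close>

lemma smooth_curve_branch_param:
  fixes Z :: "(complex ^ 'n) set"
  assumes "smooth_curve_at Z 0"
  shows "\<exists>\<phi>. branch_param \<phi> Z 1"
proof -
  obtain V W and \<Phi> \<Psi> :: "complex ^ 'n \<Rightarrow> complex ^ 'n" and j where
    VW: "open V" "open W" "0 \<in> V" "\<Phi> 0 = 0" and h\<Phi>: "\<And>k. cholomorphic_on (\<lambda>z. \<Phi> z $ k) V"
    and h\<Psi>: "\<And>k. cholomorphic_on (\<lambda>w. \<Psi> w $ k) W" and im: "\<Phi> ` V = W"
    and inv: "\<And>z. z \<in> V \<Longrightarrow> \<Psi> (\<Phi> z) = z"
    and Z: "\<Phi> ` (Z \<inter> V) = {w \<in> W. \<forall>k. k \<noteq> j \<longrightarrow> w $ k = 0}"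
    using assms unfolding smooth_curve_at_def by blast
  define e where "e = (axis j 1 :: complex ^ 'n)"
  define \<phi> where "\<phi> = (\<lambda>u. \<Psi> (0 + u *s e))"
  have "0 \<in> W" using im VW(3,4) by force
  have ej: "(u *s e) $ k = (if k = j then u else 0)" for u k by (simp add: e_def axis_def)
  have "((\<lambda>u. 0 + u *s e) \<longlongrightarrow> 0 + 0 *s e) (nhds 0)"
    by (intro tendsto_intros) (simp add: filterlim_ident)
  then have lim: "((\<lambda>u. 0 + u *s e) \<longlongrightarrow> 0) (nhds 0)" by simp
  have evW: "\<forall>\<^sub>F u in nhds 0. 0 + u *s e \<in> W"
    using eventually_compose_filterlim[OF eventually_nhds_in_open[OF VW(2) \<open>0 \<in> W\<close>] lim] .
  then obtain r where r: "r > 0" "\<And>u. norm u < r \<Longrightarrow> 0 + u *s e \<in> W"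
    by (auto simp: eventually_nhds_metric)
  have hol: "(\<lambda>u. \<phi> u $ k) holomorphic_on ball 0 r" for k
    unfolding \<phi>_def using r(2) by (intro cholomorphic_on_line[OF h\<Psi>]) auto
  have an: "(\<lambda>u. \<phi> u $ k) analytic_on {0}" for k
    unfolding analytic_on_def using hol r(1) by blast
  have \<phi>0: "\<phi> 0 = 0" using inv[OF VW(3)] VW(4) by (simp add: \<phi>_def)
  have mem: "\<phi> u \<in> Z \<and> \<phi> u \<in> V \<and> \<Phi> (\<phi> u) = u *s e" if "0 + u *s e \<in> W" for u
  proof -
    have "u *s e \<in> {w \<in> W. \<forall>k. k \<noteq> j \<longrightarrow> w $ k = 0}" using that ej by auto
    then obtain z where z: "z \<in> Z" "z \<in> V" "u *s e = \<Phi> z" unfolding Z[symmetric] by blast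
    have "\<phi> u = z" unfolding \<phi>_def add_0 z(3) using z(2) by (rule inv)
    with z show ?thesis by simp
  qed
  have d\<phi>: "((\<lambda>u. \<phi> u $ k) has_field_derivative coeff_vec \<phi> 1 $ k) (at 0)" for k
    using holomorphic_derivI[OF hol open_ball] r(1) by (simp add: coeff_vec_def fps_expansion_def)
  \<comment> \<open>Component \<open>j\<close> of the chart composed with \<open>\<phi>\<close> is
    the identity near 0, so by the chain rule the derivative of \<open>\<phi>\<close> cannot
    vanish.\<close>
  have "coeff_vec \<phi> 1 \<noteq> 0"
  proof
    assume t0: "coeff_vec \<phi> 1 = 0"
    obtain D where D: "((\<lambda>z. \<Phi> z $ j) has_derivative D) (at 0)" "\<And>c x. D (c *s x) = c * D x"
      using h\<Phi>[of j] VW(3) unfolding cholomorphic_on_def by blast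
    have "((\<lambda>u. \<phi> u $ k) has_derivative (\<lambda>h. 0)) (at 0)" for k
    proof -
      have "(*) (0 :: complex) = (\<lambda>h. 0)" by auto
      then show ?thesis using d\<phi>[of k] unfolding t0 has_field_derivative_def by simp
    qed
    then have "((\<lambda>u. (\<phi> u - \<phi> 0 - 0) /\<^sub>R norm (u - 0)) \<longlongrightarrow> 0) (at 0)"
      by (intro vec_tendstoI) (simp add: has_derivative_at_within)
    then have "(\<phi> has_derivative (\<lambda>h. 0)) (at 0)"
      by (intro has_derivativeI bounded_linear_zero)
    then have d1: "((\<lambda>u. \<Phi> (\<phi> u) $ j) has_derivative (\<lambda>h. D 0)) (at 0)"
      using has_derivative_compose[of \<phi> "\<lambda>h. 0" 0 UNIV "\<lambda>z. \<Phi> z $ j" D] D(1) by (simp add: \<phi>0)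
    have D0: "D 0 = 0" using D(2)[of 0 0] by simp
    have d2: "((\<lambda>u. \<Phi> (\<phi> u) $ j) has_derivative (\<lambda>h. h)) (at 0)"
    proof (rule has_derivative_transform_eventually[OF has_derivative_ident])
      show "\<forall>\<^sub>F u in at 0. u = \<Phi> (\<phi> u) $ j"
      proof -
        have "\<forall>\<^sub>F u in at 0. 0 + u *s e \<in> W" using evW by (simp only: eventually_nhds_conv_at)
        then show ?thesis
        proof eventually_elim
          case (elim u)
          have "\<Phi> (\<phi> u) $ j = (u *s e) $ j" using mem[OF elim] by simp
          then show ?case unfolding ej by simp
        qed
      qed
    qed (simp_all add: \<phi>0 VW(4))
    have "(\<lambda>h. D 0) = (\<lambda>h. h)" using d1 d2 by (rule has_derivative_unique)
    then have "D 0 = 1" by (rule fun_cong)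
    with D0 show False by simp
  qed
  moreover have "coeff_vec \<phi> 0 = 0" by (simp add: coeff_vec_def fps_expansion_def vec_eq_iff \<phi>0)
  moreover have "\<forall>\<^sub>F u in nhds 0. \<phi> u \<in> Z" using evW by eventually_elim (simp add: mem)
  moreover have "\<forall>\<^sub>F z in nhds 0. z \<in> Z \<longrightarrow> z \<in> \<phi> ` ball 0 \<epsilon>" if "\<epsilon> > 0" for \<epsilon>
  proof -
    have "isCont (\<lambda>z. \<Phi> z $ j) 0" using h\<Phi> VW(3) by (rule cholomorphic_on_isCont)
    then have "((\<lambda>z. \<Phi> z $ j) \<longlongrightarrow> 0) (nhds 0)" by (simp add: tendsto_nhds_iff isCont_def VW(4))
    then have "\<forall>\<^sub>F z in nhds 0. norm (\<Phi> z $ j) < \<epsilon>" using that by (simp add: tendsto_iff)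
    moreover have "\<forall>\<^sub>F z in nhds 0. z \<in> V" using VW by (intro eventually_nhds_in_open)
    ultimately show ?thesis
    proof eventually_elim
      case (elim z)
      show ?case
      proof
        assume "z \<in> Z"
        then have "\<Phi> z \<in> {w \<in> W. \<forall>k. k \<noteq> j \<longrightarrow> w $ k = 0}" using Z elim by blast
        then have eq: "(\<Phi> z $ j) *s e = \<Phi> z" by (simp add: vec_eq_iff e_def axis_def)
        have "\<phi> (\<Phi> z $ j) = z" unfolding \<phi>_def add_0 eq using elim by (intro inv) auto
        then show "z \<in> \<phi> ` ball 0 \<epsilon>" using elim by (metis image_eqI mem_ball_0)
      qed
    qed
  qed
  ultimately have "branch_param \<phi> Z 1" unfolding branch_param_def using an by auto
  then show ?thesis by blast
qed

text \<open>With coordinate \<open>a\<close> as parameter, \<open>Z\<close> is near the origin the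
  graph of \<open>\<phi>\<close> over the \<open>a\<close>-axis. The shear subtracting the remaining
  coordinates of \<open>\<phi>\<close> straightens it, and the opposite shear is its
  inverse.\<close>

lemma branch_param_1_smooth:
  fixes Z :: "(complex ^ 'n) set"
  assumes "branch_param \<phi>0 Z 1"
  shows "smooth_curve_at Z 0"
proof -
  have "coeff_vec \<phi>0 1 \<noteq> 0" using assms by (simp add: branch_param_def)
  then obtain a where "coeff_vec \<phi>0 1 $ a \<noteq> 0" by (rule vec_nonzero_component)
  then obtain \<phi> where bp: "branch_param \<phi> Z 1" and pa: "\<forall>\<^sub>F u in nhds 0. \<phi> u $ a = u ^ 1"
    using branch_param_pure_coordinate[OF assms] by blast
  have an: "(\<lambda>u. \<phi> u $ j) analytic_on {0}" for j using bp by (simp add: branch_param_def)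
  have "\<exists>r>0. (\<lambda>u. \<phi> u $ j) holomorphic_on ball 0 r" for j
    using an[of j] by (auto simp: analytic_on_def)
  then obtain \<rho> where \<rho>: "\<And>j. \<rho> j > 0" "\<And>j. (\<lambda>u. \<phi> u $ j) holomorphic_on ball 0 (\<rho> j)" by metis
  define \<rho>0 where "\<rho>0 = Min (range \<rho>)"
  have \<rho>0: "\<rho>0 > 0" "\<rho>0 \<le> \<rho> j" for j
    using \<rho>(1) by (auto simp: \<rho>0_def)
  have "\<forall>\<^sub>F u in nhds (0::complex). norm u < \<rho>0"
    using \<rho>0(1) by (auto simp: eventually_nhds_metric)
  moreover have "\<forall>\<^sub>F u in nhds 0. \<phi> u \<in> Z" using bp by (simp add: branch_param_def)
  ultimately have "\<forall>\<^sub>F u in nhds 0. \<phi> u $ a = u \<and> \<phi> u \<in> Z \<and> norm u < \<rho>0"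
    using pa by eventually_elim simp
  then obtain R where "R > 0" "\<forall>u. dist u 0 < R \<longrightarrow> \<phi> u $ a = u \<and> \<phi> u \<in> Z \<and> norm u < \<rho>0"
    unfolding eventually_nhds_metric by blast
  then have R: "R > 0" "\<And>u. norm u < R \<Longrightarrow> \<phi> u $ a = u \<and> \<phi> u \<in> Z \<and> norm u < \<rho>0"
    by simp_all
  have hol: "(\<lambda>u. \<phi> u $ j) holomorphic_on ball 0 R" for j
  proof (rule holomorphic_on_subset[OF \<rho>(2)])
    have "norm u < \<rho> j" if "norm u < R" for u :: complex
      using R(2)[OF that] \<rho>0(2)[of j] by linarith
    then show "ball (0::complex) R \<subseteq> ball 0 (\<rho> j)" by (simp add: subset_iff)
  qed
  have "\<forall>\<^sub>F z in nhds 0. z \<in> Z \<longrightarrow> z \<in> \<phi> ` ball 0 R" using bp R(1) by (simp add: branch_param_def)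
  then obtain N where N: "open N" "0 \<in> N" "\<And>z. z \<in> N \<Longrightarrow> z \<in> Z \<Longrightarrow> z \<in> \<phi> ` ball 0 R"
    by (auto simp: eventually_nhds)
  define C where "C = {z :: complex ^ 'n. norm (z $ a) < R}"
  have "open C" unfolding C_def by (intro open_Collect_less continuous_intros)
  have chol: "cholomorphic_on (\<lambda>z. \<phi> (z $ a) $ k) C" for k
    unfolding cholomorphic_on_def
  proof
    fix z assume "z \<in> C"
    then have "((\<lambda>u. \<phi> u $ k) has_field_derivative deriv (\<lambda>u. \<phi> u $ k) (z $ a)) (at (z $ a))"
      using hol[of k] by (intro holomorphic_derivI[of _ "ball 0 R"]) (auto simp: C_def)
    then have "((\<lambda>u. \<phi> u $ k) has_derivative (\<lambda>h. deriv (\<lambda>u. \<phi> u $ k) (z $ a) * h)) (at (z $ a))"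
      by (simp add: has_field_derivative_def)
    moreover have "((\<lambda>z. z $ a) has_derivative (\<lambda>z. z $ a)) (at z)"
      by (intro bounded_linear_imp_has_derivative bounded_linear_vec_nth)
    ultimately have "((\<lambda>z. \<phi> (z $ a) $ k) has_derivative
        (\<lambda>h. deriv (\<lambda>u. \<phi> u $ k) (z $ a) * h $ a)) (at z)"
      using has_derivative_compose[of "\<lambda>z. z $ a" "\<lambda>z. z $ a" z UNIV "\<lambda>u. \<phi> u $ k"] by simp
    then show "\<exists>f'. ((\<lambda>z. \<phi> (z $ a) $ k) has_derivative f') (at z) \<and> (\<forall>c x. f' (c *s x) = c * f' x)"
      by (intro exI[of _ "\<lambda>h. deriv (\<lambda>u. \<phi> u $ k) (z $ a) * h $ a"]) simp
  qed
  define \<Phi> where "\<Phi> = (\<lambda>z :: complex ^ 'n. \<chi> k. if k = a then z $ a else z $ k - \<phi> (z $ a) $ k)"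
  define \<Psi> where "\<Psi> = (\<lambda>w :: complex ^ 'n. \<chi> k. if k = a then w $ a else w $ k - - 1 * \<phi> (w $ a) $ k)"
  have hol\<Phi>: "cholomorphic_on (\<lambda>z. \<Phi> z $ k) C" for k
  proof (cases "k = a")
    case False
    then show ?thesis
      by (simp add: \<Phi>_def cholomorphic_on_diff[OF cholomorphic_on_component chol])
  qed (simp add: \<Phi>_def cholomorphic_on_component)
  have hol\<Psi>: "cholomorphic_on (\<lambda>z. \<Psi> z $ k) C" for k
  proof (cases "k = a")
    case False
    then show ?thesis
      using cholomorphic_on_diff[OF cholomorphic_on_component cholomorphic_on_cmult[OF chol, where c = "-1"]]
      by (simp add: \<Psi>_def)
  qed (simp add: \<Psi>_def cholomorphic_on_component)
  have \<Psi>\<Phi>: "\<Psi> (\<Phi> z) = z" and \<Phi>\<Psi>: "\<Phi> (\<Psi> z) = z" for z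
    by (simp_all add: \<Phi>_def \<Psi>_def vec_eq_iff)
  have a\<Phi>: "\<Phi> z $ a = z $ a" and a\<Psi>: "\<Psi> z $ a = z $ a" for z by (simp_all add: \<Phi>_def \<Psi>_def)
  define V where "V = N \<inter> C"
  \<comment> \<open>Both shears preserve coordinate \<open>a\<close> and hence \<open>C\<close>, so
    this preimage of \<open>N\<close> is exactly the image of \<open>V\<close>.\<close>
  define W where "W = {w \<in> C. \<Psi> w \<in> N}"
  have \<phi>0: "\<phi> 0 = 0" and Z0: "0 \<in> Z" using branch_param_at_0[OF bp] by auto
  have "isCont \<Psi> w" if "w \<in> C" for w
  proof -
    have "((\<lambda>z. \<Psi> z $ k) \<longlongrightarrow> \<Psi> w $ k) (at w)" for k
      using cholomorphic_on_isCont[OF hol\<Psi> that] by (simp add: isCont_def)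
    then show ?thesis unfolding isCont_def by (rule vec_tendstoI)
  qed
  then have "continuous_on C \<Psi>" by (simp add: continuous_at_imp_continuous_on)
  then have "open W" using continuous_open_preimage[OF _ \<open>open C\<close> N(1)]
    by (simp add: W_def vimage_def Int_def)
  have "\<Phi> ` V = W"
  proof (intro equalityI subsetI)
    fix w assume "w \<in> W"
    then have "\<Psi> w \<in> V" by (simp add: W_def V_def C_def a\<Psi>)
    then show "w \<in> \<Phi> ` V" using \<Phi>\<Psi>[of w] by (metis image_eqI)
  qed (auto simp: V_def W_def C_def a\<Phi> \<Psi>\<Phi>)
  have axis: "\<Phi> ` (Z \<inter> V) = {w \<in> W. \<forall>k. k \<noteq> a \<longrightarrow> w $ k = 0}"
  proof (intro equalityI subsetI)
    fix w assume "w \<in> \<Phi> ` (Z \<inter> V)"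
    then obtain z where z: "z \<in> Z" "z \<in> V" "w = \<Phi> z" by blast
    then obtain u where u: "norm u < R" "z = \<phi> u" using N(3)[of z] by (auto simp: V_def)
    then have "w $ k = 0" if "k \<noteq> a" for k using R(2)[of u] that by (simp add: z(3) \<Phi>_def)
    moreover have "w \<in> W" using z \<open>\<Phi> ` V = W\<close> by blast
    ultimately show "w \<in> {w \<in> W. \<forall>k. k \<noteq> a \<longrightarrow> w $ k = 0}" by blast
  next
    fix w assume w: "w \<in> {w \<in> W. \<forall>k. k \<noteq> a \<longrightarrow> w $ k = 0}"
    then have n: "norm (w $ a) < R" by (simp add: W_def C_def)
    have "\<Psi> w = \<phi> (w $ a)" using w R(2)[OF n] by (simp add: \<Psi>_def vec_eq_iff)
    then have "\<Psi> w \<in> Z \<inter> V" using w R(2)[OF n] by (simp add: V_def W_def C_def)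
    then show "w \<in> \<Phi> ` (Z \<inter> V)" using \<Phi>\<Psi>[of w] by (metis image_eqI)
  qed
  have "cholomorphic_on (\<lambda>z. \<Phi> z $ k) V" "cholomorphic_on (\<lambda>z. \<Psi> z $ k) W" for k
    using cholomorphic_on_subset[OF hol\<Phi>] cholomorphic_on_subset[OF hol\<Psi>] by (auto simp: V_def W_def)
  moreover have "\<Phi> 0 = 0" by (simp add: \<Phi>_def vec_eq_iff \<phi>0)
  moreover have "0 \<in> V" using N R(1) by (simp add: V_def C_def)
  moreover have "open V" using N(1) \<open>open C\<close> by (simp add: V_def open_Int)
  ultimately show ?thesis unfolding smooth_curve_at_def
    using \<open>open W\<close> Z0 \<open>\<Phi> ` V = W\<close> \<Psi>\<Phi> axis
    by (intro exI[of _ V] exI[of _ W] exI[of _ \<Phi>] exI[of _ \<Psi>] exI[of _ a]) simp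
qed

text \<open>The least sheet number exists because the coordinate that serves as parameter has one
  point in each fibre. Positivity is what later makes the exponent 1 of a smooth branch compatible
  with the gcd of the multiplicities.\<close>

lemma multiplicity_germ_pos:
  fixes Z :: "(complex ^ 'n) set"
  assumes bp0: "branch_param \<phi>0 Z 1"
  shows "multiplicity_germ Z > 0"
proof -
  define Q where "Q = (\<lambda>m::nat. \<exists>a :: complex ^ 'n.
        (\<forall>\<^sub>F z in at 0. z \<in> Z \<longrightarrow> (\<Sum>k\<in>UNIV. a $ k * z $ k) \<noteq> 0) \<and>
        (\<forall>\<^sub>F \<epsilon> in at_right 0. \<forall>\<^sub>F t in at 0.
           finite {z \<in> Z. norm z < \<epsilon> \<and> (\<Sum>k\<in>UNIV. a $ k * z $ k) = t} \<and>
           card {z \<in> Z. norm z < \<epsilon> \<and> (\<Sum>k\<in>UNIV. a $ k * z $ k) = t} = m))"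
  have "coeff_vec \<phi>0 1 \<noteq> 0" using bp0 by (simp add: branch_param_def)
  then obtain j where "coeff_vec \<phi>0 1 $ j \<noteq> 0" by (rule vec_nonzero_component)
  then obtain \<phi> where bp: "branch_param \<phi> Z 1" and pa: "\<forall>\<^sub>F u in nhds 0. \<phi> u $ j = u ^ 1"
    using branch_param_pure_coordinate[OF bp0] by blast
  have \<phi>0: "\<phi> 0 = 0" using branch_param_at_0[OF bp] by auto
  have evZ: "\<forall>\<^sub>F u in nhds 0. \<phi> u \<in> Z" using bp by (simp add: branch_param_def)
  have lim0: "(\<phi> \<longlongrightarrow> 0) (nhds 0)"
    using leading_term_tendsto_0[OF branch_param_leading_term[OF bp], of "\<lambda>x. x" "nhds 0"]
    by (simp add: filterlim_ident)
  have "\<forall>\<^sub>F u in nhds 0. \<phi> u $ j = u \<and> \<phi> u \<in> Z" using pa evZ by eventually_elim simp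
  then obtain R where R: "R > 0" "\<And>u. norm u < R \<Longrightarrow> \<phi> u $ j = u \<and> \<phi> u \<in> Z"
    by (auto simp: eventually_nhds_metric)
  have "\<forall>\<^sub>F z in nhds 0. z \<in> Z \<longrightarrow> z \<in> \<phi> ` ball 0 R" using bp R(1) by (simp add: branch_param_def)
  then obtain d where d: "d > 0" "\<And>z. norm z < d \<Longrightarrow> z \<in> Z \<Longrightarrow> z \<in> \<phi> ` ball 0 R"
    by (auto simp: eventually_nhds_metric)
  have form: "(\<Sum>k\<in>UNIV. (axis j 1 :: complex ^ 'n) $ k * z $ k) = z $ j" for z
    by (simp add: axis_def if_distrib[of "\<lambda>x. x * _"] cong: if_cong)
  have graph: "z = \<phi> (z $ j)" if "norm z < d" "z \<in> Z" for z
    using d(2)[OF that] R(2) by auto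
  have "Q 1" unfolding Q_def
  proof (intro exI[of _ "axis j 1"] conjI; unfold form)
    have "\<forall>\<^sub>F z in at 0. norm z < d \<and> z \<noteq> (0 :: complex ^ 'n)"
      using d(1) by (auto simp: eventually_at)
    then show "\<forall>\<^sub>F z in at 0. z \<in> Z \<longrightarrow> z $ j \<noteq> 0"
      by eventually_elim (metis graph \<phi>0)
    have "\<forall>\<^sub>F \<epsilon> in at_right 0. 0 < \<epsilon> \<and> \<epsilon> < d"
      using d(1) by (auto simp: eventually_at_right[OF zero_less_one])
    then show "\<forall>\<^sub>F \<epsilon> in at_right 0. \<forall>\<^sub>F t in at 0.
        finite {z \<in> Z. norm z < \<epsilon> \<and> z $ j = t} \<and> card {z \<in> Z. norm z < \<epsilon> \<and> z $ j = t} = 1"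
    proof eventually_elim
      case (elim \<epsilon>)
      then have "\<forall>\<^sub>F t in nhds 0. norm (\<phi> t) < \<epsilon>" using lim0 by (simp add: tendsto_iff)
      then have "\<forall>\<^sub>F t in at 0. norm (\<phi> t) < \<epsilon>" by (simp add: eventually_nhds_conv_at)
      moreover have "\<forall>\<^sub>F t in at (0::complex). norm t < R" using R(1) by (auto simp: eventually_at)
      ultimately show ?case
      proof eventually_elim
        case (elim t)
        have "{z \<in> Z. norm z < \<epsilon> \<and> z $ j = t} = {\<phi> t}"
        proof (intro equalityI subsetI)
          fix z assume "z \<in> {z \<in> Z. norm z < \<epsilon> \<and> z $ j = t}"
          then show "z \<in> {\<phi> t}" using graph[of z] \<open>0 < \<epsilon> \<and> \<epsilon> < d\<close> by auto
        qed (use R(2)[of t] elim in auto)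
        then show ?case by simp
      qed
    qed
  qed
  \<comment> \<open>With no sheets, the fibres over small nonzero values would be empty. But the
    fibre over \<open>f (\<phi> u)\<close> contains \<open>\<phi> u\<close>, and the isolatedness
    condition makes this value nonzero.\<close>
  moreover have "\<not> Q 0"
  proof
    assume "Q 0"
    then obtain a :: "complex ^ 'n" where
      nz: "\<forall>\<^sub>F z in at 0. z \<in> Z \<longrightarrow> (\<Sum>k\<in>UNIV. a $ k * z $ k) \<noteq> 0" and
      fib: "\<forall>\<^sub>F \<epsilon> in at_right 0. \<forall>\<^sub>F t in at 0.
           finite {z \<in> Z. norm z < \<epsilon> \<and> (\<Sum>k\<in>UNIV. a $ k * z $ k) = t} \<and>
           card {z \<in> Z. norm z < \<epsilon> \<and> (\<Sum>k\<in>UNIV. a $ k * z $ k) = t} = 0"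
      unfolding Q_def by blast
    define f where "f = (\<lambda>z :: complex ^ 'n. \<Sum>k\<in>UNIV. a $ k * z $ k)"
    have "\<forall>\<^sub>F \<epsilon> in at_right (0::real). 0 < \<epsilon>" by (simp add: eventually_at_right_less)
    with fib have "\<forall>\<^sub>F \<epsilon> in at_right (0::real). \<exists>\<epsilon>>0. \<forall>\<^sub>F t in at 0. {z \<in> Z. norm z < \<epsilon> \<and> f z = t} = {}"
    proof eventually_elim
      case (elim \<epsilon>)
      have "\<forall>\<^sub>F t in at 0. {z \<in> Z. norm z < \<epsilon> \<and> f z = t} = {}"
        using elim(1) unfolding f_def
        by (rule eventually_mono) (use card_0_eq in blast)
      with elim(2) show ?case by blast
    qed
    then obtain \<epsilon> where \<epsilon>: "\<epsilon> > 0" "\<forall>\<^sub>F t in at 0. {z \<in> Z. norm z < \<epsilon> \<and> f z = t} = {}"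
      using eventually_happens'[OF trivial_limit_at_right_real] by blast
    have "filterlim \<phi> (at 0) (at 0)"
      unfolding filterlim_at
    proof (intro conjI)
      show "(\<phi> \<longlongrightarrow> 0) (at 0)" using lim0 by (simp add: tendsto_nhds_iff)
    qed (use leading_term_nonzero[OF branch_param_leading_term[OF bp]] in simp)
    from eventually_compose_filterlim[OF nz this] have "\<forall>\<^sub>F u in at 0. \<phi> u \<in> Z \<longrightarrow> f (\<phi> u) \<noteq> 0"
      by (simp add: f_def)
    moreover have evZ': "\<forall>\<^sub>F u in at 0. \<phi> u \<in> Z" using evZ by (simp add: eventually_nhds_conv_at)
    ultimately have fne: "\<forall>\<^sub>F u in at 0. f (\<phi> u) \<noteq> 0" by eventually_elim simp
    have lim: "(\<phi> \<longlongrightarrow> 0) (at 0)" using lim0 by (simp add: tendsto_nhds_iff)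
    have "((\<lambda>u. f (\<phi> u)) \<longlongrightarrow> (\<Sum>k\<in>UNIV. a $ k * (0 :: complex ^ 'n) $ k)) (at 0)"
      unfolding f_def by (intro tendsto_intros tendsto_vec_nth lim)
    then have "filterlim (\<lambda>u. f (\<phi> u)) (at 0) (at 0)" using fne by (simp add: filterlim_at)
    from eventually_compose_filterlim[OF \<epsilon>(2) this]
    have "\<forall>\<^sub>F u in at 0. {z \<in> Z. norm z < \<epsilon> \<and> f z = f (\<phi> u)} = {}" .
    moreover have "\<forall>\<^sub>F u in at 0. norm (\<phi> u) < \<epsilon>" using lim \<epsilon>(1) by (simp add: tendsto_iff)
    ultimately have "\<forall>\<^sub>F u in at (0::complex). False" using evZ' by eventually_elim blast
    then show False by simp
  qed
  moreover have "Q (LEAST m. Q m)" using \<open>Q 1\<close> by (rule LeastI)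
  ultimately have "(LEAST m. Q m) > 0" by (metis gr0I)
  then show ?thesis by (simp add: multiplicity_germ_def Q_def)
qed

section \<open>The bound\<close>

lemma branch_param_germ_eq:
  assumes "branch_param \<phi> A m" and eq: "germ_eq A Z"
  shows "branch_param \<phi> Z m"
proof -
  have AZ: "\<forall>\<^sub>F z in nhds 0. z \<in> A \<longleftrightarrow> z \<in> Z" using eq by (simp add: germ_eq_def)
  have "\<forall>\<^sub>F u in nhds 0. \<phi> u \<in> Z"
    using assms(1) by (rule branch_param_eventually_in) (use AZ in eventually_elim, simp)
  moreover have "\<forall>\<^sub>F z in nhds 0. z \<in> Z \<longrightarrow> z \<in> \<phi> ` ball 0 e" if "e > 0" for e
  proof -
    have "\<forall>\<^sub>F z in nhds 0. z \<in> A \<longrightarrow> z \<in> \<phi> ` ball 0 e" using assms(1) that by (simp add: branch_param_def)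
    with AZ show ?thesis by eventually_elim simp
  qed
  ultimately show ?thesis using assms(1) by (simp add: branch_param_def)
qed

section \<open>Reducing \<open>C5\<close> to secants between branches\<close>

lemma secant_limit_sym:
  assumes "secant_limit A B v"
  shows "secant_limit B A v"
proof -
  obtain F :: "nat filter" and w w' c where F: "F \<noteq> bot" "(w \<longlongrightarrow> 0) F" "(w' \<longlongrightarrow> 0) F"
    "\<forall>\<^sub>F i in F. w i \<in> A \<and> w' i \<in> B" "((\<lambda>i. c i *s (w i - w' i)) \<longlongrightarrow> v) F"
    using assms by (auto simp: secant_limit_def)
  have "(- c i) *s (w' i - w i) = c i *s (w i - w' i)" for i by (simp add: vec_eq_iff algebra_simps)
  then have "((\<lambda>i. (- c i) *s (w' i - w i)) \<longlongrightarrow> v) F" using F(5) by simp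
  moreover have "\<forall>\<^sub>F i in F. w' i \<in> B \<and> w i \<in> A" using F(4) by eventually_elim simp
  ultimately show ?thesis unfolding secant_limit_def
    using F(1-3) by (intro exI[of _ F] exI[of _ w'] exI[of _ w] exI[of _ "\<lambda>i. - c i"]) simp
qed

lemma tangent_secant_limit:
  assumes "v \<in> tangent_cone A" "0 \<in> B"
  shows "secant_limit A B v"
proof -
  obtain w c where w: "\<And>i::nat. w i \<in> A" "w \<longlonglongrightarrow> 0" "(\<lambda>i. c i *s w i) \<longlonglongrightarrow> v"
    using assms(1) by (auto simp: tangent_cone_def)
  then have "(\<lambda>i. c i *s (w i - 0)) \<longlonglongrightarrow> v" "\<forall>\<^sub>F i in sequentially. w i \<in> A \<and> 0 \<in> B"
    using assms(2) by simp_all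
  then show ?thesis unfolding secant_limit_def
    using w(2) tendsto_const[of 0 sequentially] trivial_limit_sequentially by blast
qed

text \<open>There are finitely many pairs of branches, so one pair carries the points along a
  nontrivial restriction of the sequence filter.\<close>

lemma C5_secant_limit:
  assumes X: "germ_eq X (\<Union>i\<in>I. B i)" and I: "finite I" and v: "v \<in> C5 X"
  shows "\<exists>i\<in>I. \<exists>j\<in>I. secant_limit (B i) (B j) v"
proof -
  obtain w w' c where w: "\<And>s::nat. w s \<in> X \<and> w' s \<in> X" "w \<longlonglongrightarrow> 0" "w' \<longlonglongrightarrow> 0"
    "(\<lambda>s. c s *s (w s - w' s)) \<longlonglongrightarrow> v"
    using v by (auto simp: C5_def)
  have ev: "\<forall>\<^sub>F z in nhds 0. z \<in> X \<longleftrightarrow> z \<in> (\<Union>i\<in>I. B i)" using X by (simp add: germ_eq_def)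
  define g where "g = (\<lambda>s. SOME ij. ij \<in> I \<times> I \<and> w s \<in> B (fst ij) \<and> w' s \<in> B (snd ij))"
  have g: "\<forall>\<^sub>F s in sequentially. g s \<in> I \<times> I \<and> w s \<in> B (fst (g s)) \<and> w' s \<in> B (snd (g s))"
    using eventually_compose_filterlim[OF ev w(2)] eventually_compose_filterlim[OF ev w(3)]
  proof eventually_elim
    case (elim s)
    then obtain i j where "i \<in> I" "w s \<in> B i" "j \<in> I" "w' s \<in> B j" using w(1)[of s] by auto
    then have "(i, j) \<in> I \<times> I \<and> w s \<in> B (fst (i, j)) \<and> w' s \<in> B (snd (i, j))" by simp
    then show ?case unfolding g_def by (rule someI)
  qed
  have "\<forall>\<^sub>F s in sequentially. g s \<in> I \<times> I" using g by eventually_elim simp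
  then obtain ij where ij: "ij \<in> I \<times> I" "inf sequentially (principal {s. g s = ij}) \<noteq> bot"
    using filter_pigeonhole[OF trivial_limit_sequentially, of "I \<times> I" g] I by auto
  let ?F = "inf sequentially (principal {s. g s = ij})"
  have "?F \<le> sequentially" by simp
  note F = tendsto_mono[OF this w(2)] tendsto_mono[OF this w(3)] tendsto_mono[OF this w(4)]
  have "\<forall>\<^sub>F s in ?F. w s \<in> B (fst ij) \<and> w' s \<in> B (snd ij)"
    unfolding eventually_inf_principal using g by eventually_elim auto
  then have "secant_limit (B (fst ij)) (B (snd ij)) v"
    unfolding secant_limit_def using ij(2) F by blast
  then show ?thesis using ij(1) by (auto simp: mem_Times_iff)
qed

text \<open>Finiteness is part of the claim because \<open>card\<close> is 0 on infinite sets, where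
  the bound would say nothing.\<close>

lemma irreducible_components_C5_bound:
  fixes X :: "(complex ^ 'n) set" and B :: "nat \<Rightarrow> (complex ^ 'n) set"
  assumes ns: "\<not> smooth_curve_at X 0" and br: "branches X r B"
    and px: "\<And>i. i \<in> S_index r B \<Longrightarrow> puiseux_param (\<phi> i) (B i)"
  shows "finite (irreducible_components (C5 X)) \<and>
    card (irreducible_components (C5 X))
      \<le> (\<Sum>i\<in>S_index r B. card (ChAM (B i) (\<phi> i)) - 1)
        + (\<Sum>(i, j)\<in>T_index r B. gcd (multiplicity_germ (B i)) (multiplicity_germ (B j)))
        + card (NT_index r B)"
proof -
  define S where "S = S_index r B"
  define T where "T = T_index r B"
  define NT where "NT = NT_index r B"
  define m where "m = (\<lambda>i. multiplicity_germ (B i))"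
  have eqX: "germ_eq X (\<Union>i\<in>{1..r}. B i)" using br by (simp add: branches_def)
  have BX: "\<forall>\<^sub>F z in nhds 0. z \<in> B i \<longrightarrow> z \<in> X" if "i \<in> {1..r}" for i
    using eqX unfolding germ_eq_def by eventually_elim (use that in auto)
  have "\<exists>\<psi> k. branch_param \<psi> (B i) k \<and> (k = m i \<or> k = 1) \<and> m i > 0 \<and> (i \<notin> S \<longrightarrow> k = 1)"
    if i: "i \<in> {1..r}" for i
  proof (cases "i \<in> S")
    case True
    then have "branch_param (\<phi> i) (B i) (m i)"
      using puiseux_branch_param(1)[OF px[of i]] by (simp add: S_def m_def)
    moreover from this have "m i > 0" by (simp add: branch_param_def)
    ultimately show ?thesis using True by blast
  next
    case False
    then have "smooth_curve_at (B i) 0" using i by (simp add: S_def S_index_def)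
    then obtain \<psi> where "branch_param \<psi> (B i) 1" using smooth_curve_branch_param by blast
    moreover from this have "m i > 0" unfolding m_def by (rule multiplicity_germ_pos)
    ultimately show ?thesis by blast
  qed
  then obtain \<psi> k where bp: "\<And>i. i \<in> {1..r} \<Longrightarrow> branch_param (\<psi> i) (B i) (k i)"
    and k: "\<And>i. i \<in> {1..r} \<Longrightarrow> k i = m i \<or> k i = 1" "\<And>i. i \<in> {1..r} \<Longrightarrow> m i > 0"
      "\<And>i. i \<in> {1..r} \<Longrightarrow> i \<notin> S \<Longrightarrow> k i = 1"
    by metis
  \<comment> \<open>The exponent \<open>k\<close> is either the multiplicity or 1, and
    multiplicities are positive, so passing from exponents to multiplicities can only enlarge the
    gcd.\<close>
  have gcd_le: "gcd (k i) (k j) \<le> gcd (m i) (m j)" if "i \<in> {1..r}" "j \<in> {1..r}" for i j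
    using k(1)[OF that(1)] k(1)[OF that(2)] k(2)[OF that(1)] by (auto simp: Suc_le_eq)
  have "\<exists>P. finite P \<and> card P \<le> card (ChAM (B i) (\<phi> i)) - 1 \<and>
      (\<forall>L\<in>P. complex_plane L \<and> L \<subseteq> C5 X) \<and> (\<forall>v. secant_limit (B i) (B i) v \<longrightarrow> v \<in> \<Union>P)"
    if i: "i \<in> S" for i
  proof -
    have ir: "i \<in> {1..r}" and nsm: "\<not> smooth_curve_at (B i) 0" using i by (simp_all add: S_def S_index_def)
    have pi: "puiseux_param (\<phi> i) (B i)" using px i by (simp add: S_def)
    note bpi = puiseux_branch_param(1)[OF pi]
    obtain a where a: "\<forall>\<^sub>F u in nhds 0. \<phi> i u $ a = u ^ multiplicity_germ (B i)"
      using puiseux_branch_param(2)[OF pi] by blast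
    have "multiplicity_germ (B i) \<noteq> 1" using bpi nsm branch_param_1_smooth by metis
    moreover have "multiplicity_germ (B i) > 0" using bpi by (simp add: branch_param_def)
    ultimately have "multiplicity_germ (B i) \<ge> 2" by simp
    then show ?thesis
      using secant_limits_branch[OF bpi a puiseux_branch_param(3)[OF pi] refl _ BX[OF ir]] by blast
  qed
  then obtain P1 where P1: "\<And>i. i \<in> S \<Longrightarrow> finite (P1 i)"
    "\<And>i. i \<in> S \<Longrightarrow> card (P1 i) \<le> card (ChAM (B i) (\<phi> i)) - 1"
    "\<And>i L. i \<in> S \<Longrightarrow> L \<in> P1 i \<Longrightarrow> complex_plane L \<and> L \<subseteq> C5 X"
    "\<And>i v. i \<in> S \<Longrightarrow> secant_limit (B i) (B i) v \<Longrightarrow> v \<in> \<Union>(P1 i)" by metis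
  have "\<exists>P. finite P \<and> card P \<le> gcd (m i) (m j) \<and> (\<forall>L\<in>P. complex_plane L \<and> L \<subseteq> C5 X) \<and>
      (\<forall>v. secant_limit (B i) (B j) v \<longrightarrow> v \<in> \<Union>P)" if ij: "(i, j) \<in> T" for i j
  proof -
    have ir: "i \<in> {1..r}" "j \<in> {1..r}" and ne: "i \<noteq> j" and tc: "tangent_cone (B i) = tangent_cone (B j)"
      using ij by (simp_all add: T_def T_index_def)
    have "\<not> germ_le (B i) (B j)" using br ir ne by (simp add: branches_def)
    from secant_limits_same_tangent[OF bp[OF ir(1)] bp[OF ir(2)] tc this BX[OF ir(1)] BX[OF ir(2)]]
    show ?thesis using gcd_le[OF ir] by (meson order_trans)
  qed
  then have "\<forall>ij\<in>T. \<exists>P. finite P \<and> card P \<le> (case ij of (i, j) \<Rightarrow> gcd (m i) (m j)) \<and>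
      (\<forall>L\<in>P. complex_plane L \<and> L \<subseteq> C5 X) \<and>
      (\<forall>v. secant_limit (B (fst ij)) (B (snd ij)) v \<longrightarrow> v \<in> \<Union>P)" by auto
  then obtain P2 where P2: "\<And>ij. ij \<in> T \<Longrightarrow> finite (P2 ij)"
    "\<And>ij. ij \<in> T \<Longrightarrow> card (P2 ij) \<le> (case ij of (i, j) \<Rightarrow> gcd (m i) (m j))"
    "\<And>ij L. ij \<in> T \<Longrightarrow> L \<in> P2 ij \<Longrightarrow> complex_plane L \<and> L \<subseteq> C5 X"
    "\<And>ij v. ij \<in> T \<Longrightarrow> secant_limit (B (fst ij)) (B (snd ij)) v \<Longrightarrow> v \<in> \<Union>(P2 ij)" by metis
  have "\<forall>ij\<in>NT. \<exists>L. complex_plane L \<and> L \<subseteq> C5 X \<and>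
      (\<forall>v. secant_limit (B (fst ij)) (B (snd ij)) v \<longrightarrow> v \<in> L)"
  proof
    fix ij assume "ij \<in> NT"
    then have ir: "fst ij \<in> {1..r}" "snd ij \<in> {1..r}"
      and tc: "tangent_cone (B (fst ij)) \<noteq> tangent_cone (B (snd ij))"
      by (auto simp: NT_def NT_index_def)
    from secant_limits_distinct_tangents[OF bp[OF ir(1)] bp[OF ir(2)] tc BX[OF ir(1)] BX[OF ir(2)]]
    show "\<exists>L. complex_plane L \<and> L \<subseteq> C5 X \<and>
      (\<forall>v. secant_limit (B (fst ij)) (B (snd ij)) v \<longrightarrow> v \<in> L)" .
  qed
  then obtain P3 where P3: "\<And>ij. ij \<in> NT \<Longrightarrow> complex_plane (P3 ij) \<and> P3 ij \<subseteq> C5 X"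
    "\<And>ij v. ij \<in> NT \<Longrightarrow> secant_limit (B (fst ij)) (B (snd ij)) v \<Longrightarrow> v \<in> P3 ij" by metis
  define P where "P = (\<Union>i\<in>S. P1 i) \<union> (\<Union>ij\<in>T. P2 ij) \<union> P3 ` NT"
  have "S \<subseteq> {1..r}" "T \<subseteq> {1..r} \<times> {1..r}" "NT \<subseteq> {1..r} \<times> {1..r}"
    by (auto simp: S_def S_index_def T_def T_index_def NT_def NT_index_def)
  then have fin: "finite S" "finite T" "finite NT" by (auto intro: finite_subset)
  have finP: "finite P" unfolding P_def using fin P1(1) P2(1) by simp
  have planes: "complex_plane L \<and> L \<subseteq> C5 X" if "L \<in> P" for L
    using that P1(3) P2(3) P3(1) unfolding P_def by blast
  have lt: "v \<in> \<Union>P" if "i \<in> {1..r}" "j \<in> {1..r}" "i < j" "secant_limit (B i) (B j) v" for i j v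
  proof (cases "tangent_cone (B i) = tangent_cone (B j)")
    case True
    then have "(i, j) \<in> T" using that by (simp add: T_def T_index_def)
    then show ?thesis using P2(4)[of "(i, j)" v] that(4) unfolding P_def by auto
  next
    case False
    then have "(i, j) \<in> NT" using that by (simp add: NT_def NT_index_def)
    then show ?thesis using P3(2)[of "(i, j)" v] that(4) unfolding P_def by auto
  qed
  \<comment> \<open>The index sets contain only pairs with \<open>i < j\<close>; symmetry of secant
    limits covers the reversed pairs.\<close>
  have neq: "v \<in> \<Union>P" if "i \<in> {1..r}" "j \<in> {1..r}" "i \<noteq> j" "secant_limit (B i) (B j) v" for i j v
    using that lt secant_limit_sym by (metis linorder_neqE_nat)
  have C5_sub: "v \<in> \<Union>P" if v: "v \<in> C5 X" for v
  proof -
    obtain i j where ij: "i \<in> {1..r}" "j \<in> {1..r}" "secant_limit (B i) (B j) v"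
      using C5_secant_limit[OF eqX _ v] by auto
    consider "i \<noteq> j" | "i = j" "i \<in> S" | "i = j" "i \<notin> S" by blast
    then show ?thesis
    proof cases
      case 1
      then show ?thesis using neq ij by blast
    next
      case 2
      then show ?thesis using P1(4)[of i v] ij(3) unfolding P_def by blast
    next
      case 3
      have bpi: "branch_param (\<psi> i) (B i) 1" using bp[OF ij(1)] k(3)[OF ij(1) 3(2)] by simp
      \<comment> \<open>A smooth branch has no planes of its own. Its tangent vectors are also
        limits of secants to the origin, a point of any other branch \<open>l\<close>, and so lie in
        the planes of that pair. Without another branch \<open>X\<close> itself would be
        smooth.\<close>
      have "\<exists>l\<in>{1..r}. l \<noteq> i"
      proof (rule ccontr)
        assume "\<not> ?thesis"
        then have "{1..r} = {i}" using ij(1) by blast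
        then have "germ_eq X (B i)" using eqX by simp
        then have "germ_eq (B i) X" unfolding germ_eq_def by eventually_elim blast
        then have "smooth_curve_at X 0" using branch_param_1_smooth branch_param_germ_eq[OF bpi] by blast
        with ns show False by simp
      qed
      then obtain l where l: "l \<in> {1..r}" "l \<noteq> i" by blast
      have "coeff_vec (\<psi> i) 1 \<noteq> 0" using bpi by (simp add: branch_param_def)
      then obtain a where "coeff_vec (\<psi> i) 1 $ a \<noteq> 0" by (rule vec_nonzero_component)
      then obtain \<chi>' where \<chi>: "branch_param \<chi>' (B i) 1" "\<forall>\<^sub>F u in nhds 0. \<chi>' u $ a = u ^ 1"
        using branch_param_pure_coordinate[OF bpi] by blast
      have "v \<in> tangent_cone (B i)"
        using secant_limit_branch_cases[OF \<chi>, of v] ij(3) 3(1) by auto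
      then have "secant_limit (B i) (B l) v"
        using branch_param_at_0(2)[OF bp[OF l(1)]] by (rule tangent_secant_limit)
      then show ?thesis using neq[OF ij(1) l(1)] l(2) by blast
    qed
  qed
  \<comment> \<open>Equality matters here: components are defined by maximality inside the set, so
    an inclusion alone would not bound their number.\<close>
  have "C5 X = \<Union>P" using C5_sub planes by blast
  then have sub: "irreducible_components (C5 X) \<subseteq> P"
    using irreducible_components_planes[OF finP] planes by metis
  have "card (\<Union>i\<in>S. P1 i) \<le> (\<Sum>i\<in>S. card (P1 i))" using fin(1) by (rule card_UN_le)
  also have "\<dots> \<le> (\<Sum>i\<in>S. card (ChAM (B i) (\<phi> i)) - 1)" using P1(2) by (rule sum_mono)
  finally have c1: "card (\<Union>i\<in>S. P1 i) \<le> (\<Sum>i\<in>S. card (ChAM (B i) (\<phi> i)) - 1)" .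
  have "card (\<Union>ij\<in>T. P2 ij) \<le> (\<Sum>ij\<in>T. card (P2 ij))" using fin(2) by (rule card_UN_le)
  also have "\<dots> \<le> (\<Sum>(i, j)\<in>T. gcd (m i) (m j))" using P2(2) by (rule sum_mono)
  finally have c2: "card (\<Union>ij\<in>T. P2 ij) \<le> (\<Sum>(i, j)\<in>T. gcd (m i) (m j))" .
  have c3: "card (P3 ` NT) \<le> card NT" using fin(3) by (rule card_image_le)
  have "card P \<le> card ((\<Union>i\<in>S. P1 i) \<union> (\<Union>ij\<in>T. P2 ij)) + card (P3 ` NT)"
    unfolding P_def by (rule card_Un_le)
  also have "card ((\<Union>i\<in>S. P1 i) \<union> (\<Union>ij\<in>T. P2 ij))
      \<le> card (\<Union>i\<in>S. P1 i) + card (\<Union>ij\<in>T. P2 ij)" by (rule card_Un_le)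
  finally have "card P \<le> (\<Sum>i\<in>S. card (ChAM (B i) (\<phi> i)) - 1) + (\<Sum>(i, j)\<in>T. gcd (m i) (m j)) + card NT"
    using c1 c2 c3 by linarith
  moreover have "card (irreducible_components (C5 X)) \<le> card P" using finP sub by (rule card_mono)
  ultimately show ?thesis
    using finite_subset[OF sub finP] unfolding S_def T_def NT_def m_def by simp
qed

theorem proposition5p7:
  fixes X :: "(complex ^ 'n) set"
    and r :: nat
    and B :: "nat \<Rightarrow> (complex ^ 'n) set"
    and \<phi> :: "nat \<Rightarrow> complex \<Rightarrow> complex ^ 'n"
  assumes "CARD('n) \<ge> 2"
    and "curve_germ X"
    and "\<not> smooth_curve_at X 0"
    and "branches X r B"
    and "\<And>i. i \<in> S_index r B \<Longrightarrow> puiseux_param (\<phi> i) (B i)"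
  shows "finite (irreducible_components (C5 X)) \<and>
    card (irreducible_components (C5 X))
      \<le> (\<Sum>i\<in>S_index r B. card (ChAM (B i) (\<phi> i)) - 1)
        + (\<Sum>(i, j)\<in>T_index r B. gcd (multiplicity_germ (B i)) (multiplicity_germ (B j)))
        + card (NT_index r B) \<and>
    (irreducible_germ X \<longrightarrow>
      (\<forall>\<psi>. puiseux_param \<psi> X \<longrightarrow>
         card (irreducible_components (C5 X)) \<le> card (ChAM X \<psi>) - 1))"
proof -
  have "card (irreducible_components (C5 X)) \<le> card (ChAM X \<psi>) - 1"
    if "irreducible_germ X" "puiseux_param \<psi> X" for \<psi>
  proof -
    \<comment> \<open>An irreducible germ is its own only branch, and its singularity puts the index
      1 into the first sum; there are no pairs.\<close>
    have "branches X 1 (\<lambda>_. X)" using that(1) by (simp add: branches_def germ_eq_def)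
    moreover have "S_index 1 (\<lambda>_. X) = {1}" "T_index 1 (\<lambda>_. X) = {}" "NT_index 1 (\<lambda>_. X) = {}"
      using assms(3) by (auto simp: S_index_def T_index_def NT_index_def)
    ultimately show ?thesis
      using irreducible_components_C5_bound[OF assms(3), of 1 "\<lambda>_. X" "\<lambda>_. \<psi>"] that(2) by simp
  qed
  then show ?thesis using irreducible_components_C5_bound[OF assms(3-5)] by blast
qed

end
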